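(* Let $X$ be a quasi-Banach function space over $\mathbf{R}^d$ with the Fatou property, and suppose $M:X\to X$ is bounded. Then for all $0<\theta<1$: (a) $M:(X')^\theta\to(X')^\theta$ is bounded with $\|M\|_{(X')^\theta\to(X')^\theta}\lesssim_d\frac1{1-\theta}\|M\|_{X\to X}^\theta$; (b) $M:[(X')^\theta]'\to[(X')^\theta]'$ is bounded with $\|M\|_{[(X')^\theta]'\to[(X')^\theta]'}\lesssim_d\frac1\theta\|M\|_{X\to X}$; (c) $(X')^\theta\in A_{\mathrm{sparse}}$ with $[(X')^\theta]_{A_{\mathrm{sparse}}}\lesssim_d\frac1\theta\frac1{1-\theta}\|M\|_{X\to X}^{1+\theta}$.
   Context: A quasi-Banach function space over $\mathbf{R}^d$ is a complete quasi-normed space $X\subseteq L^0(\mathbf{R}^d)$ with the ideal property (if $f\in X$, $|g|\le|f|$ then $g\in X$, $\|g\|_X\le\|f\|_X$) and the saturation property (every set of positive measure contains a subset $F$ of positive measure with $\mathbf{1}_F\in X$). Köthe dual: $\|g\|_{X'}=\sup_{\|f\|_X=1}\int|fg|$. Fatou property: $0\le f_n\uparrow f$ a.e., $\sup\|f_n\|_X<\infty$ imply $f\in X$, $\|f\|_X=\sup\|f_n\|_X$. For $0<p<\infty$, $Y^p=\{f:|f|^{1/p}\in Y\}$, $\|f\|_{Y^p}=\||f|^{1/p}\|_Y^p$. $M$ is the Hardy–Littlewood maximal operator over axis-parallel cubes. A collection $\mathcal{S}$ of cubes is sparse if there are pairwise disjoint $E_Q\subseteq Q$ with $|E_Q|\ge\frac12|Q|$;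 $Y\in A_{\mathrm{sparse}}$ means there is $C$ with $\|\sum_{Q\in\mathcal{S}}(\frac1{|Q|}\int_Q|f|)\mathbf{1}_Q\|_Y\le C\|f\|_Y$ for all sparse $\mathcal{S}$ and $f\in Y$; the least such $C$ is $[Y]_{A_{\mathrm{sparse}}}$. *)

theory Defs
  imports "HOL-Analysis.Analysis"
begin

text \<open>A (quasi-)norm on functions over a Euclidean space is represented by an
  extended-valued functional N on real-valued functions; the space itself is
  the set of Lebesgue measurable functions of finite quasi-norm.\<close>

type_synonym 'a fnorm = "('a \<Rightarrow> real) \<Rightarrow> ennreal"

definition fspace :: "'a::euclidean_space fnorm \<Rightarrow> ('a \<Rightarrow> real) set" where
  "fspace N = {f \<in> borel_measurable lebesgue. N f < \<infinity>}"

definition quasi_banach_function_space :: "'a::euclidean_space fnorm \<Rightarrow> bool" where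
  "quasi_banach_function_space N \<longleftrightarrow>
     \<comment> \<open>quasi-norm axioms\<close>
     (\<exists>K::real. K \<ge> 1 \<and> (\<forall>f\<in>fspace N. \<forall>g\<in>fspace N.
          N (\<lambda>x. f x + g x) \<le> ennreal K * (N f + N g))) \<and>
     (\<forall>f\<in>fspace N. \<forall>c::real. N (\<lambda>x. c * f x) = ennreal \<bar>c\<bar> * N f) \<and>
     (\<forall>f\<in>fspace N. N f = 0 \<longleftrightarrow> (AE x in lebesgue. f x = 0)) \<and>
     \<comment> \<open>ideal property\<close>
     (\<forall>f \<in> borel_measurable lebesgue. \<forall>g \<in> borel_measurable lebesgue.
        (AE x in lebesgue. \<bar>g x\<bar> \<le> \<bar>f x\<bar>) \<longrightarrow> N g \<le> N f) \<and>
     \<comment> \<open>saturation property\<close>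
     (\<forall>E \<in> sets lebesgue. emeasure lebesgue E > 0 \<longrightarrow>
        (\<exists>F \<in> sets lebesgue. F \<subseteq> E \<and> emeasure lebesgue F > 0 \<and>
            indicator F \<in> fspace N)) \<and>
     \<comment> \<open>completeness\<close>
     (\<forall>u::nat \<Rightarrow> 'a \<Rightarrow> real. (\<forall>n. u n \<in> fspace N) \<longrightarrow>
        (\<forall>e>0. \<exists>n0. \<forall>m\<ge>n0. \<forall>n\<ge>n0. N (\<lambda>x. u m x - u n x) < e) \<longrightarrow>
        (\<exists>f\<in>fspace N. (\<lambda>n. N (\<lambda>x. u n x - f x)) \<longlonglongrightarrow> 0))"

definition fatou_property :: "'a::euclidean_space fnorm \<Rightarrow> bool" where
  "fatou_property N \<longleftrightarrow>
     (\<forall>(fs::nat \<Rightarrow> 'a \<Rightarrow> real) f.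
        (\<forall>n. fs n \<in> borel_measurable lebesgue) \<longrightarrow> f \<in> borel_measurable lebesgue \<longrightarrow>
        (AE x in lebesgue. (\<forall>n. 0 \<le> fs n x \<and> fs n x \<le> fs (Suc n) x) \<and>
                           (\<lambda>n. fs n x) \<longlonglongrightarrow> f x) \<longrightarrow>
        (SUP n. N (fs n)) < \<infinity> \<longrightarrow>
        f \<in> fspace N \<and> N f = (SUP n. N (fs n)))"

definition koethe_dual :: "'a::euclidean_space fnorm \<Rightarrow> 'a fnorm" where
  "koethe_dual N g = (SUP f\<in>{f \<in> borel_measurable lebesgue. N f = 1}.
       \<integral>\<^sup>+ x. ennreal \<bar>f x * g x\<bar> \<partial>lebesgue)"

text \<open>Real powers of extended nonnegative reals (p > 0).\<close>
definition epowr :: "ennreal \<Rightarrow> real \<Rightarrow> ennreal" where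
  "epowr a p = (if a = \<infinity> then \<infinity> else ennreal (enn2real a powr p))"

definition fpower :: "'a::euclidean_space fnorm \<Rightarrow> real \<Rightarrow> 'a fnorm" where
  "fpower N p f = epowr (N (\<lambda>x. \<bar>f x\<bar> powr (1 / p))) p"

definition is_cube :: "'a::euclidean_space set \<Rightarrow> bool" where
  "is_cube Q \<longleftrightarrow> (\<exists>a h. h > 0 \<and> Q = cbox a (a + h *\<^sub>R One))"

definition avg :: "('a::euclidean_space \<Rightarrow> real) \<Rightarrow> 'a set \<Rightarrow> ennreal" where
  "avg f Q = (\<integral>\<^sup>+ x \<in> Q. ennreal \<bar>f x\<bar> \<partial>lebesgue) / emeasure lebesgue Q"

definition maximal_op :: "('a::euclidean_space \<Rightarrow> real) \<Rightarrow> 'a \<Rightarrow> ennreal" where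
  "maximal_op f x = (SUP Q\<in>{Q. is_cube Q \<and> x \<in> Q}. avg f Q)"

definition sparse :: "'a::euclidean_space set set \<Rightarrow> bool" where
  "sparse S \<longleftrightarrow> (\<forall>Q\<in>S. is_cube Q) \<and>
     (\<exists>E. disjoint_family_on E S \<and>
        (\<forall>Q\<in>S. E Q \<subseteq> Q \<and> E Q \<in> sets lebesgue \<and>
                 emeasure lebesgue (E Q) \<ge> emeasure lebesgue Q / 2))"

text \<open>The sparse operator, sum over Q in S of avg f Q times the indicator of Q
  (possibly infinite family: supremum of finite partial sums).\<close>
definition sparse_op :: "'a::euclidean_space set set \<Rightarrow> ('a \<Rightarrow> real) \<Rightarrow> 'a \<Rightarrow> ennreal" where
  "sparse_op S f x = (SUP F\<in>{F. finite F \<and> F \<subseteq> S}.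
       \<Sum>Q\<in>F. avg f Q * indicator Q x)"

definition bounded_on :: "'a::euclidean_space fnorm \<Rightarrow> (('a \<Rightarrow> real) \<Rightarrow> 'a \<Rightarrow> ennreal) \<Rightarrow> real \<Rightarrow> bool" where
  "bounded_on N T C \<longleftrightarrow> (\<forall>f\<in>fspace N.
       (AE x in lebesgue. T f x < \<infinity>) \<and>
       (\<lambda>x. enn2real (T f x)) \<in> borel_measurable lebesgue \<and>
       N (\<lambda>x. enn2real (T f x)) \<le> ennreal C * N f)"

definition A_sparse :: "'a::euclidean_space fnorm \<Rightarrow> real \<Rightarrow> bool" where
  "A_sparse N C \<longleftrightarrow> (\<forall>S. sparse S \<longrightarrow> bounded_on N (sparse_op S) C)"

end

theory Submission
  imports Defs
begin

text \<open>
  Put \<open>p = 1 / \<theta>\<close> and \<open>Y = (X')\<^sup>\<theta>\<close>, so that the \<open>p\<close>-th power of the norm of \<open>g\<close> in \<open>Y\<close> is the supremum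
  of the integrals of \<open>\<bar>g\<bar>\<^sup>p \<bar>f\<bar>\<close> over the unit sphere of \<open>X\<close>. By the one-third trick \<open>M\<close> is
  dominated by finitely many dyadic maximal operators.

  (a) The Fefferman-Stein inequality bounds the integral of \<open>(M g)\<^sup>p \<bar>f\<bar>\<close> by \<open>c\<^sup>p p'\<close> times that of
  \<open>\<bar>g\<bar>\<^sup>p M f\<close>.

  (b) For a linearised dyadic maximal operator with adjoint \<open>T\<close>, summation along chains of dyadic cubes
  bounds the integral of \<open>(T k)\<^sup>p \<bar>f\<bar>\<close> by \<open>p\<close> times that of \<open>\<bar>k\<bar> (T k)\<^bsup>p - 1\<^esup> M f\<close>. Young's
  inequality and the supremum over \<open>f\<close> allow the power of \<open>T k\<close> to be absorbed, so that \<open>T\<close> has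
  norm at most \<open>p C\<close> on \<open>Y\<close>.

  (c) For a sparse operator \<open>A\<close>, the integral of \<open>(A g)\<^sup>p \<bar>f\<bar>\<close> is the pairing of \<open>A g\<close> with
  \<open>h = (A g)\<^bsup>p - 1\<^esup> \<bar>f\<bar>\<close>, which is at most twice the pairing of \<open>M g\<close> with \<open>M h\<close>; then (a) and
  (b) apply and the norm of \<open>h\<close> is absorbed.
\<close>

section \<open>Powers of extended nonnegative reals\<close>

text \<open>The obstacle is finiteness. In (b) a multiple of an unknown norm is subtracted, and in
  (c) a power of one is cancelled; both are meaningless unless that norm is finite beforehand. Hence
  the estimates are proved for finitely many cubes, where the function in question is a step
  function of bounded support, and the general case follows by monotone convergence. Step functions
  lie in Y because indicators of cubes lie in X', and this is forced by the boundedness of M on X.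
  The constants: each of the 2^d grids supplies cells up to 6^d times as large as the cubes they
  replace, which explains the dependence on the dimension d. In (a) C sits under the p-th root and
  becomes C^\<theta>. In (b) the bound for the p-th power is (p C)^p, the outcome of using p C as
  the weight in Young's inequality, so its root is linear in C and carries the factor p = 1 /
  \<theta>. In (c) the two bounds are multiplied.\<close>

lemma epowr_ennreal:
  assumes "r \<ge> 0" shows "epowr (ennreal r) p = ennreal (r powr p)"
  using assms by (simp add: epowr_def)

lemma epowr_top [simp]: "epowr top p = top"
  by (simp add: epowr_def)

lemma epowr_zero [simp]: "epowr 0 p = 0"
  by (simp add: epowr_def)

lemma epowr_eq_top_iff [simp]: "epowr a p = top \<longleftrightarrow> a = top"
  by (simp add: epowr_def)

lemma epowr_mono:
  assumes "p > 0" "a \<le> b" shows "epowr a p \<le> epowr b p"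
proof (cases "b = top")
  case False
  then have "a \<noteq> top" using assms(2) by (auto simp: top_unique)
  with False assms show ?thesis
    by (cases a; cases b) (auto simp: epowr_ennreal intro!: ennreal_leI powr_mono2)
qed simp

lemma epowr_epowr:
  assumes "p > 0" "q > 0" shows "epowr (epowr a p) q = epowr a (p * q)"
  using assms by (cases a) (auto simp: epowr_ennreal powr_powr)

lemma epowr_one [simp]: "epowr a 1 = a"
  by (cases a) (auto simp: epowr_ennreal)

lemma epowr_inverse:
  assumes "p > 0" shows "epowr (epowr a (1 / p)) p = a" "epowr (epowr a p) (1 / p) = a"
  using assms by (simp_all add: epowr_epowr)

lemma epowr_le_iff:
  assumes "p > 0" shows "epowr a p \<le> b \<longleftrightarrow> a \<le> epowr b (1 / p)"
  using epowr_mono[of p a "epowr b (1/p)"] epowr_mono[of "1/p" "epowr a p" b] assms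
  by (auto simp: epowr_inverse)

lemma epowr_mult:
  assumes "p > 0" shows "epowr (a * b) p = epowr a p * epowr b p"
proof (cases "a = 0 \<or> b = 0")
  case False
  show ?thesis
  proof (cases "a = top \<or> b = top")
    case True
    with False have "a * b = top" by (auto simp: ennreal_mult_top ennreal_top_mult)
    moreover have "epowr a p \<noteq> 0" "epowr b p \<noteq> 0"
      using False assms by (cases a; cases b; auto simp: epowr_ennreal)+
    ultimately show ?thesis using True by (auto simp: ennreal_mult_top ennreal_top_mult)
  next
    case False
    then obtain r s where "a = ennreal r" "r \<ge> 0" "b = ennreal s" "s \<ge> 0"
      by (metis ennreal_cases)
    then show ?thesis
      by (simp add: epowr_ennreal powr_mult flip: ennreal_mult)
  qed
qed auto

text \<open>\<open>epowr _ p\<close> is an order isomorphism with inverse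
  \<open>epowr _ (1 / p)\<close>, so it commutes with arbitrary suprema. This lets monotone limits
  pass through p-th powers.\<close>

lemma epowr_SUP:
  assumes "p > 0" shows "epowr (SUP i\<in>I. a i) p = (SUP i\<in>I. epowr (a i) p)"
proof (rule antisym)
  show "epowr (SUP i\<in>I. a i) p \<le> (SUP i\<in>I. epowr (a i) p)"
    unfolding epowr_le_iff[OF assms] by (rule SUP_least, subst epowr_le_iff[OF assms, symmetric], rule SUP_upper)
  show "(SUP i\<in>I. epowr (a i) p) \<le> epowr (SUP i\<in>I. a i) p"
    by (intro SUP_least epowr_mono assms SUP_upper)
qed

text \<open>Each of the n terms is compared with the largest one, so the factor is n^p rather than
  the sharper n^(p - 1). After taking p-th roots this still costs only a factor n.\<close>

lemma epowr_sum_le: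
  assumes "finite I" "p > 0"
  shows "epowr (\<Sum>i\<in>I. a i) p \<le> epowr (of_nat (card I)) p * (\<Sum>i\<in>I. epowr (a i) p)"
proof (cases "I = {}")
  case False
  define m where "m = Max (a ` I)"
  have "m \<in> a ` I" using False assms by (simp add: m_def)
  then obtain j where j: "j \<in> I" "m = a j" by auto
  have "(\<Sum>i\<in>I. a i) \<le> (\<Sum>i\<in>I. a j)"
    unfolding j(2)[symmetric] using assms by (intro sum_mono) (auto simp: m_def)
  also have "\<dots> = of_nat (card I) * a j" by simp
  finally have "epowr (\<Sum>i\<in>I. a i) p \<le> epowr (of_nat (card I)) p * epowr (a j) p"
    unfolding epowr_mult[OF assms(2), symmetric] by (rule epowr_mono[OF assms(2)])
  also have "\<dots> \<le> epowr (of_nat (card I)) p * (\<Sum>i\<in>I. epowr (a i) p)"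
    using assms j by (intro mult_left_mono member_le_sum) auto
  finally show ?thesis .
qed simp

lemma borel_measurable_epowr [measurable]:
  assumes [measurable]: "f \<in> borel_measurable M"
  shows "(\<lambda>x. epowr (f x) p) \<in> borel_measurable M"
  unfolding epowr_def by measurable

section \<open>Tangent-line inequalities for real powers\<close>

lemma powr_tangent_le:
  assumes "p > 1" "a \<ge> 0" "b \<ge> (0::real)"
  shows "p * a * b powr (p - 1) \<le> a powr p + (p - 1) * b powr p"
proof -
  define q where "q = p / (p - 1)"
  have q: "q > 1" "1/p + 1/q = 1" using assms by (auto simp: q_def field_simps)
  have "a * b powr (p - 1) \<le> a powr p / p + (b powr (p - 1)) powr q / q"
    by (rule Youngs_inequality) (use assms q in auto)
  also have "(b powr (p - 1)) powr q = b powr p"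
    using assms by (simp add: powr_powr q_def)
  finally have "p * (a * b powr (p - 1)) \<le> p * (a powr p / p + b powr p / q)"
    using assms by (intro mult_left_mono) auto
  also have "\<dots> = a powr p + (p - 1) * b powr p"
    using assms by (simp add: q_def field_simps)
  finally show ?thesis by (simp add: mult.assoc)
qed

text \<open>The tangent to t^p at a + b, evaluated at b. This is the discrete form of d(t^p) = p
  t^(p - 1) dt with the slope taken at the upper end, made for telescoping sums.\<close>

lemma powr_increment_le:
  assumes "p > 1" "a \<ge> 0" "b \<ge> (0::real)"
  shows "(a + b) powr p \<le> b powr p + p * a * (a + b) powr (p - 1)"
proof -
  define Z where "Z = (a + b) powr (p - 1)"
  have W: "(a + b) powr p = (a + b) * Z"
    using assms by (cases "a + b = 0") (auto simp: Z_def powr_diff)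
  have "p * b * Z \<le> b powr p + (p - 1) * (a + b) powr p"
    unfolding Z_def using assms by (intro powr_tangent_le) auto
  then show ?thesis
    unfolding W Z_def[symmetric] by (simp add: algebra_simps)
qed

section \<open>Sigma-finiteness and the layer-cake integral\<close>

lemma sigma_finite_lebesgue: "sigma_finite_measure (lebesgue :: 'a::euclidean_space measure)"
proof
  have "\<exists>A::'a set set. countable A \<and> A \<subseteq> sets lborel \<and> \<Union>A = space lborel
      \<and> (\<forall>a\<in>A. emeasure lborel a \<noteq> \<infinity>)"
    by (rule lborel.sigma_finite_countable)
  then obtain A :: "'a set set" where A: "countable A" "A \<subseteq> sets lborel" "\<Union>A = space lborel"
      "\<forall>a\<in>A. emeasure lborel a \<noteq> \<infinity>"
    by (elim exE conjE)
  have "emeasure lebesgue a \<noteq> \<infinity>" if "a \<in> A" for a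
  proof -
    have "a \<in> sets lborel" using A(2) that by (rule subsetD)
    then have "emeasure lebesgue a = emeasure lborel a" by simp
    then show ?thesis using bspec[OF A(4) that] by argo
  qed
  moreover have "A \<subseteq> sets lebesgue"
    by (rule subsetI) (rule sets_completionI_sets, rule subsetD[OF A(2)])
  moreover have "\<Union>A = space lebesgue"
    using A(3) by (simp only: space_completion)
  ultimately show "\<exists>A::'a set set. countable A \<and> A \<subseteq> sets lebesgue \<and> \<Union>A = space lebesgue
      \<and> (\<forall>a\<in>A. emeasure lebesgue a \<noteq> \<infinity>)"
    using A(1) by (intro exI[of _ A] conjI ballI)
qed

text \<open>The condition t < a is kept as a factor in an integral over the whole line, so that the
  two integrations can be exchanged when a depends on x. It is applied with r = p to the level sets
  of a maximal function and with r = p - 1 to those of g.\<close>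

lemma nn_integral_layer_powr:
  assumes "r > 0" "a \<ge> 0"
  shows "(\<integral>\<^sup>+t. indicator {0<..} t * ennreal (t powr (r - 1)) * (if t < a then 1 else 0) \<partial>lborel)
    = ennreal (a powr r / r)"
proof -
  have "((\<lambda>t. t powr (r - 1)) has_integral (a powr r / r)) {0..a}"
    using has_integral_powr_from_0[of "r - 1" a] assms by simp
  then have "(\<integral>\<^sup>+t. ennreal (t powr (r - 1)) * indicator {0..a} t \<partial>lborel) = ennreal (a powr r / r)"
    by (intro nn_integral_has_integral_lebesgue') auto
  moreover have "AE t in lborel. t \<noteq> a"
    by (rule AE_lborel_singleton)
  then have "(\<integral>\<^sup>+t. ennreal (t powr (r - 1)) * indicator {0..a} t \<partial>lborel)
    = (\<integral>\<^sup>+t. indicator {0<..} t * ennreal (t powr (r - 1)) * (if t < a then 1 else 0) \<partial>lborel)"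
    by (intro nn_integral_cong_AE, eventually_elim) (auto simp: indicator_def)
  ultimately show ?thesis by simp
qed

section \<open>Adjacent dyadic grids\<close>

text \<open>
  The shift alternates in sign with the level \<open>k\<close>: this is what keeps the cells of a shifted grid nested.
  A coordinate in \<open>A\<close> is shifted by a third of the side length.
\<close>

definition shift :: "'a set \<Rightarrow> int \<Rightarrow> 'a \<Rightarrow> real" where
  "shift A k b = (if b \<in> A then if even k then 1 / 3 else - 1 / 3 else 0)"

text \<open>Half-open cubes of side \<open>2 powr k\<close>, so larger k means larger cells. Naming
  a cell by the floors of its rescaled coordinates turns nesting into integer arithmetic.\<close>

definition cell :: "'a::euclidean_space set \<Rightarrow> int \<Rightarrow> ('a \<Rightarrow> int) \<Rightarrow> 'a set" where
  "cell A k \<phi> = {y. \<forall>b\<in>Basis. \<lfloor>(y \<bullet> b) / 2 powr k - shift A k b\<rfloor> = \<phi> b}"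

definition grid :: "'a::euclidean_space set \<Rightarrow> 'a set set" where
  "grid A = (\<lambda>(k, \<phi>). cell A k \<phi>) ` (UNIV \<times> (Basis \<rightarrow>\<^sub>E UNIV))"

lemma cell_in_grid: "cell A k \<phi> \<in> grid A"
proof -
  have "cell A k \<phi> = cell A k (restrict \<phi> Basis)"
    by (auto simp: cell_def)
  then show ?thesis
    unfolding grid_def by (intro image_eqI[of _ _ "(k, restrict \<phi> Basis)"]) auto
qed

lemma countable_grid: "countable (grid A)"
  unfolding grid_def by (intro countable_image countable_SIGMA countable_PiE finite_Basis countableI_type)

text \<open>In a shifted coordinate the shift at level k minus twice the shift at level k + 1 is 1/3
  + 2/3 or its negative, an integer. It can therefore be pulled out of the floor, and the floor at
  level k determines the one at level k + 1.\<close>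

lemma floor_cell_step:
  "\<lfloor>v / 2 powr (real_of_int (k + 1)) - shift A (k + 1) b\<rfloor> =
    (\<lfloor>v / 2 powr k - shift A k b\<rfloor> + (if b \<in> A then if even k then 1 else - 1 else 0)) div 2"
proof -
  define e :: int where "e = (if b \<in> A then if even k then 1 else - 1 else 0)"
  define y where "y = v / 2 powr k - shift A k b"
  have "v / 2 powr (real_of_int (k + 1)) - shift A (k + 1) b = (y + of_int e) / real_of_int 2"
    by (auto simp: y_def e_def shift_def powr_add field_simps)
  also have "\<lfloor>\<dots>\<rfloor> = \<lfloor>y + of_int e\<rfloor> div 2"
    by (rule floor_divide_real_eq_div) simp
  finally show ?thesis by (simp add: y_def e_def)
qed

lemma floor_cell_mono:
  assumes "k \<le> l" "\<lfloor>v / 2 powr k - shift A k b\<rfloor> = \<lfloor>w / 2 powr k - shift A k b\<rfloor>"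
  shows "\<lfloor>v / 2 powr l - shift A l b\<rfloor> = \<lfloor>w / 2 powr l - shift A l b\<rfloor>"
  using assms(1)
proof (induction l rule: int_ge_induct)
  case (step l)
  then show ?case unfolding floor_cell_step by simp
qed (rule assms(2))

lemma cell_nested:
  assumes "k \<le> l" "z \<in> cell A k \<phi>" "z \<in> cell A l \<psi>"
  shows "cell A k \<phi> \<subseteq> cell A l \<psi>"
proof
  fix y assume y: "y \<in> cell A k \<phi>"
  have "\<lfloor>(y \<bullet> b) / 2 powr l - shift A l b\<rfloor> = \<psi> b" if b: "b \<in> Basis" for b
  proof -
    have "\<lfloor>(y \<bullet> b) / 2 powr l - shift A l b\<rfloor> = \<lfloor>(z \<bullet> b) / 2 powr l - shift A l b\<rfloor>"
      using y assms(2) b by (intro floor_cell_mono[OF assms(1)]) (simp add: cell_def)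
    then show ?thesis using assms(3) b by (simp add: cell_def)
  qed
  then show "y \<in> cell A l \<psi>" by (simp add: cell_def)
qed

section \<open>Measures of cubes and cells, and averages over them\<close>

lemma emeasure_cube:
  assumes "h \<ge> 0"
  shows "emeasure lebesgue (cbox a (a + h *\<^sub>R One :: 'a::euclidean_space)) = ennreal (h ^ DIM('a))"
proof -
  have "emeasure lborel (cbox a (a + h *\<^sub>R One)) = ennreal (\<Prod>b\<in>Basis. (a + h *\<^sub>R One - a) \<bullet> b)"
    using assms by (intro emeasure_lborel_cbox) (simp add: inner_add_left)
  also have "(\<Prod>b\<in>Basis. (a + h *\<^sub>R One - a) \<bullet> b) = (\<Prod>b\<in>(Basis::'a set). h)"
    by (intro prod.cong) auto
  finally show ?thesis by simp
qed

lemma emeasure_open_cube: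
  assumes "h \<ge> 0"
  shows "emeasure lebesgue (box a (a + h *\<^sub>R One :: 'a::euclidean_space)) = ennreal (h ^ DIM('a))"
proof -
  have "emeasure lborel (box a (a + h *\<^sub>R One)) = ennreal (\<Prod>b\<in>Basis. (a + h *\<^sub>R One - a) \<bullet> b)"
    using assms by (intro emeasure_lborel_box) (simp add: inner_add_left)
  also have "(\<Prod>b\<in>Basis. (a + h *\<^sub>R One - a) \<bullet> b) = (\<Prod>b\<in>(Basis::'a set). h)"
    by (intro prod.cong) auto
  finally show ?thesis by simp
qed

definition cell_corner :: "'a::euclidean_space set \<Rightarrow> int \<Rightarrow> ('a \<Rightarrow> int) \<Rightarrow> 'a" where
  "cell_corner A k \<phi> = (\<Sum>b\<in>Basis. (2 powr k * (of_int (\<phi> b) + shift A k b)) *\<^sub>R b)"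

lemma mem_cell_iff:
  "y \<in> cell A k \<phi> \<longleftrightarrow> (\<forall>b\<in>Basis. cell_corner A k \<phi> \<bullet> b \<le> y \<bullet> b \<and>
     y \<bullet> b < cell_corner A k \<phi> \<bullet> b + 2 powr k)"
proof -
  have "\<lfloor>(y \<bullet> b) / 2 powr k - shift A k b\<rfloor> = \<phi> b \<longleftrightarrow>
    cell_corner A k \<phi> \<bullet> b \<le> y \<bullet> b \<and> y \<bullet> b < cell_corner A k \<phi> \<bullet> b + 2 powr k"
    if "b \<in> Basis" for b
  proof -
    have P: "2 powr real_of_int k > (0::real)" by simp
    have "cell_corner A k \<phi> \<bullet> b = 2 powr k * (of_int (\<phi> b) + shift A k b)"
      using that by (simp add: cell_corner_def)
    then show ?thesis using P by (simp add: floor_eq_iff field_simps)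
  qed
  then show ?thesis by (simp add: cell_def)
qed

lemma cell_subset_cube:
  "cell A k \<phi> \<subseteq> cbox (cell_corner A k \<phi>) (cell_corner A k \<phi> + 2 powr k *\<^sub>R One)"
  by (auto simp: mem_cell_iff mem_box inner_add_left less_imp_le)

lemma open_cube_subset_cell:
  "box (cell_corner A k \<phi>) (cell_corner A k \<phi> + 2 powr k *\<^sub>R One) \<subseteq> cell A k \<phi>"
  by (auto simp: mem_cell_iff mem_box inner_add_left less_imp_le)

lemma sets_cell: "cell A k (\<phi> :: 'a::euclidean_space \<Rightarrow> int) \<in> sets lebesgue"
proof -
  have "cell A k \<phi> = (\<Inter>b\<in>Basis. {y. cell_corner A k \<phi> \<bullet> b \<le> y \<bullet> b} \<inter>
    {y. y \<bullet> b < cell_corner A k \<phi> \<bullet> b + 2 powr k})"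
    by (auto simp: mem_cell_iff)
  also have "\<dots> \<in> sets borel"
    by (intro sets.finite_INT sets.Int) (auto simp: inner_commute)
  finally show ?thesis by (rule sets_completionI_sets[of _ lborel, simplified])
qed

lemma emeasure_cell:
  "emeasure lebesgue (cell A k (\<phi> :: 'a::euclidean_space \<Rightarrow> int)) = ennreal ((2 powr k) ^ DIM('a))"
proof (rule antisym)
  let ?a = "cell_corner A k \<phi>"
  have "emeasure lebesgue (cell A k \<phi>) \<le> emeasure lebesgue (cbox ?a (?a + 2 powr k *\<^sub>R One))"
    by (intro emeasure_mono cell_subset_cube) simp
  also have "\<dots> = ennreal ((2 powr k) ^ DIM('a))" by (rule emeasure_cube) simp
  finally show "emeasure lebesgue (cell A k \<phi>) \<le> ennreal ((2 powr k) ^ DIM('a))" .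
  have "ennreal ((2 powr k) ^ DIM('a)) = emeasure lebesgue (box ?a (?a + 2 powr k *\<^sub>R One))"
    by (rule emeasure_open_cube[symmetric]) simp
  also have "\<dots> \<le> emeasure lebesgue (cell A k \<phi>)"
    by (intro emeasure_mono open_cube_subset_cell sets_cell)
  finally show "ennreal ((2 powr k) ^ DIM('a)) \<le> emeasure lebesgue (cell A k \<phi>)" .
qed

lemma divide_mono_ennreal:
  fixes a b c d :: ennreal
  assumes "a \<le> b" "d \<le> c" shows "a / c \<le> b / d"
proof -
  have "inverse c \<le> inverse d"
  proof (cases "c = top \<or> d = 0")
    case False
    then obtain r s where rs: "c = ennreal r" "d = ennreal s" "r \<ge> 0" "s \<ge> 0"
      using assms(2) by (metis ennreal_cases top.extremum_unique)
    then have "0 < s" "s \<le> r" using False assms(2) by (auto simp: less_le)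
    then show ?thesis by (simp add: rs inverse_ennreal ennreal_leI le_imp_inverse_le)
  qed auto
  then show ?thesis unfolding divide_ennreal_def using assms(1) by (intro mult_mono) auto
qed

lemma avg_le_avg_superset:
  assumes "Q \<subseteq> R" "emeasure lebesgue R \<le> emeasure lebesgue Q"
  shows "avg f Q \<le> avg f R"
  unfolding avg_def using assms
  by (intro divide_mono_ennreal nn_integral_mono mult_left_mono) (auto simp: indicator_def)

text \<open>A cell is half-open and so not a cube in the sense of \<open>is_cube\<close>, but the
  closed cube with the same corners has the same measure and at least the same mass.\<close>

lemma avg_cell_le_maximal:
  assumes "x \<in> cell A k \<phi>" shows "avg f (cell A k \<phi>) \<le> maximal_op f x"
proof -
  let ?Q = "cbox (cell_corner A k \<phi>) (cell_corner A k \<phi> + 2 powr k *\<^sub>R One)"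
  have "avg f (cell A k \<phi>) \<le> avg f ?Q"
    by (rule avg_le_avg_superset[OF cell_subset_cube]) (simp only: emeasure_cell emeasure_cube powr_ge_zero order_refl)
  also have "\<dots> \<le> maximal_op f x"
    unfolding maximal_op_def using assms cell_subset_cube
    by (intro SUP_upper) (auto simp: is_cube_def intro!: exI[of _ "cell_corner A k \<phi>"] exI[of _ "2 powr k"])
  finally show ?thesis .
qed

text \<open>One-third trick in one coordinate. If the interval from v to v + \<eta> crosses an
  integer m, both ends lie within 1/3 of m, and a translation by 1/3 in either direction moves the
  whole interval strictly between two consecutive integers. Both signs occur because
  \<open>shift\<close> alternates.\<close>

lemma floor_shift_third:
  fixes v s \<eta> :: real
  assumes "0 \<le> \<eta>" "\<eta> < 1 / 3" "s = 1 / 3 \<or> s = - 1 / 3" "\<lfloor>v\<rfloor> \<noteq> \<lfloor>v + \<eta>\<rfloor>"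
  shows "\<lfloor>v - s\<rfloor> = \<lfloor>v + \<eta> - s\<rfloor>"
proof -
  define m where "m = \<lfloor>v + \<eta>\<rfloor>"
  have "\<lfloor>v\<rfloor> \<le> m" unfolding m_def using assms(1) by (intro floor_mono) simp
  with assms(4) have "\<lfloor>v\<rfloor> < m" by (simp add: m_def)
  then have 1: "v < m" by (simp add: floor_less_iff)
  have 2: "m \<le> v + \<eta>" by (simp add: m_def)
  from assms(3) show ?thesis
  proof
    assume s: "s = 1 / 3"
    have "\<lfloor>v - s\<rfloor> = m - 1" "\<lfloor>v + \<eta> - s\<rfloor> = m - 1"
      using 1 2 assms(1,2) s by (auto intro!: floor_unique)
    then show ?thesis by simp
  next
    assume s: "s = - 1 / 3"
    have "\<lfloor>v - s\<rfloor> = m" "\<lfloor>v + \<eta> - s\<rfloor> = m"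
      using 1 2 assms(1,2) s by (auto intro!: floor_unique)
    then show ?thesis by simp
  qed
qed

lemma cube_subset_cell:
  fixes a :: "'a::euclidean_space"
  assumes "h > 0"
  obtains A k \<phi> where "A \<subseteq> Basis" "cbox a (a + h *\<^sub>R One) \<subseteq> cell A k \<phi>" "2 powr k \<le> 6 * h"
proof -
  \<comment> \<open>The least level with 3 h < \<open>2 powr k\<close>. Relative to a cell the cube
    then has side below 1/3, and minimality of k gives the bound 6 h.\<close>
  define k where "k = \<lfloor>log 2 (3 * h)\<rfloor> + 1"
  have "log 2 (3 * h) < k" unfolding k_def by linarith
  then have k1: "3 * h < 2 powr k" using assms by (simp add: log_less_iff)
  have "k - 1 \<le> log 2 (3 * h)" unfolding k_def by simp
  then have "2 powr (real_of_int k - 1) \<le> 3 * h" using assms by (simp add: le_log_iff)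
  then have k2: "2 powr k \<le> 6 * h" by (simp add: powr_diff)
  have P: "2 powr real_of_int k > (0::real)" by simp
  define \<eta> where "\<eta> = h / 2 powr k"
  have \<eta>: "0 \<le> \<eta>" "\<eta> < 1 / 3" using k1 assms P by (auto simp: \<eta>_def field_simps)
  define v where "v = (\<lambda>b. (a \<bullet> b) / 2 powr k)"
  \<comment> \<open>Exactly those coordinates are shifted in which the unshifted grid of level k
    cuts the cube.\<close>
  define A where "A = {b\<in>Basis. \<lfloor>v b\<rfloor> \<noteq> \<lfloor>v b + \<eta>\<rfloor>}"
  define \<phi> where "\<phi> = (\<lambda>b. \<lfloor>v b - shift A k b\<rfloor>)"
  have eq: "\<lfloor>v b - shift A k b\<rfloor> = \<lfloor>v b + \<eta> - shift A k b\<rfloor>" if "b \<in> Basis" for b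
  proof (cases "b \<in> A")
    case True
    then show ?thesis using \<eta> by (intro floor_shift_third) (auto simp: shift_def A_def)
  next
    case False
    then show ?thesis using that by (auto simp: shift_def A_def)
  qed
  have "cbox a (a + h *\<^sub>R One) \<subseteq> cell A k \<phi>"
  proof
    fix y assume y: "y \<in> cbox a (a + h *\<^sub>R One)"
    have "\<lfloor>(y \<bullet> b) / 2 powr k - shift A k b\<rfloor> = \<phi> b" if b: "b \<in> Basis" for b
    proof -
      have "a \<bullet> b \<le> y \<bullet> b" "y \<bullet> b \<le> a \<bullet> b + h"
        using y b by (auto simp: mem_box inner_add_left)
      then have "v b \<le> (y \<bullet> b) / 2 powr k" "(y \<bullet> b) / 2 powr k \<le> v b + \<eta>"
        using P by (auto simp: v_def \<eta>_def field_simps)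
      then have "\<lfloor>v b - shift A k b\<rfloor> \<le> \<lfloor>(y \<bullet> b) / 2 powr k - shift A k b\<rfloor>"
        "\<lfloor>(y \<bullet> b) / 2 powr k - shift A k b\<rfloor> \<le> \<lfloor>v b + \<eta> - shift A k b\<rfloor>"
        by (auto intro!: floor_mono)
      with eq[OF b] show ?thesis by (simp add: \<phi>_def)
    qed
    then show "y \<in> cell A k \<phi>" by (simp add: cell_def)
  qed
  then show ?thesis by (rule that[of A, rotated]) (use k2 in \<open>auto simp: A_def\<close>)
qed

text \<open>For a grid this is its dyadic maximal operator, for a finite \<open>F\<close> a
  truncation of it. Expressing membership by an indicator keeps the index set of the supremum
  independent of x, so countable families give measurable functions.\<close>

definition family_max :: "'a::euclidean_space set set \<Rightarrow> ('a \<Rightarrow> real) \<Rightarrow> 'a \<Rightarrow> ennreal" where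
  "family_max F f x = (SUP Q\<in>F. avg f Q * indicator Q x)"

text \<open>The factor bounds the volume ratio between the enclosing cell, of side at most 6 h, and
  the cube of side h. Which grid supplies the cell depends on the cube, so the supremum over cubes
  will need the sum over all grids.\<close>

lemma avg_cube_le_cell:
  fixes Q :: "'a::euclidean_space set"
  assumes "is_cube Q" "x \<in> Q"
  obtains A where "A \<subseteq> Basis" "avg f Q \<le> ennreal (6 ^ DIM('a)) * family_max (grid A) f x"
proof -
  obtain a h where h: "h > 0" and Q: "Q = cbox a (a + h *\<^sub>R One)"
    using assms(1) by (auto simp: is_cube_def)
  obtain A k \<phi> where A: "A \<subseteq> Basis" and sub: "Q \<subseteq> cell A k \<phi>" and k: "2 powr k \<le> 6 * h"
    using cube_subset_cell[OF h, of a] unfolding Q by metis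
  let ?c = "ennreal (6 ^ DIM('a))"
  have "(2 powr k) ^ DIM('a) \<le> (6 * h) ^ DIM('a)" using k by (intro power_mono) auto
  then have meas: "emeasure lebesgue (cell A k \<phi>) \<le> ?c * emeasure lebesgue Q"
    unfolding Q emeasure_cell emeasure_cube[OF less_imp_le[OF h]] using h
    by (simp add: power_mult_distrib ennreal_leI flip: ennreal_mult)
  have c: "?c \<noteq> 0" "?c \<noteq> top" by auto
  have "avg f Q \<le> (\<integral>\<^sup>+ x \<in> cell A k \<phi>. ennreal \<bar>f x\<bar> \<partial>lebesgue) / emeasure lebesgue Q"
    unfolding avg_def using sub
    by (intro divide_right_mono_ennreal nn_integral_mono mult_left_mono) (auto simp: indicator_def)
  also have "\<dots> = ?c * ((\<integral>\<^sup>+ x \<in> cell A k \<phi>. ennreal \<bar>f x\<bar> \<partial>lebesgue) / (?c * emeasure lebesgue Q))"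
  proof -
    have q: "emeasure lebesgue Q = ennreal (h ^ DIM('a))" "h ^ DIM('a) > 0"
      unfolding Q using h by (auto simp only: emeasure_cube less_imp_le zero_less_power)
    show ?thesis unfolding q(1) using q(2)
      by (cases "\<integral>\<^sup>+ x \<in> cell A k \<phi>. ennreal \<bar>f x\<bar> \<partial>lebesgue")
         (auto simp: divide_ennreal ennreal_top_divide ennreal_mult_top simp flip: ennreal_mult)
  qed
  also have "\<dots> \<le> ?c * avg f (cell A k \<phi>)"
    unfolding avg_def by (intro mult_left_mono divide_mono_ennreal meas) auto
  also have "avg f (cell A k \<phi>) = avg f (cell A k \<phi>) * indicator (cell A k \<phi>) x"
    using sub assms(2) by auto
  also have "\<dots> \<le> family_max (grid A) f x"
    unfolding family_max_def by (rule SUP_upper[OF cell_in_grid])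
  finally show ?thesis using A that by (meson mult_left_mono zero_le)
qed

lemma maximal_op_le_grids:
  "maximal_op f x \<le> ennreal (6 ^ DIM('a)) * (\<Sum>A\<in>Pow Basis. family_max (grid A) f (x::'a::euclidean_space))"
  unfolding maximal_op_def
proof (rule SUP_least, clarify)
  fix Q :: "'a set" assume "is_cube Q" "x \<in> Q"
  then obtain A where A: "A \<subseteq> Basis" "avg f Q \<le> ennreal (6 ^ DIM('a)) * family_max (grid A) f x"
    by (rule avg_cube_le_cell)
  note A(2)
  also have "family_max (grid A) f x \<le> (\<Sum>A\<in>Pow Basis. family_max (grid A) f x)"
    using A(1) by (intro member_le_sum) auto
  finally show "avg f Q \<le> ennreal (6 ^ DIM('a)) * (\<Sum>A\<in>Pow Basis. family_max (grid A) f x)"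
    by (simp add: mult_left_mono)
qed

section \<open>Measurability of the maximal operator\<close>

lemma less_ennreal_divide_iff:
  assumes "q > 0" shows "t < I / ennreal q \<longleftrightarrow> t * ennreal q < I"
proof (cases I)
  case (real i)
  show ?thesis
  proof (cases t)
    case (real s)
    with assms \<open>I = ennreal i\<close> \<open>0 \<le> i\<close> show ?thesis
      by (simp add: divide_ennreal ennreal_less_iff pos_less_divide_eq flip: ennreal_mult)
  next
    case top
    with assms \<open>I = ennreal i\<close> show ?thesis by (simp add: divide_ennreal ennreal_top_mult)
  qed
next
  case top
  then have "I / ennreal q = top" by (simp add: ennreal_top_divide)
  then show ?thesis using top assms by (cases t) (simp_all add: ennreal_top_mult flip: ennreal_mult)
qed

text \<open>Lower semicontinuity: a cube whose average exceeds t can be enlarged a little on all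
  sides with its average still above t, and its interior then contains x. The cubes are closed and
  uncountably many, so measurability is drawn from this openness.\<close>

lemma open_maximal_op_gt: "open {x::'a::euclidean_space. t < maximal_op f x}"
proof (subst open_subopen, safe)
  fix x :: 'a assume "t < maximal_op f x"
  then obtain Q where Q: "is_cube Q" "x \<in> Q" "t < avg f Q"
    by (auto simp: maximal_op_def less_SUP_iff)
  then obtain a h where h: "h > 0" and Qe: "Q = cbox a (a + h *\<^sub>R One)" by (auto simp: is_cube_def)
  define I where "I = (\<integral>\<^sup>+ x \<in> Q. ennreal \<bar>f x\<bar> \<partial>lebesgue)"
  have "t < I / ennreal (h ^ DIM('a))"
    using Q(3) unfolding avg_def I_def Qe using emeasure_cube[of h a] h by simp
  then have tI: "t * ennreal (h ^ DIM('a)) < I" using h by (simp add: less_ennreal_divide_iff)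
  have "t \<noteq> top" using Q(3) by auto
  then obtain s where s: "t = ennreal s" "s \<ge> 0" by (cases t) auto
  \<comment> \<open>The mass I of the original cube is kept while the volume grows continuously with
    \<delta>, so the strict inequality survives for some positive \<delta>.\<close>
  have "((\<lambda>\<delta>. ennreal (s * (h + 2 * \<delta>) ^ DIM('a))) \<longlongrightarrow> ennreal (s * (h + 2 * 0) ^ DIM('a))) (at_right 0)"
    by (intro tendsto_ennrealI tendsto_intros)
  moreover have "ennreal (s * (h + 2 * 0) ^ DIM('a)) < I"
    using tI h s by (simp add: ennreal_mult)
  ultimately have "eventually (\<lambda>\<delta>. ennreal (s * (h + 2 * \<delta>) ^ DIM('a)) < I) (at_right (0::real))"
    by (rule order_tendstoD(2))
  moreover have "eventually (\<lambda>\<delta>. \<delta> > 0) (at_right (0::real))"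
    by (rule eventually_at_right_less)
  ultimately have "eventually (\<lambda>\<delta>. ennreal (s * (h + 2 * \<delta>) ^ DIM('a)) < I \<and> \<delta> > 0) (at_right (0::real))"
    by (rule eventually_conj)
  then obtain \<delta> where \<delta>: "ennreal (s * (h + 2 * \<delta>) ^ DIM('a)) < I" "\<delta> > 0"
    using eventually_happens'[OF trivial_limit_at_right_real] by blast
  define a' where "a' = a - \<delta> *\<^sub>R One"
  define R where "R = cbox a' (a' + (h + 2 * \<delta>) *\<^sub>R One)"
  define U where "U = box a' (a' + (h + 2 * \<delta>) *\<^sub>R One)"
  have QU: "Q \<subseteq> U"
  proof
    fix y assume "y \<in> Q"
    then have y: "a \<bullet> b \<le> y \<bullet> b" "y \<bullet> b \<le> a \<bullet> b + h" if "b \<in> Basis" for b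
      using that by (auto simp: Qe mem_box inner_add_left)
    have "a' \<bullet> b < y \<bullet> b" "y \<bullet> b < (a' + (h + 2 * \<delta>) *\<^sub>R One) \<bullet> b" if "b \<in> Basis" for b
      using y[OF that] that \<delta>(2) by (simp_all add: a'_def inner_add_left inner_diff_left)
    then show "y \<in> U" by (simp add: U_def mem_box)
  qed
  have UR: "U \<subseteq> R" unfolding U_def R_def by (rule box_subset_cbox)
  have R: "is_cube R" using h \<delta>(2) by (auto simp: is_cube_def R_def intro!: exI[of _ a'] exI[of _ "h + 2 * \<delta>"])
  have "I \<le> (\<integral>\<^sup>+ x \<in> R. ennreal \<bar>f x\<bar> \<partial>lebesgue)"
    unfolding I_def using QU UR by (intro nn_integral_mono mult_left_mono) (auto simp: indicator_def)
  moreover have "t * ennreal ((h + 2 * \<delta>) ^ DIM('a)) < I"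
    using \<delta> s h by (simp add: ennreal_mult)
  ultimately have "t * ennreal ((h + 2 * \<delta>) ^ DIM('a)) < (\<integral>\<^sup>+ x \<in> R. ennreal \<bar>f x\<bar> \<partial>lebesgue)"
    by (rule order_less_le_trans[rotated])
  then have tR: "t < avg f R"
    unfolding avg_def R_def using emeasure_cube[of "h + 2 * \<delta>" a'] h \<delta>(2)
    by (simp add: less_ennreal_divide_iff)
  have "U \<subseteq> {x. t < maximal_op f x}"
  proof safe
    fix y assume "y \<in> U"
    then have "avg f R \<le> maximal_op f y"
      unfolding maximal_op_def using UR R by (intro SUP_upper) auto
    with tR show "t < maximal_op f y" by simp
  qed
  moreover have "open U" unfolding U_def by (rule open_box)
  ultimately show "\<exists>T. open T \<and> x \<in> T \<and> T \<subseteq> {x. t < maximal_op f x}"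
    using QU Q(2) by auto
qed

lemma borel_measurable_maximal_op [measurable]: "maximal_op f \<in> borel_measurable lebesgue"
proof -
  have "maximal_op f \<in> borel_measurable borel"
    using open_maximal_op_gt[of _ f] by (intro borel_measurableI_greater) auto
  then show ?thesis by (simp add: measurable_completion)
qed

lemma is_cube_sets: "is_cube Q \<Longrightarrow> Q \<in> sets lebesgue"
  by (auto simp: is_cube_def)

lemma is_cube_emeasure:
  assumes "is_cube Q" shows "emeasure lebesgue Q > 0" "emeasure lebesgue Q < top"
proof -
  obtain a h where h: "h > 0" and Q: "Q = cbox a (a + h *\<^sub>R One)"
    using assms by (auto simp: is_cube_def)
  show "emeasure lebesgue Q > 0" "emeasure lebesgue Q < top"
    unfolding Q emeasure_cube[OF less_imp_le[OF h]] using h by auto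
qed

lemma bounded_subset_cube:
  fixes S :: "'a::euclidean_space set"
  assumes "bounded S" obtains Q where "is_cube Q" "S \<subseteq> Q"
proof -
  obtain r where r: "r > 0" "\<And>x. x \<in> S \<Longrightarrow> norm x \<le> r"
    using assms by (auto simp: bounded_pos)
  let ?a = "- r *\<^sub>R One :: 'a"
  have "S \<subseteq> cbox ?a (?a + (2 * r) *\<^sub>R One)"
  proof
    fix x assume "x \<in> S"
    then have "\<bar>x \<bullet> b\<bar> \<le> r" if "b \<in> Basis" for b
      using Basis_le_norm[OF that, of x] r(2)[of x] by linarith
    then show "x \<in> cbox ?a (?a + (2 * r) *\<^sub>R One)"
      by (auto simp: mem_box inner_add_left inner_diff_left abs_le_iff) force+
  qed
  moreover have "is_cube (cbox ?a (?a + (2 * r) *\<^sub>R One))"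
    unfolding is_cube_def using r(1) by (intro exI[of _ ?a] exI[of _ "2 * r"]) auto
  ultimately show ?thesis using that by blast
qed

section \<open>Nested families of sets\<close>

declare emeasure_completion [simp del]

text \<open>A laminar family over which averages make sense. It isolates what the estimates use of a
  grid and, unlike being a grid, is inherited by finite subfamilies.\<close>

definition nested :: "'a::euclidean_space set set \<Rightarrow> bool" where
  "nested F \<longleftrightarrow> (\<forall>Q\<in>F. Q \<in> sets lebesgue \<and> 0 < emeasure lebesgue Q \<and> emeasure lebesgue Q < top) \<and>
     (\<forall>Q\<in>F. \<forall>R\<in>F. Q \<inter> R = {} \<or> Q \<subseteq> R \<or> R \<subseteq> Q)"

lemma nestedD:
  assumes "nested F" "Q \<in> F"
  shows "Q \<in> sets lebesgue" "0 < emeasure lebesgue Q" "emeasure lebesgue Q < top"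
  using assms by (auto simp: nested_def)

lemma nested_subset: "nested F \<Longrightarrow> G \<subseteq> F \<Longrightarrow> nested G"
  by (auto simp: nested_def subset_eq)

lemma nested_grid: "nested (grid A)"
  unfolding nested_def
proof (intro conjI ballI)
  fix Q assume "Q \<in> grid A"
  then obtain k \<phi> where Q: "Q = cell A k \<phi>" by (auto simp: grid_def)
  show "Q \<in> sets lebesgue" unfolding Q by (rule sets_cell)
  show "0 < emeasure lebesgue Q" "emeasure lebesgue Q < top" unfolding Q emeasure_cell by auto
next
  fix Q R assume "Q \<in> grid A" "R \<in> grid A"
  then obtain k \<phi> l \<psi> where QR: "Q = cell A k \<phi>" "R = cell A l \<psi>" by (auto simp: grid_def)
  show "Q \<inter> R = {} \<or> Q \<subseteq> R \<or> R \<subseteq> Q"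
    unfolding QR using cell_nested[of k l _ A \<phi> \<psi>] cell_nested[of l k _ A \<psi> \<phi>]
    by (cases "k \<le> l") auto
qed

section \<open>Weighted weak and strong type bounds over finite nested families\<close>

lemma avg_mult_emeasure:
  assumes "0 < emeasure lebesgue Q" "emeasure lebesgue Q < top"
  shows "avg f Q * emeasure lebesgue Q = (\<integral>\<^sup>+ x \<in> Q. ennreal \<bar>f x\<bar> \<partial>lebesgue)"
  unfolding avg_def using assms by (simp add: ennreal_divide_times)

lemma borel_measurable_family_max:
  assumes "countable F" "\<And>Q. Q \<in> F \<Longrightarrow> Q \<in> sets lebesgue"
  shows "family_max F f \<in> borel_measurable lebesgue"
  unfolding family_max_def[abs_def] using assms
  by (intro borel_measurable_SUP borel_measurable_times borel_measurable_indicator) auto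

lemma sum_disjoint_indicator_le:
  assumes "finite F" "disjoint_family_on E F"
  shows "(\<Sum>Q\<in>F. c * indicator (E Q) x) \<le> (c :: ennreal)"
proof (cases "\<exists>Q\<in>F. x \<in> E Q")
  case True
  then obtain Q where Q: "Q \<in> F" "x \<in> E Q" by auto
  have "(\<Sum>R\<in>F. c * indicator (E R) x) = (\<Sum>R\<in>{Q}. c * indicator (E R) x)"
    using Q assms by (intro sum.mono_neutral_right) (auto simp: disjoint_family_on_def indicator_def)
  then show ?thesis using Q by simp
next
  case False
  then have "(\<Sum>R\<in>F. c * indicator (E R) x) = 0" by (intro sum.neutral) auto
  then show ?thesis by simp
qed

lemma sum_nn_integral_disjoint_le:
  assumes "finite F" "disjoint_family_on E F" "\<And>Q. Q \<in> F \<Longrightarrow> E Q \<in> sets lebesgue"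
    and [measurable]: "h \<in> borel_measurable lebesgue"
  shows "(\<Sum>Q\<in>F. \<integral>\<^sup>+x\<in>E Q. h x \<partial>lebesgue) \<le> (\<integral>\<^sup>+x. h x \<partial>lebesgue)"
proof -
  have "(\<Sum>Q\<in>F. \<integral>\<^sup>+x\<in>E Q. h x \<partial>lebesgue) = (\<integral>\<^sup>+x. (\<Sum>Q\<in>F. h x * indicator (E Q) x) \<partial>lebesgue)"
    using assms(3) by (intro nn_integral_sum[symmetric] borel_measurable_times borel_measurable_indicator) auto
  also have "\<dots> \<le> (\<integral>\<^sup>+x. h x \<partial>lebesgue)"
    by (intro nn_integral_mono sum_disjoint_indicator_le assms)
  finally show ?thesis .
qed

text \<open>The maximal members among those with average above t are disjoint and cover the level
  set. Discarding the values of \<open>g\<close> up to t / 2 loses at most half of its mass on each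
  of them, so |Q| is at most 2 / t times the integral of the large part of \<open>g\<close> over Q.
  Multiplication by \<open>avg w Q\<close> turns |Q| into the mass of \<open>w\<close> and brings in
  \<open>W\<close>, which plays the role of the maximal function of \<open>w\<close>.\<close>

lemma family_max_weak_type:
  fixes g w :: "'a::euclidean_space \<Rightarrow> real"
  assumes F: "nested F" "finite F"
    and [measurable]: "g \<in> borel_measurable lebesgue" "w \<in> borel_measurable lebesgue"
      "W \<in> borel_measurable lebesgue"
    and W: "\<And>Q x. Q \<in> F \<Longrightarrow> x \<in> Q \<Longrightarrow> avg w Q \<le> W x"
    and t: "t > 0"
  shows "(\<integral>\<^sup>+x. ennreal \<bar>w x\<bar> * (if ennreal t < family_max F g x then 1 else 0) \<partial>lebesgue)
    \<le> (\<integral>\<^sup>+x. ennreal (2 / t) * (ennreal \<bar>g x\<bar> * W x * (if t < 2 * \<bar>g x\<bar> then 1 else 0)) \<partial>lebesgue)"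
proof -
  define G where "G = {Q\<in>F. ennreal t < avg g Q}"
  define H where "H = {Q\<in>G. \<forall>R\<in>G. Q \<subseteq> R \<longrightarrow> Q = R}"
  define u where "u = (\<lambda>x. if t < 2 * \<bar>g x\<bar> then \<bar>g x\<bar> else 0)"
  have [measurable]: "u \<in> borel_measurable lebesgue" unfolding u_def by measurable
  have HF: "H \<subseteq> F" and finH: "finite H" using F(2) by (auto simp: H_def G_def)
  have setsH: "Q \<in> sets lebesgue" if "Q \<in> H" for Q using that HF nestedD(1)[OF F(1)] by auto
  have disj: "disjoint_family_on (\<lambda>Q. Q) H"
    unfolding disjoint_family_on_def
  proof (intro ballI impI)
    fix Q R assume QR: "Q \<in> H" "R \<in> H" "Q \<noteq> R"
    then have "\<not> Q \<subseteq> R" "\<not> R \<subseteq> Q" unfolding H_def by blast+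
    moreover have "Q \<inter> R = {} \<or> Q \<subseteq> R \<or> R \<subseteq> Q"
      using F(1) HF QR unfolding nested_def by blast
    ultimately show "Q \<inter> R = {}" by blast
  qed
  have cover: "\<exists>Q\<in>H. x \<in> Q" if "ennreal t < family_max F g x" for x
  proof -
    from that obtain Q where Q: "Q \<in> F" "ennreal t < avg g Q * indicator Q x"
      by (auto simp: family_max_def less_SUP_iff)
    then have xQ: "x \<in> Q" "Q \<in> G" by (cases "x \<in> Q"; simp add: G_def)+
    have "finite G" using F(2) by (simp add: G_def)
    then obtain M where "M \<in> G" "Q \<subseteq> M" "\<forall>b\<in>G. M \<subseteq> b \<longrightarrow> M = b"
      using finite_has_maximal2[of G Q] xQ by auto
    then show ?thesis using xQ by (auto simp: H_def)
  qed
  have cube: "(\<integral>\<^sup>+x\<in>Q. ennreal \<bar>w x\<bar> \<partial>lebesgue)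
      \<le> (\<integral>\<^sup>+x\<in>Q. (ennreal (2 / t) * ennreal (u x) * W x) \<partial>lebesgue)" if Q: "Q \<in> H" for Q
  proof -
    have QF: "Q \<in> F" and gt: "ennreal t < avg g Q" using Q by (auto simp: H_def G_def)
    note [measurable] = nestedD(1)[OF F(1) QF]
    note pos = nestedD(2,3)[OF F(1) QF]
    obtain q where q: "emeasure lebesgue Q = ennreal q" "q > 0"
      using pos by (cases "emeasure lebesgue Q") auto
    have "ennreal t * ennreal q \<le> avg g Q * emeasure lebesgue Q"
      unfolding q using gt by (intro mult_right_mono) auto
    also have "\<dots> = (\<integral>\<^sup>+ x \<in> Q. ennreal \<bar>g x\<bar> \<partial>lebesgue)"
      by (rule avg_mult_emeasure[OF pos])
    also have "\<dots> \<le> (\<integral>\<^sup>+ x. ennreal (u x) * indicator Q x + ennreal (t / 2) * indicator Q x \<partial>lebesgue)"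
      using t by (intro nn_integral_mono) (auto simp: u_def indicator_def intro!: ennreal_leI)
    also have "\<dots> = (\<integral>\<^sup>+ x \<in> Q. ennreal (u x) \<partial>lebesgue) + ennreal (t / 2) * ennreal q"
      by (subst nn_integral_add) (auto simp: q nn_integral_cmult_indicator)
    finally have le: "ennreal t * ennreal q \<le> (\<integral>\<^sup>+ x \<in> Q. ennreal (u x) \<partial>lebesgue) + ennreal (t / 2) * ennreal q" .
    \<comment> \<open>The term t q / 2 has to be subtracted in the reals, hence the separate case of
      an infinite integral.\<close>
    have "ennreal q \<le> ennreal (2 / t) * (\<integral>\<^sup>+ x \<in> Q. ennreal (u x) \<partial>lebesgue)"
    proof (cases "\<integral>\<^sup>+ x \<in> Q. ennreal (u x) \<partial>lebesgue")
      case (real j)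
      have nn: "0 \<le> t" "0 \<le> t / 2" "0 \<le> q" "0 \<le> t / 2 * q" using t q(2) by auto
      have "ennreal (t * q) \<le> ennreal (j + t / 2 * q)"
        using le unfolding real by (simp only: ennreal_plus[OF \<open>0 \<le> j\<close> nn(4)] ennreal_mult[OF nn(2,3)] ennreal_mult[OF nn(1,3)])
      then have "t * q \<le> j + t / 2 * q" using \<open>0 \<le> j\<close> nn(4) by (subst (asm) ennreal_le_iff) auto
      then have "q \<le> 2 / t * j" using t by (simp add: field_simps)
      then show ?thesis using real t by (simp add: ennreal_leI flip: ennreal_mult)
    qed (use t in \<open>simp add: ennreal_mult_top\<close>)
    then have "avg w Q * ennreal q \<le> avg w Q * (ennreal (2 / t) * (\<integral>\<^sup>+ x \<in> Q. ennreal (u x) \<partial>lebesgue))"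
      by (rule mult_left_mono) simp
    also have "avg w Q * ennreal q = (\<integral>\<^sup>+x\<in>Q. ennreal \<bar>w x\<bar> \<partial>lebesgue)"
      using avg_mult_emeasure[OF pos] q(1) by simp
    also have "avg w Q * (ennreal (2 / t) * (\<integral>\<^sup>+ x \<in> Q. ennreal (u x) \<partial>lebesgue))
      = (\<integral>\<^sup>+ x. (avg w Q * ennreal (2 / t)) * (ennreal (u x) * indicator Q x) \<partial>lebesgue)"
      by (subst nn_integral_cmult) (auto simp: mult.assoc)
    also have "\<dots> \<le> (\<integral>\<^sup>+x\<in>Q. (ennreal (2 / t) * ennreal (u x) * W x) \<partial>lebesgue)"
    proof (rule nn_integral_mono)
      fix x
      show "(avg w Q * ennreal (2 / t)) * (ennreal (u x) * indicator Q x)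
        \<le> ennreal (2 / t) * ennreal (u x) * W x * indicator Q x"
        using mult_left_mono[OF W[OF QF], of x "ennreal (2 / t) * ennreal (u x)"]
        by (auto simp: indicator_def mult_ac)
    qed
    finally show ?thesis .
  qed
  have "(\<integral>\<^sup>+x. ennreal \<bar>w x\<bar> * (if ennreal t < family_max F g x then 1 else 0) \<partial>lebesgue)
    \<le> (\<integral>\<^sup>+x. (\<Sum>Q\<in>H. ennreal \<bar>w x\<bar> * indicator Q x) \<partial>lebesgue)"
  proof (rule nn_integral_mono)
    fix x
    show "ennreal \<bar>w x\<bar> * (if ennreal t < family_max F g x then 1 else 0)
      \<le> (\<Sum>Q\<in>H. ennreal \<bar>w x\<bar> * indicator Q x)"
    proof (cases "ennreal t < family_max F g x")
      case True
      then obtain Q where "Q \<in> H" "x \<in> Q" using cover by auto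
      then show ?thesis
        using member_le_sum[of Q H "\<lambda>Q. ennreal \<bar>w x\<bar> * indicator Q x"] finH True by simp
    qed simp
  qed
  also have "\<dots> = (\<Sum>Q\<in>H. \<integral>\<^sup>+x\<in>Q. ennreal \<bar>w x\<bar> \<partial>lebesgue)"
    using setsH by (intro nn_integral_sum borel_measurable_times borel_measurable_indicator) auto
  also have "\<dots> \<le> (\<Sum>Q\<in>H. \<integral>\<^sup>+x\<in>Q. (ennreal (2 / t) * ennreal (u x) * W x) \<partial>lebesgue)"
    by (intro sum_mono cube)
  also have "\<dots> \<le> (\<integral>\<^sup>+x. ennreal (2 / t) * ennreal (u x) * W x \<partial>lebesgue)"
    by (intro sum_nn_integral_disjoint_le finH disj setsH) auto
  also have "\<dots> = (\<integral>\<^sup>+x. ennreal (2 / t) * (ennreal \<bar>g x\<bar> * W x * (if t < 2 * \<bar>g x\<bar> then 1 else 0)) \<partial>lebesgue)"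
    by (intro nn_integral_cong) (auto simp: u_def mult_ac)
  finally show ?thesis .
qed

lemma family_max_finite:
  assumes "finite F" "\<And>Q. Q \<in> F \<Longrightarrow> avg g Q < top"
  shows "family_max F g x < top"
proof -
  have "family_max F g x \<le> (\<Sum>Q\<in>F. avg g Q)"
    unfolding family_max_def
  proof (rule SUP_least)
    fix Q assume "Q \<in> F"
    then have "avg g Q \<le> (\<Sum>Q\<in>F. avg g Q)" using assms(1) by (intro member_le_sum) auto
    moreover have "avg g Q * indicator Q x \<le> avg g Q" by (auto simp: indicator_def)
    ultimately show "avg g Q * indicator Q x \<le> (\<Sum>Q\<in>F. avg g Q)" by (rule order_trans[rotated])
  qed
  also have "\<dots> < top" using assms by (auto simp: less_top[symmetric])
  finally show ?thesis .
qed

text \<open>The weak type bound integrated over the levels t. At each point the inner integral on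
  the right is 2 p |g| (2 |g|)^(p - 1) / (p - 1), the stated constant times |g|^p. The restriction t
  < 2 |g| from the weak bound is what makes this integral finite.\<close>

lemma family_max_strong_type:
  fixes g w :: "'a::euclidean_space \<Rightarrow> real"
  assumes F: "nested F" "finite F"
    and [measurable]: "g \<in> borel_measurable lebesgue" "w \<in> borel_measurable lebesgue"
      "W \<in> borel_measurable lebesgue"
    and W: "\<And>Q x. Q \<in> F \<Longrightarrow> x \<in> Q \<Longrightarrow> avg w Q \<le> W x"
    and fin: "\<And>Q. Q \<in> F \<Longrightarrow> avg g Q < top"
    and p: "p > 1"
  shows "(\<integral>\<^sup>+x. ennreal \<bar>w x\<bar> * epowr (family_max F g x) p \<partial>lebesgue)
    \<le> ennreal (2 powr p * (p / (p - 1))) * (\<integral>\<^sup>+x. ennreal (\<bar>g x\<bar> powr p) * W x \<partial>lebesgue)"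
proof -
  interpret L: sigma_finite_measure "lebesgue :: 'a measure" by (rule sigma_finite_lebesgue)
  interpret P: pair_sigma_finite "lborel :: real measure" "lebesgue :: 'a measure" ..
  \<comment> \<open>The layer-cake formula needs a real-valued function; finiteness of
    \<open>F\<close> and of its averages provides one.\<close>
  define u where "u = (\<lambda>x. enn2real (family_max F g x))"
  have ue: "family_max F g x = ennreal (u x)" and u0: "u x \<ge> 0" for x
    using family_max_finite[OF F(2) fin, of x] by (auto simp: u_def)
  have [measurable]: "u \<in> borel_measurable lebesgue"
    unfolding u_def using borel_measurable_family_max[OF countable_finite[OF F(2)] nestedD(1)[OF F(1)]]
    by measurable
  have layer: "ennreal (a powr r) = ennreal r * (\<integral>\<^sup>+t. indicator {0<..} t * ennreal (t powr (r - 1)) * (if t < a then 1 else 0) \<partial>lborel)"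
    if "r > 0" "a \<ge> 0" for r a :: real
    using that by (simp add: nn_integral_layer_powr flip: ennreal_mult)
  let ?K = "\<lambda>t x. ennreal p * (indicator {0<..} t * ennreal (t powr (p - 1)) * (if t < u x then 1 else 0)) * ennreal \<bar>w x\<bar>"
  let ?J = "\<lambda>t x. ennreal (2 * p) * (indicator {0<..} t * ennreal (t powr ((p - 1) - 1)) * (if t < 2 * \<bar>g x\<bar> then 1 else 0)) * (ennreal \<bar>g x\<bar> * W x)"
  have "(\<integral>\<^sup>+x. ennreal \<bar>w x\<bar> * epowr (family_max F g x) p \<partial>lebesgue) = (\<integral>\<^sup>+x. \<integral>\<^sup>+t. ?K t x \<partial>lborel \<partial>lebesgue)"
  proof (rule nn_integral_cong)
    fix x
    show "ennreal \<bar>w x\<bar> * epowr (family_max F g x) p = (\<integral>\<^sup>+t. ?K t x \<partial>lborel)"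
      using layer[of p "u x"] u0[of x] p
      by (simp add: ue epowr_ennreal nn_integral_cmult nn_integral_multc mult_ac)
  qed
  also have "\<dots> = (\<integral>\<^sup>+t. \<integral>\<^sup>+x. ?K t x \<partial>lebesgue \<partial>lborel)"
    by (rule P.Fubini') measurable
  also have "\<dots> \<le> (\<integral>\<^sup>+t. \<integral>\<^sup>+x. ?J t x \<partial>lebesgue \<partial>lborel)"
  proof (rule nn_integral_mono)
    fix t :: real
    show "(\<integral>\<^sup>+x. ?K t x \<partial>lebesgue) \<le> (\<integral>\<^sup>+x. ?J t x \<partial>lebesgue)"
    proof (cases "t > 0")
      case True
      let ?c = "ennreal p * ennreal (t powr (p - 1))"
      have "(\<integral>\<^sup>+x. ?K t x \<partial>lebesgue) = ?c * (\<integral>\<^sup>+x. ennreal \<bar>w x\<bar> * (if ennreal t < family_max F g x then 1 else 0) \<partial>lebesgue)"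
        using True u0 by (subst nn_integral_cmult[symmetric]) (auto intro!: nn_integral_cong simp: ue ennreal_less_iff)
      also have "\<dots> \<le> ?c * (\<integral>\<^sup>+x. ennreal (2 / t) * (ennreal \<bar>g x\<bar> * W x * (if t < 2 * \<bar>g x\<bar> then 1 else 0)) \<partial>lebesgue)"
        by (intro mult_left_mono family_max_weak_type F W True) auto
      also have "\<dots> = (\<integral>\<^sup>+x. (?c * ennreal (2 / t)) * (ennreal \<bar>g x\<bar> * W x * (if t < 2 * \<bar>g x\<bar> then 1 else 0)) \<partial>lebesgue)"
        by (subst nn_integral_cmult[symmetric]) (auto simp: mult.assoc)
      also have "?c * ennreal (2 / t) = ennreal (2 * p) * ennreal (t powr ((p - 1) - 1))"
        using True p by (simp add: powr_diff power2_eq_square flip: ennreal_mult)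
      finally show ?thesis using True by (simp add: mult_ac)
    qed simp
  qed
  also have "\<dots> = (\<integral>\<^sup>+x. \<integral>\<^sup>+t. ?J t x \<partial>lborel \<partial>lebesgue)"
    by (rule P.Fubini'[symmetric]) measurable
  also have "\<dots> = (\<integral>\<^sup>+x. ennreal (2 powr p * (p / (p - 1))) * (ennreal (\<bar>g x\<bar> powr p) * W x) \<partial>lebesgue)"
  proof (rule nn_integral_cong)
    fix x
    have "(\<integral>\<^sup>+t. ?J t x \<partial>lborel) = ennreal (2 * p) * ennreal ((2 * \<bar>g x\<bar>) powr (p - 1) / (p - 1)) * (ennreal \<bar>g x\<bar> * W x)"
      using nn_integral_layer_powr[of "p - 1" "2 * \<bar>g x\<bar>"] p
      by (simp add: nn_integral_cmult nn_integral_multc)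
    also have "\<dots> = ennreal (2 * p * ((2 * \<bar>g x\<bar>) powr (p - 1) / (p - 1)) * \<bar>g x\<bar>) * W x"
    proof -
      have nn: "0 \<le> 2 * p" "0 \<le> (2 * \<bar>g x\<bar>) powr (p - 1) / (p - 1)" "0 \<le> \<bar>g x\<bar>" using p by auto
      show ?thesis
        by (simp only: ennreal_mult[OF mult_nonneg_nonneg[OF nn(1,2)] nn(3)] ennreal_mult[OF nn(1,2)] mult.assoc[of _ "ennreal \<bar>g x\<bar>" "W x"])
    qed
    also have "2 * p * ((2 * \<bar>g x\<bar>) powr (p - 1) / (p - 1)) * \<bar>g x\<bar> = 2 powr p * (p / (p - 1)) * \<bar>g x\<bar> powr p"
      using p by (cases "g x = 0") (auto simp: powr_mult powr_diff)
    also have "ennreal (2 powr p * (p / (p - 1)) * \<bar>g x\<bar> powr p) * W x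
      = ennreal (2 powr p * (p / (p - 1))) * (ennreal (\<bar>g x\<bar> powr p) * W x)"
      using p by (subst ennreal_mult) (simp_all add: mult.assoc)
    finally show "(\<integral>\<^sup>+t. ?J t x \<partial>lborel) = ennreal (2 powr p * (p / (p - 1))) * (ennreal (\<bar>g x\<bar> powr p) * W x)" .
  qed
  also have "\<dots> = ennreal (2 powr p * (p / (p - 1))) * (\<integral>\<^sup>+x. ennreal (\<bar>g x\<bar> powr p) * W x \<partial>lebesgue)"
    by (rule nn_integral_cmult) measurable
  finally show ?thesis .
qed

text \<open>A discrete chain rule. The sum over all members containing Q is the partial sum at Q,
  counted from the largest set downwards. The induction removes the least member M, whose addition
  raises the p-th power by at most p \<open>a M\<close> times the full sum to the power p -
  1.\<close>

lemma chain_sum_powr_le: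
  fixes a :: "'b set \<Rightarrow> real"
  assumes p: "p > 1" and "finite G" "\<And>Q R. Q \<in> G \<Longrightarrow> R \<in> G \<Longrightarrow> Q \<subseteq> R \<or> R \<subseteq> Q"
    and "\<And>Q. a Q \<ge> 0"
  shows "(\<Sum>Q\<in>G. a Q) powr p \<le> p * (\<Sum>Q\<in>G. a Q * (\<Sum>R\<in>{R\<in>G. Q \<subseteq> R}. a R) powr (p - 1))"
  using assms(2,3)
proof (induction "card G" arbitrary: G)
  case 0
  then show ?case by simp
next
  case (Suc n)
  then have "G \<noteq> {}" by auto
  then obtain M where M: "M \<in> G" "\<And>b. b \<in> G \<Longrightarrow> b \<subseteq> M \<Longrightarrow> M = b"
    using finite_has_minimal[of G] Suc.prems(1) by auto
  have MR: "M \<subseteq> R" if "R \<in> G" for R using M Suc.prems(2)[OF M(1) that] that by blast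
  define G' where "G' = G - {M}"
  have G: "finite G'" "G = insert M G'" "M \<notin> G'" using M Suc.prems(1) by (auto simp: G'_def)
  have s0: "(\<Sum>Q\<in>G'. a Q) \<ge> 0" using assms(4) by (simp add: sum_nonneg)
  have "(\<Sum>Q\<in>G. a Q) powr p = (a M + (\<Sum>Q\<in>G'. a Q)) powr p" using G by simp
  also have "\<dots> \<le> (\<Sum>Q\<in>G'. a Q) powr p + p * a M * (a M + (\<Sum>Q\<in>G'. a Q)) powr (p - 1)"
    using p s0 assms(4) by (intro powr_increment_le) auto
  also have "(\<Sum>Q\<in>G'. a Q) powr p \<le> p * (\<Sum>Q\<in>G'. a Q * (\<Sum>R\<in>{R\<in>G'. Q \<subseteq> R}. a R) powr (p - 1))"
    using Suc.hyps(2) Suc.prems G by (intro Suc.hyps(1)) auto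
  also have "\<dots> \<le> p * (\<Sum>Q\<in>G'. a Q * (\<Sum>R\<in>{R\<in>G. Q \<subseteq> R}. a R) powr (p - 1))"
    using p assms(4) G
    by (intro mult_left_mono sum_mono powr_mono2 sum_mono2 sum_nonneg) auto
  also have "a M + (\<Sum>Q\<in>G'. a Q) = (\<Sum>R\<in>{R\<in>G. M \<subseteq> R}. a R)"
  proof -
    have "{R\<in>G. M \<subseteq> R} = G" using MR by auto
    then show ?thesis using G by simp
  qed
  finally show ?case using G by (simp add: algebra_simps)
qed

text \<open>\<open>T\<close> is the adjoint, applied to |k|, of the operator taking h to the sum of
  \<open>avg h Q\<close> times the indicator of \<open>E Q\<close>. Expanding T^p along chains
  leaves \<open>a Q\<close> times \<open>A Q\<close> to the power p - 1 times the mass of f on Q.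
  That mass is \<open>avg f Q\<close> times |Q|, and \<open>a Q\<close> times |Q| is the mass of k
  on \<open>E Q\<close>. So each term becomes an integral over \<open>E Q\<close>, where
  \<open>A Q\<close> is at most \<open>T\<close> and \<open>avg f Q\<close> at most
  \<open>W\<close>, and these sets are disjoint.\<close>

lemma nested_dual_powr_le:
  fixes f k :: "'a::euclidean_space \<Rightarrow> real"
  assumes F: "nested F" "finite F"
    and [measurable]: "k \<in> borel_measurable lebesgue" "f \<in> borel_measurable lebesgue"
      "W \<in> borel_measurable lebesgue"
    and W: "\<And>Q x. Q \<in> F \<Longrightarrow> x \<in> Q \<Longrightarrow> avg f Q \<le> W x"
    and E: "disjoint_family_on E F" "\<And>Q. Q \<in> F \<Longrightarrow> E Q \<subseteq> Q" "\<And>Q. Q \<in> F \<Longrightarrow> E Q \<in> sets lebesgue"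
    and a: "\<And>Q. a Q \<ge> 0" "\<And>Q. Q \<in> F \<Longrightarrow> ennreal (a Q) * emeasure lebesgue Q = (\<integral>\<^sup>+x\<in>E Q. ennreal \<bar>k x\<bar> \<partial>lebesgue)"
    and p: "p > 1"
    and T: "\<And>x. T x = (\<Sum>Q\<in>F. a Q * indicator Q x)"
  shows "(\<integral>\<^sup>+x. ennreal \<bar>f x\<bar> * ennreal (T x powr p) \<partial>lebesgue)
    \<le> (\<integral>\<^sup>+x. ennreal p * (ennreal \<bar>k x\<bar> * ennreal (T x powr (p - 1))) * W x \<partial>lebesgue)"
proof -
  have Fs: "Q \<in> sets lebesgue" if "Q \<in> F" for Q using nestedD(1)[OF F(1) that] .
  have "(\<lambda>x. \<Sum>Q\<in>F. a Q * indicator Q x) \<in> borel_measurable lebesgue"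
    using Fs by (intro borel_measurable_sum borel_measurable_times borel_measurable_indicator) auto
  then have [measurable]: "T \<in> borel_measurable lebesgue" by (simp add: T[abs_def])
  have T0: "T x \<ge> 0" for x unfolding T using a by (auto intro!: sum_nonneg)
  \<comment> \<open>The contribution to \<open>T\<close> of the cells containing Q: a lower bound
    for \<open>T\<close> on Q that is constant there, so it can leave the integral over Q.\<close>
  define A where "A = (\<lambda>Q. \<Sum>R\<in>{R\<in>F. Q \<subseteq> R}. a R)"
  have A0: "A Q \<ge> 0" for Q unfolding A_def using a by (auto intro!: sum_nonneg)
  have AT: "A Q \<le> T x" if "Q \<in> F" "x \<in> Q" for Q x
  proof -
    have "A Q = (\<Sum>R\<in>{R\<in>F. Q \<subseteq> R}. a R * indicator R x)"
      unfolding A_def using that by (intro sum.cong) (auto simp: indicator_def)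
    also have "\<dots> \<le> T x" unfolding T using F(2) a by (intro sum_mono2) auto
    finally show ?thesis .
  qed
  have pt: "T x powr p \<le> p * (\<Sum>Q\<in>F. a Q * A Q powr (p - 1) * indicator Q x)" for x
  proof -
    let ?G = "{Q\<in>F. x \<in> Q}"
    have chain: "Q \<subseteq> R \<or> R \<subseteq> Q" if "Q \<in> ?G" "R \<in> ?G" for Q R
      using F(1) that unfolding nested_def by blast
    have "T x = (\<Sum>Q\<in>?G. a Q)"
      unfolding T using F(2) by (intro sum.mono_neutral_cong_right) auto
    also have "\<dots> powr p \<le> p * (\<Sum>Q\<in>?G. a Q * (\<Sum>R\<in>{R\<in>?G. Q \<subseteq> R}. a R) powr (p - 1))"
      using F(2) by (intro chain_sum_powr_le p chain a) auto
    also have "(\<Sum>Q\<in>?G. a Q * (\<Sum>R\<in>{R\<in>?G. Q \<subseteq> R}. a R) powr (p - 1)) = (\<Sum>Q\<in>?G. a Q * A Q powr (p - 1))"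
    proof (rule sum.cong[OF refl])
      fix Q assume "Q \<in> ?G"
      then have "{R\<in>?G. Q \<subseteq> R} = {R\<in>F. Q \<subseteq> R}" by auto
      then show "a Q * (\<Sum>R\<in>{R\<in>?G. Q \<subseteq> R}. a R) powr (p - 1) = a Q * A Q powr (p - 1)" by (simp add: A_def)
    qed
    also have "\<dots> = (\<Sum>Q\<in>F. a Q * A Q powr (p - 1) * indicator Q x)"
      using F(2) by (intro sum.mono_neutral_cong_left) auto
    finally show ?thesis .
  qed
  have "(\<integral>\<^sup>+x. ennreal \<bar>f x\<bar> * ennreal (T x powr p) \<partial>lebesgue)
    \<le> (\<integral>\<^sup>+x. (\<Sum>Q\<in>F. ennreal (p * (a Q * A Q powr (p - 1))) * (ennreal \<bar>f x\<bar> * indicator Q x)) \<partial>lebesgue)"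
  proof (rule nn_integral_mono)
    fix x
    have "ennreal \<bar>f x\<bar> * ennreal (T x powr p) \<le> ennreal \<bar>f x\<bar> * ennreal (p * (\<Sum>Q\<in>F. a Q * A Q powr (p - 1) * indicator Q x))"
      by (intro mult_left_mono ennreal_leI pt) simp
    also have "\<dots> = ennreal (\<Sum>Q\<in>F. p * (a Q * A Q powr (p - 1)) * (\<bar>f x\<bar> * indicator Q x))"
      using p a by (simp add: sum_distrib_left mult_ac sum_nonneg flip: ennreal_mult)
    also have "\<dots> = (\<Sum>Q\<in>F. ennreal (p * (a Q * A Q powr (p - 1)) * (\<bar>f x\<bar> * indicator Q x)))"
      using p a by (intro sum_ennreal[symmetric]) auto
    also have "\<dots> = (\<Sum>Q\<in>F. ennreal (p * (a Q * A Q powr (p - 1))) * (ennreal \<bar>f x\<bar> * indicator Q x))"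
      using p a by (intro sum.cong) (auto simp: ennreal_mult indicator_def)
    finally show "ennreal \<bar>f x\<bar> * ennreal (T x powr p) \<le> (\<Sum>Q\<in>F. ennreal (p * (a Q * A Q powr (p - 1))) * (ennreal \<bar>f x\<bar> * indicator Q x))" .
  qed
  also have "\<dots> = (\<Sum>Q\<in>F. ennreal (p * (a Q * A Q powr (p - 1))) * (\<integral>\<^sup>+x\<in>Q. ennreal \<bar>f x\<bar> \<partial>lebesgue))"
  proof -
    have m: "(\<lambda>x. ennreal \<bar>f x\<bar> * indicator Q x) \<in> borel_measurable lebesgue" if "Q \<in> F" for Q
      using Fs[OF that] by measurable
    have "(\<integral>\<^sup>+x. (\<Sum>Q\<in>F. ennreal (p * (a Q * A Q powr (p - 1))) * (ennreal \<bar>f x\<bar> * indicator Q x)) \<partial>lebesgue)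
      = (\<Sum>Q\<in>F. \<integral>\<^sup>+x. ennreal (p * (a Q * A Q powr (p - 1))) * (ennreal \<bar>f x\<bar> * indicator Q x) \<partial>lebesgue)"
      by (intro nn_integral_sum borel_measurable_times_ennreal m borel_measurable_const)
    also have "\<dots> = (\<Sum>Q\<in>F. ennreal (p * (a Q * A Q powr (p - 1))) * (\<integral>\<^sup>+x\<in>Q. ennreal \<bar>f x\<bar> \<partial>lebesgue))"
      by (intro sum.cong refl nn_integral_cmult m)
    finally show ?thesis .
  qed
  also have "\<dots> \<le> (\<Sum>Q\<in>F. \<integral>\<^sup>+x\<in>E Q. (ennreal p * (ennreal \<bar>k x\<bar> * ennreal (T x powr (p - 1))) * W x) \<partial>lebesgue)"
  proof (rule sum_mono)
    fix Q assume Q: "Q \<in> F"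
    note [measurable] = E(3)[OF Q]
    have "ennreal (p * (a Q * A Q powr (p - 1))) * (\<integral>\<^sup>+x\<in>Q. ennreal \<bar>f x\<bar> \<partial>lebesgue)
      = ennreal p * ennreal (A Q powr (p - 1)) * avg f Q * (ennreal (a Q) * emeasure lebesgue Q)"
      unfolding avg_mult_emeasure[OF nestedD(2,3)[OF F(1) Q], symmetric]
      using p a(1)[of Q] by (simp add: ennreal_mult mult_ac)
    also have "\<dots> = (\<integral>\<^sup>+x. ennreal p * ennreal (A Q powr (p - 1)) * avg f Q * (ennreal \<bar>k x\<bar> * indicator (E Q) x) \<partial>lebesgue)"
      unfolding a(2)[OF Q] by (rule nn_integral_cmult[symmetric]) measurable
    also have "\<dots> \<le> (\<integral>\<^sup>+x\<in>E Q. (ennreal p * (ennreal \<bar>k x\<bar> * ennreal (T x powr (p - 1))) * W x) \<partial>lebesgue)"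
    proof (rule nn_integral_mono)
      fix x
      show "ennreal p * ennreal (A Q powr (p - 1)) * avg f Q * (ennreal \<bar>k x\<bar> * indicator (E Q) x)
        \<le> ennreal p * (ennreal \<bar>k x\<bar> * ennreal (T x powr (p - 1))) * W x * indicator (E Q) x"
      proof (cases "x \<in> E Q")
        case True
        then have xQ: "x \<in> Q" using E(2)[OF Q] by auto
        have "ennreal (A Q powr (p - 1)) * avg f Q \<le> ennreal (T x powr (p - 1)) * W x"
          using W[OF Q xQ] AT[OF Q xQ] A0[of Q] p by (intro mult_mono ennreal_leI powr_mono2) auto
        then have "(ennreal p * ennreal \<bar>k x\<bar>) * (ennreal (A Q powr (p - 1)) * avg f Q) \<le> (ennreal p * ennreal \<bar>k x\<bar>) * (ennreal (T x powr (p - 1)) * W x)"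
          by (rule mult_left_mono) simp
        then show ?thesis using True by (simp add: mult_ac)
      qed simp
    qed
    finally show "ennreal (p * (a Q * A Q powr (p - 1))) * (\<integral>\<^sup>+x\<in>Q. ennreal \<bar>f x\<bar> \<partial>lebesgue)
      \<le> (\<integral>\<^sup>+x\<in>E Q. (ennreal p * (ennreal \<bar>k x\<bar> * ennreal (T x powr (p - 1))) * W x) \<partial>lebesgue)" .
  qed
  also have "\<dots> \<le> (\<integral>\<^sup>+x. ennreal p * (ennreal \<bar>k x\<bar> * ennreal (T x powr (p - 1))) * W x \<partial>lebesgue)"
    by (intro sum_nn_integral_disjoint_le F(2) E) auto
  finally show ?thesis .
qed

text \<open>For a finite family the supremum is attained, and \<open>E Q\<close> collects the points
  where Q is selected. A newly added set takes only the points where its average strictly exceeds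
  the current maximum. Ties stay with earlier sets, which makes the selection single-valued and
  measurable.\<close>

lemma family_max_linearization:
  assumes "finite F" "\<And>Q. Q \<in> F \<Longrightarrow> Q \<in> sets lebesgue"
  shows "\<exists>E. disjoint_family_on E F \<and> (\<forall>Q\<in>F. E Q \<subseteq> Q \<and> E Q \<in> sets lebesgue) \<and>
    (\<forall>x. family_max F f x = (\<Sum>Q\<in>F. avg f Q * indicator (E Q) x))"
  using assms
proof (induction F rule: finite_induct)
  case empty
  then show ?case by (auto simp: family_max_def disjoint_family_on_def bot_ennreal)
next
  case (insert Q F)
  then obtain E where E: "disjoint_family_on E F" "\<And>R. R \<in> F \<Longrightarrow> E R \<subseteq> R" "\<And>R. R \<in> F \<Longrightarrow> E R \<in> sets lebesgue"
    "\<And>x. family_max F f x = (\<Sum>Q\<in>F. avg f Q * indicator (E Q) x)"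
    by auto
  have [measurable]: "Q \<in> sets lebesgue" using insert by auto
  have [measurable]: "family_max F f \<in> borel_measurable lebesgue"
    using insert by (intro borel_measurable_family_max countable_finite) auto
  define D where "D = {x\<in>space lebesgue. x \<in> Q \<and> family_max F f x < avg f Q}"
  have D: "D \<in> sets lebesgue" unfolding D_def by measurable
  define E' where "E' = (\<lambda>R. if R = Q then D else E R - D)"
  have "family_max (insert Q F) f x = (\<Sum>R\<in>insert Q F. avg f R * indicator (E' R) x)" for x
  proof -
    have 1: "family_max (insert Q F) f x = sup (avg f Q * indicator Q x) (family_max F f x)"
      by (simp add: family_max_def)
    have 2: "(\<Sum>R\<in>insert Q F. avg f R * indicator (E' R) x)
      = avg f Q * indicator D x + (\<Sum>R\<in>F. avg f R * indicator (E R - D) x)"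
    proof -
      have "(\<Sum>R\<in>F. avg f R * indicator (E' R) x) = (\<Sum>R\<in>F. avg f R * indicator (E R - D) x)"
        using insert(2) by (intro sum.cong refl) (auto simp: E'_def)
      then show ?thesis unfolding sum.insert[OF insert(1,2)] by (simp add: E'_def)
    qed
    show ?thesis
    proof (cases "x \<in> D")
      case True
      then have "(\<Sum>R\<in>F. avg f R * indicator (E R - D) x) = 0" by (intro sum.neutral) auto
      moreover have "sup (avg f Q * indicator Q x) (family_max F f x) = avg f Q"
        using True by (auto simp: D_def sup_max max_def)
      ultimately show ?thesis using True by (simp add: 1 2)
    next
      case False
      then have "(\<Sum>R\<in>F. avg f R * indicator (E R - D) x) = family_max F f x"
        unfolding E(4) by (intro sum.cong) (auto simp: indicator_def)
      moreover have "sup (avg f Q * indicator Q x) (family_max F f x) = family_max F f x"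
        using False by (intro sup_absorb2) (auto simp: D_def indicator_def)
      ultimately show ?thesis using False by (simp add: 1 2)
    qed
  qed
  moreover have "disjoint_family_on E' (insert Q F)"
    using E(1) insert(2) by (auto simp: disjoint_family_on_def E'_def)
  moreover have "E' R \<subseteq> R \<and> E' R \<in> sets lebesgue" if "R \<in> insert Q F" for R
    using that E(2,3)[of R] D by (auto simp: E'_def D_def)
  ultimately show ?case by (intro exI[of _ E']) auto
qed

lemma countable_finite_exhaustion:
  fixes D :: "'b set"
  assumes "countable D"
  obtains F :: "nat \<Rightarrow> 'b set" where "incseq F" "\<And>n. finite (F n)" "(\<Union>n. F n) = D"
proof (cases "D = {}")
  case True
  then show ?thesis by (intro that[of "\<lambda>_. {}"]) (auto simp: incseq_def)
next
  case False
  then have r: "range (from_nat_into D) = D" using assms by (rule range_from_nat_into)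
  show ?thesis
  proof (rule that[of "\<lambda>n. from_nat_into D ` {..<n}"])
    show "incseq (\<lambda>n. from_nat_into D ` {..<n})" by (auto simp: incseq_def)
    show "(\<Union>n. from_nat_into D ` {..<n}) = D" using r by auto
  qed simp
qed

section \<open>Koethe duals\<close>

text \<open>The dual norm for extended-valued nonnegative functions. Powers of maximal functions and
  of sparse sums are not known to be finite when they are estimated, and monotone limits may leave
  the real-valued functions.\<close>

definition koethe_ext :: "'a::euclidean_space fnorm \<Rightarrow> ('a \<Rightarrow> ennreal) \<Rightarrow> ennreal" where
  "koethe_ext N g = (SUP f\<in>{f \<in> borel_measurable lebesgue. N f = 1}.
     \<integral>\<^sup>+ x. ennreal \<bar>f x\<bar> * g x \<partial>lebesgue)"

lemma koethe_dual_eq_ext: "koethe_dual N g = koethe_ext N (\<lambda>x. ennreal \<bar>g x\<bar>)"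
  unfolding koethe_dual_def koethe_ext_def by (simp add: abs_mult ennreal_mult)

lemma koethe_ext_upper:
  assumes "f \<in> borel_measurable lebesgue" "N f = 1"
  shows "(\<integral>\<^sup>+ x. ennreal \<bar>f x\<bar> * g x \<partial>lebesgue) \<le> koethe_ext N g"
  unfolding koethe_ext_def using assms by (intro SUP_upper) auto

lemma koethe_ext_least:
  assumes "\<And>f. f \<in> borel_measurable lebesgue \<Longrightarrow> N f = 1 \<Longrightarrow>
    (\<integral>\<^sup>+ x. ennreal \<bar>f x\<bar> * g x \<partial>lebesgue) \<le> B"
  shows "koethe_ext N g \<le> B"
  unfolding koethe_ext_def using assms by (intro SUP_least) auto

lemma koethe_ext_mono_AE:
  assumes "AE x in lebesgue. g x \<le> h x" shows "koethe_ext N g \<le> koethe_ext N h"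
  unfolding koethe_ext_def
proof (intro SUP_mono')
  fix f :: "'a \<Rightarrow> real"
  show "(\<integral>\<^sup>+ x. ennreal \<bar>f x\<bar> * g x \<partial>lebesgue) \<le> (\<integral>\<^sup>+ x. ennreal \<bar>f x\<bar> * h x \<partial>lebesgue)"
    using assms by (intro nn_integral_mono_AE, eventually_elim) (auto intro!: mult_left_mono)
qed

lemma koethe_ext_mono: "(\<And>x. g x \<le> h x) \<Longrightarrow> koethe_ext N g \<le> koethe_ext N h"
  by (rule koethe_ext_mono_AE) auto

lemma koethe_ext_cmult:
  assumes [measurable]: "g \<in> borel_measurable lebesgue"
  shows "koethe_ext N (\<lambda>x. c * g x) = c * koethe_ext N g"
proof -
  have "(\<integral>\<^sup>+ x. ennreal \<bar>f x\<bar> * (c * g x) \<partial>lebesgue) = c * (\<integral>\<^sup>+ x. ennreal \<bar>f x\<bar> * g x \<partial>lebesgue)"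
    if [measurable]: "f \<in> borel_measurable lebesgue" for f :: "'a \<Rightarrow> real"
    by (subst nn_integral_cmult[symmetric]) (auto simp: mult_ac)
  then show ?thesis
    unfolding koethe_ext_def by (subst SUP_mult_left_ennreal) (auto intro!: SUP_cong)
qed

lemma koethe_ext_sum_le:
  fixes g :: "'i \<Rightarrow> 'a::euclidean_space \<Rightarrow> ennreal"
  assumes "finite I" and [measurable]: "\<And>i. i \<in> I \<Longrightarrow> g i \<in> borel_measurable lebesgue"
  shows "koethe_ext N (\<lambda>x. \<Sum>i\<in>I. g i x) \<le> (\<Sum>i\<in>I. koethe_ext N (g i))"
proof (rule koethe_ext_least)
  fix f :: "'a \<Rightarrow> real"
  assume f [measurable]: "f \<in> borel_measurable lebesgue" and N: "N f = 1"
  have "(\<integral>\<^sup>+ x. ennreal \<bar>f x\<bar> * (\<Sum>i\<in>I. g i x) \<partial>lebesgue)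
    = (\<integral>\<^sup>+ x. (\<Sum>i\<in>I. ennreal \<bar>f x\<bar> * g i x) \<partial>lebesgue)"
    by (simp add: sum_distrib_left)
  also have "\<dots> = (\<Sum>i\<in>I. \<integral>\<^sup>+ x. ennreal \<bar>f x\<bar> * g i x \<partial>lebesgue)"
    by (intro nn_integral_sum borel_measurable_times_ennreal assms(2)) measurable
  also have "\<dots> \<le> (\<Sum>i\<in>I. koethe_ext N (g i))"
    by (intro sum_mono koethe_ext_upper f N)
  finally show "(\<integral>\<^sup>+ x. ennreal \<bar>f x\<bar> * (\<Sum>i\<in>I. g i x) \<partial>lebesgue) \<le> (\<Sum>i\<in>I. koethe_ext N (g i))" .
qed

lemma nn_integral_mult_SUP:
  fixes g :: "nat \<Rightarrow> 'b \<Rightarrow> ennreal"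
  assumes "incseq g" and [measurable]: "\<And>n. g n \<in> borel_measurable M" "k \<in> borel_measurable M"
  shows "(\<integral>\<^sup>+ x. k x * (SUP n. g n x) \<partial>M) = (SUP n. \<integral>\<^sup>+ x. k x * g n x \<partial>M)"
proof -
  have "(\<integral>\<^sup>+ x. k x * (SUP n. g n x) \<partial>M) = (\<integral>\<^sup>+ x. (SUP n. k x * g n x) \<partial>M)"
    by (simp add: SUP_mult_left_ennreal)
  also have "\<dots> = (SUP n. \<integral>\<^sup>+ x. k x * g n x \<partial>M)"
    using assms(1) by (intro nn_integral_monotone_convergence_SUP) (auto simp: incseq_def le_fun_def intro!: mult_left_mono)
  finally show ?thesis .
qed

text \<open>A supremum of integrals inherits monotone convergence from the integral. This carries
  estimates from finite families of cubes to grids and to sparse collections.\<close>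

lemma koethe_ext_SUP_le:
  fixes g :: "nat \<Rightarrow> 'a::euclidean_space \<Rightarrow> ennreal"
  assumes "incseq g" "\<And>n. g n \<in> borel_measurable lebesgue" "\<And>n. koethe_ext N (g n) \<le> B"
  shows "koethe_ext N (\<lambda>x. SUP n. g n x) \<le> B"
proof (rule koethe_ext_least)
  fix f :: "'a \<Rightarrow> real"
  assume f [measurable]: "f \<in> borel_measurable lebesgue" and N: "N f = 1"
  have "(\<integral>\<^sup>+ x. ennreal \<bar>f x\<bar> * (SUP n. g n x) \<partial>lebesgue) = (SUP n. \<integral>\<^sup>+ x. ennreal \<bar>f x\<bar> * g n x \<partial>lebesgue)"
    by (intro nn_integral_mult_SUP assms) measurable
  also have "\<dots> \<le> B"
    by (intro SUP_least order_trans[OF koethe_ext_upper[of f N] assms(3)] f N)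
  finally show "(\<integral>\<^sup>+ x. ennreal \<bar>f x\<bar> * (SUP n. g n x) \<partial>lebesgue) \<le> B" .
qed

text \<open>If the norm of f is 0, then f vanishes almost everywhere; otherwise f can be normalised.
  The hypotheses concern only the given f, so that the inequality serves both X and Y.\<close>

lemma koethe_hoelder:
  assumes hom: "\<And>c. N (\<lambda>x. c * f x) = ennreal \<bar>c\<bar> * N f"
    and zero: "N f = 0 \<Longrightarrow> AE x in lebesgue. f x = 0"
    and f: "f \<in> fspace N" and [measurable]: "g \<in> borel_measurable lebesgue"
  shows "(\<integral>\<^sup>+ x. ennreal \<bar>f x\<bar> * g x \<partial>lebesgue) \<le> N f * koethe_ext N g"
proof (cases "N f = 0")
  case True
  then have "(\<integral>\<^sup>+ x. ennreal \<bar>f x\<bar> * g x \<partial>lebesgue) = (\<integral>\<^sup>+ x. 0 \<partial>(lebesgue :: 'a measure))"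
    using zero by (intro nn_integral_cong_AE) auto
  then show ?thesis by simp
next
  case False
  have [measurable]: "f \<in> borel_measurable lebesgue" and fin: "N f < top"
    using f by (auto simp: fspace_def)
  obtain n where n: "N f = ennreal n" "n > 0"
    using False fin by (cases "N f") (auto simp: less_le)
  let ?f = "\<lambda>x. (1 / n) * f x"
  have "N ?f = 1" using hom[of "1 / n"] n by (simp flip: ennreal_mult)
  then have "(\<integral>\<^sup>+ x. ennreal \<bar>?f x\<bar> * g x \<partial>lebesgue) \<le> koethe_ext N g"
    by (intro koethe_ext_upper) auto
  then have "N f * (\<integral>\<^sup>+ x. ennreal \<bar>?f x\<bar> * g x \<partial>lebesgue) \<le> N f * koethe_ext N g"
    by (rule mult_left_mono) simp
  also have "N f * (\<integral>\<^sup>+ x. ennreal \<bar>?f x\<bar> * g x \<partial>lebesgue) = (\<integral>\<^sup>+ x. N f * (ennreal \<bar>?f x\<bar> * g x) \<partial>lebesgue)"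
    by (rule nn_integral_cmult[symmetric]) measurable
  also have "\<dots> = (\<integral>\<^sup>+ x. ennreal \<bar>f x\<bar> * g x \<partial>lebesgue)"
  proof (rule nn_integral_cong)
    fix x
    have "N f * ennreal \<bar>?f x\<bar> = ennreal \<bar>f x\<bar>"
      using n by (simp add: abs_mult flip: ennreal_mult)
    then show "N f * (ennreal \<bar>?f x\<bar> * g x) = ennreal \<bar>f x\<bar> * g x" by (simp add: mult.assoc[symmetric])
  qed
  finally show ?thesis .
qed

lemma exhausting_cubes:
  obtains Q :: "nat \<Rightarrow> 'a::euclidean_space set"
  where "\<And>n. is_cube (Q n)" "\<And>x. \<exists>n. x \<in> Q n"
proof -
  have "\<exists>Q :: 'a set. is_cube Q \<and> cball 0 (real n) \<subseteq> Q" for n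
    using bounded_subset_cube[OF bounded_cball, of 0 "real n"] by metis
  then obtain Q :: "nat \<Rightarrow> 'a set" where Q: "\<And>n. is_cube (Q n)" "\<And>n. cball 0 (real n) \<subseteq> Q n"
    by metis
  have "\<exists>n. x \<in> Q n" for x
  proof -
    obtain n :: nat where "norm x \<le> n" using real_arch_simple by blast
    then have "x \<in> cball 0 (real n)" by simp
    then show ?thesis using Q(2) by blast
  qed
  then show ?thesis by (rule that[OF Q(1)])
qed

lemma AE_if_AE_on_cubes:
  fixes P :: "'a::euclidean_space \<Rightarrow> bool"
  assumes "\<And>Q. is_cube Q \<Longrightarrow> AE x in lebesgue. x \<in> Q \<longrightarrow> P x"
  shows "AE x in lebesgue. P x"
proof -
  obtain Q :: "nat \<Rightarrow> 'a set" where Q: "\<And>n. is_cube (Q n)" "\<And>x. \<exists>n. x \<in> Q n"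
    by (rule exhausting_cubes) blast
  have "AE x in lebesgue. \<forall>n. x \<in> Q n \<longrightarrow> P x"
    unfolding AE_all_countable using assms Q(1) by auto
  then show ?thesis by eventually_elim (use Q(2) in blast)
qed

section \<open>Spaces on which the maximal operator is bounded\<close>

locale maximal_bounded_space =
  fixes N :: "'a::euclidean_space fnorm" and C :: real
  assumes qbfs: "quasi_banach_function_space N" and C_nonneg: "C \<ge> 0"
    and maximal_bounded: "bounded_on N maximal_op C"
begin

lemma norm_scale: "f \<in> fspace N \<Longrightarrow> N (\<lambda>x. c * f x) = ennreal \<bar>c\<bar> * N f"
  using qbfs unfolding quasi_banach_function_space_def by blast

lemma norm_eq_0_iff: "f \<in> fspace N \<Longrightarrow> N f = 0 \<longleftrightarrow> (AE x in lebesgue. f x = 0)"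
  using qbfs unfolding quasi_banach_function_space_def by blast

lemma norm_ideal:
  assumes "f \<in> borel_measurable lebesgue" "g \<in> borel_measurable lebesgue" "AE x in lebesgue. \<bar>g x\<bar> \<le> \<bar>f x\<bar>"
  shows "N g \<le> N f"
  using qbfs assms unfolding quasi_banach_function_space_def by blast

lemma saturated:
  assumes "E \<in> sets lebesgue" "emeasure lebesgue E > 0"
  obtains F where "F \<in> sets lebesgue" "F \<subseteq> E" "emeasure lebesgue F > 0" "indicator F \<in> fspace N"
  using qbfs assms unfolding quasi_banach_function_space_def by blast

lemma hoelder:
  assumes "f \<in> fspace N" "g \<in> borel_measurable lebesgue"
  shows "(\<integral>\<^sup>+ x. ennreal \<bar>f x\<bar> * g x \<partial>lebesgue) \<le> N f * koethe_ext N g"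
  using assms norm_scale norm_eq_0_iff by (intro koethe_hoelder) auto

lemma maximal_in_space:
  assumes "f \<in> fspace N"
  shows "AE x in lebesgue. maximal_op f x < top"
    "(\<lambda>x. enn2real (maximal_op f x)) \<in> fspace N"
    "N (\<lambda>x. enn2real (maximal_op f x)) \<le> ennreal C * N f"
proof -
  note * = maximal_bounded[unfolded bounded_on_def, rule_format, OF assms]
  then show "AE x in lebesgue. maximal_op f x < top" "N (\<lambda>x. enn2real (maximal_op f x)) \<le> ennreal C * N f"
    by auto
  have "ennreal C * N f < top" using assms by (auto simp: fspace_def ennreal_mult_less_top)
  with * show "(\<lambda>x. enn2real (maximal_op f x)) \<in> fspace N"
    unfolding fspace_def by (auto intro: le_less_trans)
qed

text \<open>The form in which the norm of M on X enters (a) and (b): M falls on the test function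
  from the unit sphere of X, and the other factor is measured in X'.\<close>

lemma maximal_pairing:
  assumes f: "f \<in> fspace N" and [measurable]: "g \<in> borel_measurable lebesgue"
  shows "(\<integral>\<^sup>+ x. g x * maximal_op f x \<partial>lebesgue) \<le> ennreal C * N f * koethe_ext N g"
proof -
  let ?u = "\<lambda>x. enn2real (maximal_op f x)"
  have "(\<integral>\<^sup>+ x. g x * maximal_op f x \<partial>lebesgue) = (\<integral>\<^sup>+ x. ennreal \<bar>?u x\<bar> * g x \<partial>lebesgue)"
    using maximal_in_space(1)[OF f] by (intro nn_integral_cong_AE, eventually_elim) (simp add: mult.commute)
  also have "\<dots> \<le> N ?u * koethe_ext N g"
    by (intro hoelder maximal_in_space f) measurable
  also have "\<dots> \<le> ennreal C * N f * koethe_ext N g"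
    by (intro mult_right_mono maximal_in_space f) simp
  finally show ?thesis .
qed

lemma scaled_indicator_le:
  assumes f: "f \<in> fspace N" and Q: "Q \<in> sets lebesgue" and le: "\<And>x. x \<in> Q \<Longrightarrow> ennreal r \<le> maximal_op f x"
    and r: "r \<ge> 0"
  shows "N (\<lambda>x. r * indicator Q x) \<le> ennreal C * N f"
proof -
  have "AE x in lebesgue. \<bar>r * indicator Q x\<bar> \<le> \<bar>enn2real (maximal_op f x)\<bar>"
    using maximal_in_space(1)[OF f]
  proof eventually_elim
    case (elim x)
    show ?case
    proof (cases "x \<in> Q")
      case True
      then show ?thesis using enn2real_mono[OF le[OF True] elim] r by simp
    qed simp
  qed
  then have "N (\<lambda>x. r * indicator Q x) \<le> N (\<lambda>x. enn2real (maximal_op f x))"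
    using Q maximal_in_space(2)[OF f] by (intro norm_ideal) (auto simp: fspace_def)
  also have "\<dots> \<le> ennreal C * N f" by (rule maximal_in_space(3)[OF f])
  finally show ?thesis .
qed

text \<open>Saturation gives one set F of positive measure with indicator in X. On a cube R that
  meets F in positive measure, the maximal function of this indicator is bounded below by a positive
  constant, so the indicator of R lies in X by the ideal property. It remains to choose R around
  Q.\<close>

lemma indicator_cube_in_space:
  assumes Q: "is_cube Q" shows "indicator Q \<in> fspace N"
proof -
  have "emeasure lebesgue (UNIV :: 'a set) > 0"
    by (simp add: emeasure_lborel_UNIV emeasure_completion)
  then obtain F where F: "F \<in> sets lebesgue" "emeasure lebesgue F > 0" "indicator F \<in> fspace N"
    using saturated[of UNIV] by auto
  obtain B :: "nat \<Rightarrow> 'a set" where B: "\<And>n. is_cube (B n)" "\<And>x. \<exists>n. x \<in> B n"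
    by (rule exhausting_cubes) blast
  \<comment> \<open>F may be unbounded, but some bounded piece of it has positive measure; R is
    taken around that piece and Q.\<close>
  have "\<exists>n. emeasure lebesgue (F \<inter> B n) > 0"
  proof (rule ccontr)
    assume "\<not> ?thesis"
    then have "emeasure lebesgue (\<Union>n. F \<inter> B n) = 0"
      using F(1) is_cube_sets[OF B(1)] by (intro emeasure_UN_eq_0) auto
    moreover have "(\<Union>n. F \<inter> B n) = F" using B(2) by auto
    ultimately show False using F(2) by simp
  qed
  then obtain n where n: "emeasure lebesgue (F \<inter> B n) > 0" by auto
  have "bounded (Q \<union> B n)" using Q B(1)[of n] by (auto simp: is_cube_def)
  then obtain R where R: "is_cube R" "Q \<union> B n \<subseteq> R" by (rule bounded_subset_cube)
  note [measurable] = F(1) is_cube_sets[OF R(1)] is_cube_sets[OF Q]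
  have "emeasure lebesgue (F \<inter> B n) \<le> emeasure lebesgue (F \<inter> R)"
    using R(2) by (intro emeasure_mono) auto
  with n have pos: "emeasure lebesgue (F \<inter> R) > 0" by simp
  have "emeasure lebesgue (F \<inter> R) \<le> emeasure lebesgue R" by (intro emeasure_mono) auto
  also have "\<dots> < top" by (rule is_cube_emeasure[OF R(1)])
  finally have fin: "emeasure lebesgue (F \<inter> R) < top" .
  have "avg (indicator F) R = emeasure lebesgue (F \<inter> R) / emeasure lebesgue R"
  proof -
    have "(\<integral>\<^sup>+ x\<in>R. ennreal \<bar>indicator F x\<bar> \<partial>lebesgue) = (\<integral>\<^sup>+ x. indicator (F \<inter> R) x \<partial>lebesgue)"
      by (intro nn_integral_cong) (auto simp: indicator_def)
    then show ?thesis by (simp add: avg_def)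
  qed
  moreover have "\<dots> > 0" "\<dots> < top"
    using pos fin is_cube_emeasure[OF R(1)]
    by (auto simp: ennreal_zero_less_divide less_top[symmetric] ennreal_divide_eq_top_iff)
  ultimately have "avg (indicator F) R > 0" "avg (indicator F) R < top" by simp_all
  then obtain \<delta> where \<delta>: "avg (indicator F) R = ennreal \<delta>" "\<delta> > 0"
    by (cases "avg (indicator F) R") auto
  have "N (\<lambda>x. \<delta> * indicator R x) \<le> ennreal C * N (indicator F)"
  proof (rule scaled_indicator_le[OF F(3)])
    fix x assume "x \<in> R"
    then show "ennreal \<delta> \<le> maximal_op (indicator F) x"
      unfolding maximal_op_def \<delta>(1)[symmetric] using R(1) by (intro SUP_upper) auto
  qed (use \<delta> in auto)
  also have "\<dots> < top" using F(3) by (auto simp: fspace_def ennreal_mult_less_top)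
  finally have "(\<lambda>x. \<delta> * indicator R x) \<in> fspace N" by (auto simp: fspace_def)
  then have "N (\<lambda>x. (1 / \<delta>) * (\<delta> * indicator R x)) < top"
    by (subst norm_scale) (auto simp: fspace_def ennreal_mult_less_top)
  moreover have "N (indicator Q) \<le> N (\<lambda>x. (1 / \<delta>) * (\<delta> * indicator R x))"
    using R(2) \<delta>(2) by (intro norm_ideal) (auto simp: indicator_def)
  ultimately show ?thesis by (auto simp: fspace_def intro: le_less_trans)
qed

lemma norm_indicator_cube_pos:
  assumes Q: "is_cube Q" shows "N (indicator Q) > 0"
proof (rule ccontr)
  assume "\<not> ?thesis"
  then have "AE x in lebesgue. indicator Q x = (0::real)"
    using norm_eq_0_iff[OF indicator_cube_in_space[OF Q]] by simp
  then have "AE x in lebesgue. x \<notin> Q" by eventually_elim (auto simp: indicator_def split: if_splits)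
  then have "emeasure lebesgue Q = 0"
    using is_cube_sets[OF Q] by (subst (asm) AE_iff_measurable[of Q]) auto
  then show False using is_cube_emeasure(1)[OF Q] by simp
qed

text \<open>On Q the maximal function is at least the average of f over Q, so this average times the
  indicator of Q has norm at most C times that of f. This is a Muckenhoupt-type condition: it bounds
  the dual norm of the indicator of a cube.\<close>

lemma cube_integral_le:
  assumes f: "f \<in> fspace N" and Q: "is_cube Q"
  shows "(\<integral>\<^sup>+ x\<in>Q. ennreal \<bar>f x\<bar> \<partial>lebesgue) * N (indicator Q) \<le> emeasure lebesgue Q * (ennreal C * N f)"
proof -
  let ?m = "emeasure lebesgue Q"
  note pos = is_cube_emeasure[OF Q]
  have le: "avg f Q \<le> maximal_op f x" if "x \<in> Q" for x
    unfolding maximal_op_def using Q that by (intro SUP_upper) auto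
  \<comment> \<open>An infinite average would make the maximal function infinite on all of Q, a set
    of positive measure.\<close>
  have "avg f Q \<noteq> top"
  proof
    assume "avg f Q = top"
    then have "AE x in lebesgue. x \<notin> Q"
      using maximal_in_space(1)[OF f] le by (auto simp: top_unique)
    then have "?m = 0"
      using is_cube_sets[OF Q] by (subst (asm) AE_iff_measurable[of Q]) auto
    then show False using pos by simp
  qed
  then obtain r where r: "avg f Q = ennreal r" "r \<ge> 0" by (cases "avg f Q") auto
  have "ennreal r * N (indicator Q) = N (\<lambda>x. r * indicator Q x)"
    using norm_scale[OF indicator_cube_in_space[OF Q]] r(2) by simp
  also have "\<dots> \<le> ennreal C * N f"
    using le r by (intro scaled_indicator_le f is_cube_sets[OF Q]) auto
  finally have "?m * (avg f Q * N (indicator Q)) \<le> ?m * (ennreal C * N f)"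
    unfolding r(1) by (rule mult_left_mono) simp
  then show ?thesis
    unfolding avg_mult_emeasure[OF pos, symmetric] by (simp add: mult_ac)
qed

lemma indicator_cube_in_dual:
  assumes Q: "is_cube Q" shows "koethe_ext N (indicator Q) < top"
proof -
  have "N (indicator Q) < top" using indicator_cube_in_space[OF Q] by (simp add: fspace_def)
  then obtain n where n: "N (indicator Q) = ennreal n" "n > 0"
    using norm_indicator_cube_pos[OF Q] by (cases "N (indicator Q)") auto
  let ?B = "emeasure lebesgue Q * ennreal C / ennreal n"
  have "koethe_ext N (indicator Q) \<le> ?B"
  proof (rule koethe_ext_least)
    fix f assume "f \<in> borel_measurable lebesgue" "N f = 1"
    then have "f \<in> fspace N" by (auto simp: fspace_def)
    from cube_integral_le[OF this Q] \<open>N f = 1\<close>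
    have "(\<integral>\<^sup>+ x\<in>Q. ennreal \<bar>f x\<bar> \<partial>lebesgue) * ennreal n \<le> emeasure lebesgue Q * ennreal C"
      by (simp add: n)
    then have "(\<integral>\<^sup>+ x\<in>Q. ennreal \<bar>f x\<bar> \<partial>lebesgue) * ennreal n / ennreal n \<le> ?B"
      by (rule divide_right_mono_ennreal)
    then show "(\<integral>\<^sup>+ x\<in>Q. ennreal \<bar>f x\<bar> \<partial>lebesgue) \<le> ?B"
      using n(2) by (subst (asm) mult_divide_eq_ennreal) auto
  qed
  also have "\<dots> < top"
    using n(2) is_cube_emeasure(2)[OF Q]
    by (auto simp: less_top[symmetric] ennreal_divide_eq_top_iff ennreal_mult_eq_top_iff)
  finally show ?thesis .
qed

lemma set_integral_cube_le_ext:
  assumes "is_cube Q" "g \<in> borel_measurable lebesgue"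
  shows "(\<integral>\<^sup>+ x\<in>Q. g x \<partial>lebesgue) \<le> N (indicator Q) * koethe_ext N g"
proof -
  have "(\<integral>\<^sup>+ x\<in>Q. g x \<partial>lebesgue) = (\<integral>\<^sup>+ x. ennreal \<bar>indicator Q x\<bar> * g x \<partial>lebesgue)"
    by (intro nn_integral_cong) (auto simp: indicator_def)
  also have "\<dots> \<le> N (indicator Q) * koethe_ext N g"
    by (intro hoelder indicator_cube_in_space assms)
  finally show ?thesis .
qed

lemma ext_finite_imp_cube_integral_finite:
  assumes Q: "is_cube Q" and g: "g \<in> borel_measurable lebesgue" "koethe_ext N g < top"
  shows "(\<integral>\<^sup>+ x\<in>Q. g x \<partial>lebesgue) < top"
proof -
  have "N (indicator Q) * koethe_ext N g < top"
    using g indicator_cube_in_space[OF Q] by (auto simp: fspace_def ennreal_mult_less_top)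
  then show ?thesis using set_integral_cube_le_ext[OF Q g(1)] by (rule le_less_trans[rotated])
qed

text \<open>Pairing with the indicator of a cube, an element of X, shows that g is integrable over
  each cube, and countably many cubes exhaust the space.\<close>

lemma ext_finite_imp_AE_finite:
  assumes [measurable]: "g \<in> borel_measurable lebesgue" and "koethe_ext N g < top"
  shows "AE x in lebesgue. g x < top"
proof (rule AE_if_AE_on_cubes)
  fix Q :: "'a set" assume Q: "is_cube Q"
  note [measurable] = is_cube_sets[OF Q]
  have "AE x in lebesgue. g x * indicator Q x \<noteq> \<infinity>"
    using ext_finite_imp_cube_integral_finite[OF Q assms] by (intro nn_integral_PInf_AE) auto
  then show "AE x in lebesgue. x \<in> Q \<longrightarrow> g x < top"
    by eventually_elim (auto simp: less_top[symmetric])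
qed

lemma ext_zero_imp_AE_zero:
  assumes [measurable]: "g \<in> borel_measurable lebesgue" and "koethe_ext N g = 0"
  shows "AE x in lebesgue. g x = 0"
proof (rule AE_if_AE_on_cubes)
  fix Q :: "'a set" assume Q: "is_cube Q"
  note [measurable] = is_cube_sets[OF Q]
  have "(\<integral>\<^sup>+ x\<in>Q. g x \<partial>lebesgue) = 0"
    using set_integral_cube_le_ext[OF Q assms(1)] assms(2) by simp
  then have "AE x in lebesgue. g x * indicator Q x = 0"
    by (subst (asm) nn_integral_0_iff_AE) auto
  then show "AE x in lebesgue. x \<in> Q \<longrightarrow> g x = 0"
    by eventually_elim auto
qed

text \<open>With C = 0, \<open>cube_integral_le\<close> for the indicator of a cube would make the
  product of its measure and its norm zero, though both are positive. Positivity matters because p C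
  becomes the weight in Young's inequality.\<close>

lemma C_pos: "C > 0"
proof (rule ccontr)
  assume "\<not> ?thesis"
  then have C: "C = 0" using C_nonneg by simp
  obtain Q :: "nat \<Rightarrow> 'a set" where "\<And>n. is_cube (Q n)" by (rule exhausting_cubes) blast
  then have Q: "is_cube (Q 0)" .
  have "(\<integral>\<^sup>+ x\<in>Q 0. ennreal \<bar>indicator (Q 0) x\<bar> \<partial>lebesgue) = (\<integral>\<^sup>+ x. indicator (Q 0) x \<partial>lebesgue)"
    by (intro nn_integral_cong) (auto simp: indicator_def)
  also have "\<dots> = emeasure lebesgue (Q 0)"
    using is_cube_sets[OF Q] by (rule nn_integral_indicator)
  finally have "(\<integral>\<^sup>+ x\<in>Q 0. ennreal \<bar>indicator (Q 0) x\<bar> \<partial>lebesgue) = emeasure lebesgue (Q 0)" .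
  then have "emeasure lebesgue (Q 0) * N (indicator (Q 0)) = 0"
    using cube_integral_le[OF indicator_cube_in_space[OF Q] Q] C by simp
  then show False using is_cube_emeasure(1)[OF Q] norm_indicator_cube_pos[OF Q] by auto
qed

end

section \<open>The power space of the Koethe dual\<close>

text \<open>The tangent inequality for \<mu> k and \<nu> T with \<mu> \<nu>^(p - 1) = 1, which
  leaves the mixed product unchanged. The free weight m trades the coefficient of k^p against that
  of T^p.\<close>

lemma powr_young_scaled:
  fixes k T m p :: real
  assumes "p > 1" "m > 0" "k \<ge> 0" "T \<ge> 0"
  shows "p * (k * T powr (p - 1)) \<le> m powr (p - 1) * k powr p + (p - 1) / m * T powr p"
proof -
  let ?\<mu> = "m powr ((p - 1) / p)" and ?\<nu> = "m powr (- 1 / p)"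
  have "p * (?\<mu> * k) * (?\<nu> * T) powr (p - 1) \<le> (?\<mu> * k) powr p + (p - 1) * (?\<nu> * T) powr p"
    using assms by (intro powr_tangent_le) auto
  moreover have "(?\<mu> * k) powr p = m powr (p - 1) * k powr p"
    using assms by (simp add: powr_mult powr_powr)
  moreover have "(?\<nu> * T) powr p = 1 / m * T powr p"
    using assms by (simp add: powr_mult powr_divide powr_powr powr_minus_divide)
  moreover have "?\<mu> * (?\<nu> * T) powr (p - 1) = T powr (p - 1)"
  proof -
    have "?\<nu> powr (p - 1) = m powr (- ((p - 1) / p))" by (simp add: powr_powr)
    also have "\<dots> = 1 / ?\<mu>" by (rule powr_minus_divide)
    finally have "?\<mu> * ?\<nu> powr (p - 1) = 1" using assms(2) by simp
    then show ?thesis using assms by (simp only: powr_mult mult.assoc[symmetric] mult_1_left powr_ge_zero)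
  qed
  ultimately show ?thesis by (simp add: mult_ac)
qed

lemma family_max_SUP:
  assumes "(\<Union>n. F n) = D"
  shows "family_max D f x = (SUP n. family_max (F n) f x)"
  unfolding family_max_def assms[symmetric] by (rule SUP_UNION)

lemma incseq_family_max:
  assumes "incseq F" shows "incseq (\<lambda>n. family_max (F n) f)"
  using assms unfolding incseq_def le_fun_def family_max_def by (auto intro!: SUP_subset_mono)

lemma borel_measurable_family_max_grid:
  assumes "F \<subseteq> grid A" shows "family_max F f \<in> borel_measurable lebesgue"
  using assms countable_subset[OF assms countable_grid] nestedD(1)[OF nested_grid]
  by (intro borel_measurable_family_max) auto

lemma grid_bounded: "Q \<in> grid A \<Longrightarrow> bounded Q"
  using bounded_subset[OF bounded_cbox cell_subset_cube] by (auto simp: grid_def)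

lemma avg_grid_le_maximal:
  assumes "Q \<in> grid A" "x \<in> Q" shows "avg f Q \<le> maximal_op f x"
  using assms avg_cell_le_maximal by (auto simp: grid_def)

lemma avg_cube_le_maximal:
  assumes "is_cube Q" "x \<in> Q" shows "avg f Q \<le> maximal_op f x"
  unfolding maximal_op_def using assms by (intro SUP_upper) auto

locale maximal_bounded_power = maximal_bounded_space N C
  for N :: "'a::euclidean_space fnorm" and C :: real +
  fixes \<theta> :: real
  assumes \<theta>: "0 < \<theta>" "\<theta> < 1"
begin

definition p where "p = 1 / \<theta>"

abbreviation "Y \<equiv> fpower (koethe_dual N) \<theta>"

text \<open>The p-th power of the norm of Y. As a supremum of integrals it is the quantity in which
  estimates add up; roots are taken only at the end.\<close>

definition G :: "('a \<Rightarrow> real) \<Rightarrow> ennreal" where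
  "G g = koethe_ext N (\<lambda>x. ennreal (\<bar>g x\<bar> powr p))"

lemma p_gt_1: "p > 1" and \<theta>_p: "\<theta> * p = 1" "p * \<theta> = 1" "1 / p = \<theta>"
  using \<theta> by (auto simp: p_def)

lemma Y_eq: "Y g = epowr (G g) \<theta>"
  unfolding fpower_def koethe_dual_eq_ext G_def p_def by simp

lemma G_eq: "G g = epowr (Y g) p"
  unfolding Y_eq using p_gt_1 \<theta> by (simp add: epowr_epowr \<theta>_p)

lemma Y_finite_iff: "Y g < top \<longleftrightarrow> G g < top"
  unfolding Y_eq by (simp add: less_top[symmetric])

lemma fspace_Y_iff: "g \<in> fspace Y \<longleftrightarrow> g \<in> borel_measurable lebesgue \<and> G g < top"
  by (simp add: fspace_def Y_finite_iff)

lemma Y_scale: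
  assumes [measurable]: "g \<in> borel_measurable lebesgue"
  shows "Y (\<lambda>x. c * g x) = ennreal \<bar>c\<bar> * Y g"
proof -
  have "G (\<lambda>x. c * g x) = koethe_ext N (\<lambda>x. ennreal (\<bar>c\<bar> powr p) * ennreal (\<bar>g x\<bar> powr p))"
    unfolding G_def by (simp add: abs_mult powr_mult ennreal_mult)
  also have "\<dots> = ennreal (\<bar>c\<bar> powr p) * G g"
    unfolding G_def by (rule koethe_ext_cmult) measurable
  finally show ?thesis
    using \<theta> by (simp add: Y_eq epowr_mult epowr_ennreal powr_powr \<theta>_p)
qed

lemma Y_zero:
  assumes [measurable]: "g \<in> borel_measurable lebesgue" and "Y g = 0"
  shows "AE x in lebesgue. g x = 0"
proof -
  have "AE x in lebesgue. ennreal (\<bar>g x\<bar> powr p) = 0"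
    using assms(2) G_eq[of g] by (intro ext_zero_imp_AE_zero) (auto simp: G_def)
  then show ?thesis by eventually_elim (auto simp: ennreal_eq_0_iff dest!: antisym[OF _ powr_ge_zero])
qed

lemma Y_hoelder:
  assumes "k \<in> fspace Y" "h \<in> borel_measurable lebesgue"
  shows "(\<integral>\<^sup>+ x. ennreal \<bar>k x\<bar> * h x \<partial>lebesgue) \<le> Y k * koethe_ext Y h"
  using assms Y_scale Y_zero by (intro koethe_hoelder) (auto simp: fspace_def)

text \<open>Pointwise |k| \<le> 1 + |k|^p, and |k|^p is integrable over cubes because their
  indicators lie in X.\<close>

lemma Y_local_integrable:
  assumes k: "k \<in> fspace Y" and Q: "bounded Q"
  shows "(\<integral>\<^sup>+ x\<in>Q. ennreal \<bar>k x\<bar> \<partial>lebesgue) < top"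
proof -
  have [measurable]: "k \<in> borel_measurable lebesgue" using k by (simp add: fspace_def)
  obtain R where R: "is_cube R" "Q \<subseteq> R" using bounded_subset_cube[OF Q] .
  note [measurable] = is_cube_sets[OF R(1)]
  have "(\<integral>\<^sup>+ x\<in>Q. ennreal \<bar>k x\<bar> \<partial>lebesgue)
    \<le> (\<integral>\<^sup>+ x. indicator R x + ennreal (\<bar>k x\<bar> powr p) * indicator R x \<partial>lebesgue)"
  proof (rule nn_integral_mono)
    fix x
    have "\<bar>k x\<bar> \<le> 1 + \<bar>k x\<bar> powr p"
    proof (cases "\<bar>k x\<bar> \<le> 1")
      case False
      then have "\<bar>k x\<bar> powr 1 \<le> \<bar>k x\<bar> powr p" using p_gt_1 by (intro powr_mono) auto
      with False show ?thesis by simp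
    qed (use powr_ge_zero[of "\<bar>k x\<bar>" p] in linarith)
    then have "ennreal \<bar>k x\<bar> \<le> 1 + ennreal (\<bar>k x\<bar> powr p)"
      by (metis ennreal_1 ennreal_leI ennreal_plus powr_ge_zero zero_le_one)
    then show "ennreal \<bar>k x\<bar> * indicator Q x \<le> indicator R x + ennreal (\<bar>k x\<bar> powr p) * indicator R x"
      using R(2) by (auto simp: indicator_def)
  qed
  also have "\<dots> = emeasure lebesgue R + (\<integral>\<^sup>+ x\<in>R. ennreal (\<bar>k x\<bar> powr p) \<partial>lebesgue)"
    by (subst nn_integral_add) auto
  also have "\<dots> < top"
    using is_cube_emeasure(2)[OF R(1)] k
      ext_finite_imp_cube_integral_finite[OF R(1), of "\<lambda>x. ennreal (\<bar>k x\<bar> powr p)"]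
    by (auto simp: fspace_Y_iff G_def)
  finally show ?thesis .
qed

lemma avg_finite:
  assumes "k \<in> fspace Y" "bounded Q" "emeasure lebesgue Q > 0"
  shows "avg k Q < top"
  unfolding avg_def using Y_local_integrable[OF assms(1,2)] assms(3)
  by (auto simp: less_top[symmetric] ennreal_divide_eq_top_iff)

text \<open>|T|^p is at most a constant times the indicator of a cube, which has finite norm in X'.
  The a priori finiteness in the later absorption arguments comes from here.\<close>

lemma bounded_in_fspace_Y:
  assumes [measurable]: "T \<in> borel_measurable lebesgue"
    and "\<And>x. \<bar>T x\<bar> \<le> B" "bounded S" "\<And>x. x \<notin> S \<Longrightarrow> T x = 0"
  shows "T \<in> fspace Y"
proof -
  obtain R where R: "is_cube R" "S \<subseteq> R" using bounded_subset_cube[OF assms(3)] .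
  note [measurable] = is_cube_sets[OF R(1)]
  have "G T \<le> koethe_ext N (\<lambda>x. ennreal (B powr p) * indicator R x)"
    unfolding G_def
  proof (rule koethe_ext_mono)
    fix x
    show "ennreal (\<bar>T x\<bar> powr p) \<le> ennreal (B powr p) * indicator R x"
    proof (cases "x \<in> R")
      case True
      then show ?thesis using assms(2)[of x] p_gt_1 by (auto intro!: ennreal_leI powr_mono2)
    next
      case False
      then have "T x = 0" using R(2) assms(4) by auto
      then show ?thesis by simp
    qed
  qed
  also have "\<dots> = ennreal (B powr p) * koethe_ext N (indicator R)"
    by (rule koethe_ext_cmult) measurable
  also have "\<dots> < top" using indicator_cube_in_dual[OF R(1)] by (simp add: ennreal_mult_less_top)
  finally show ?thesis by (simp add: fspace_Y_iff)
qed

lemma step_function_in_fspace_Y: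
  assumes "finite F" "\<And>Q. Q \<in> F \<Longrightarrow> Q \<in> sets lebesgue" "\<And>Q. Q \<in> F \<Longrightarrow> bounded Q"
    and a: "\<And>Q. a Q \<ge> 0"
  shows "(\<lambda>x. \<Sum>Q\<in>F. a Q * indicator Q x) \<in> fspace Y"
proof (rule bounded_in_fspace_Y)
  show "(\<lambda>x. \<Sum>Q\<in>F. a Q * indicator Q x) \<in> borel_measurable lebesgue"
    using assms(2) by (intro borel_measurable_sum borel_measurable_times borel_measurable_indicator) auto
  show "bounded (\<Union>F)" using assms by auto
  fix x
  have "(\<Sum>Q\<in>F. a Q * indicator Q x) \<le> (\<Sum>Q\<in>F. a Q)"
    using a by (intro sum_mono) (auto simp: indicator_def)
  moreover have "(\<Sum>Q\<in>F. a Q * indicator Q x) \<ge> 0" using a by (auto intro!: sum_nonneg)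
  ultimately show "\<bar>\<Sum>Q\<in>F. a Q * indicator Q x\<bar> \<le> (\<Sum>Q\<in>F. a Q)" by simp
  show "x \<notin> \<Union>F \<Longrightarrow> (\<Sum>Q\<in>F. a Q * indicator Q x) = 0"
    by (intro sum.neutral) auto
qed

section \<open>The maximal operator on the power space\<close>

lemma ext_family_max_le:
  assumes g: "g \<in> fspace Y" and F: "F \<subseteq> grid A" "finite F"
  shows "koethe_ext N (\<lambda>x. epowr (family_max F g x) p) \<le> ennreal (2 powr p * (p / (p - 1))) * (ennreal C * G g)"
proof (rule koethe_ext_least)
  fix f :: "'a \<Rightarrow> real"
  assume f [measurable]: "f \<in> borel_measurable lebesgue" and Nf: "N f = 1"
  have fs: "f \<in> fspace N" using f Nf by (simp add: fspace_def)
  have [measurable]: "g \<in> borel_measurable lebesgue" using g by (simp add: fspace_def)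
  have nF: "nested F" by (rule nested_subset[OF nested_grid F(1)])
  have "(\<integral>\<^sup>+ x. ennreal \<bar>f x\<bar> * epowr (family_max F g x) p \<partial>lebesgue)
    \<le> ennreal (2 powr p * (p / (p - 1))) * (\<integral>\<^sup>+ x. ennreal (\<bar>g x\<bar> powr p) * maximal_op f x \<partial>lebesgue)"
  proof (rule family_max_strong_type[OF nF F(2)])
    show "avg f Q \<le> maximal_op f x" if "Q \<in> F" "x \<in> Q" for Q x
      using that F by (auto intro!: avg_grid_le_maximal)
    show "avg g Q < top" if "Q \<in> F" for Q
      using that F by (intro avg_finite g grid_bounded nestedD(2)[OF nF]) auto
  qed (use p_gt_1 in auto)
  also have "\<dots> \<le> ennreal (2 powr p * (p / (p - 1))) * (ennreal C * N f * G g)"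
    unfolding G_def by (intro mult_left_mono maximal_pairing fs) auto
  finally show "(\<integral>\<^sup>+ x. ennreal \<bar>f x\<bar> * epowr (family_max F g x) p \<partial>lebesgue)
    \<le> ennreal (2 powr p * (p / (p - 1))) * (ennreal C * G g)"
    by (simp add: Nf)
qed

lemma ext_grid_max_le:
  assumes g: "g \<in> fspace Y"
  shows "koethe_ext N (\<lambda>x. epowr (family_max (grid A) g x) p) \<le> ennreal (2 powr p * (p / (p - 1))) * (ennreal C * G g)"
proof -
  obtain F where F: "incseq F" "\<And>n. finite (F n)" "(\<Union>n. F n) = grid A"
    by (rule countable_finite_exhaustion[OF countable_grid[of A]]) blast
  have sub: "F n \<subseteq> grid A" for n using F(3) by auto
  have p0: "p > 0" using p_gt_1 by simp
  have "koethe_ext N (\<lambda>x. epowr (family_max (grid A) g x) p) = koethe_ext N (\<lambda>x. SUP n. epowr (family_max (F n) g x) p)"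
    by (simp add: family_max_SUP[OF F(3)] epowr_SUP[OF p0])
  also have "\<dots> \<le> ennreal (2 powr p * (p / (p - 1))) * (ennreal C * G g)"
  proof (rule koethe_ext_SUP_le)
    show "incseq (\<lambda>n x. epowr (family_max (F n) g x) p)"
      using incseq_family_max[OF F(1), of g] by (auto simp: incseq_def le_fun_def intro!: epowr_mono[OF p0])
    show "(\<lambda>x. epowr (family_max (F n) g x) p) \<in> borel_measurable lebesgue" for n
      using borel_measurable_family_max_grid[OF sub] by measurable
  qed (rule ext_family_max_le[OF g sub F(2)])
  finally show ?thesis .
qed

lemma card_Pow_Basis: "card (Pow (Basis :: 'a set)) = 2 ^ DIM('a)"
  by (simp add: card_Pow)

text \<open>The number of grids enters twice: to the power p from the p-th power of a sum over the
  grids, where it is merged with the 6 of \<open>maximal_op_le_grids\<close> into 12, and once more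
  from adding up the bounds for the individual grids.\<close>

lemma ext_maximal_le:
  assumes g: "g \<in> fspace Y"
  shows "koethe_ext N (\<lambda>x. epowr (maximal_op g x) p)
    \<le> ennreal ((12 ^ DIM('a)) powr p) * (2 ^ DIM('a) * (ennreal (2 powr p * (p / (p - 1))) * (ennreal C * G g)))"
proof -
  have p0: "p > 0" using p_gt_1 by simp
  let ?s = "\<lambda>x. \<Sum>A\<in>Pow Basis. epowr (family_max (grid A) g x) p"
  have m: "(\<lambda>x. epowr (family_max (grid A) g x) p) \<in> borel_measurable lebesgue" for A
    using borel_measurable_family_max_grid[OF subset_refl, of A g] by measurable
  have c: "epowr (ennreal (6 ^ DIM('a))) p * epowr (of_nat (card (Pow (Basis :: 'a set)))) p = ennreal ((12 ^ DIM('a)) powr p)"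
  proof -
    have "epowr (of_nat (card (Pow (Basis :: 'a set)))) p = epowr (ennreal (2 ^ DIM('a))) p"
      by (simp add: card_Pow_Basis ennreal_power[symmetric])
    then show ?thesis
      by (simp add: epowr_ennreal flip: ennreal_mult powr_mult power_mult_distrib)
  qed
  have "koethe_ext N (\<lambda>x. epowr (maximal_op g x) p) \<le> koethe_ext N (\<lambda>x. ennreal ((12 ^ DIM('a)) powr p) * ?s x)"
  proof (rule koethe_ext_mono)
    fix x
    have "epowr (maximal_op g x) p \<le> epowr (ennreal (6 ^ DIM('a)) * (\<Sum>A\<in>Pow Basis. family_max (grid A) g x)) p"
      by (intro epowr_mono p0 maximal_op_le_grids)
    also have "\<dots> \<le> epowr (ennreal (6 ^ DIM('a))) p * (epowr (of_nat (card (Pow (Basis :: 'a set)))) p * ?s x)"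
      unfolding epowr_mult[OF p0] by (intro mult_left_mono epowr_sum_le p0) auto
    finally show "epowr (maximal_op g x) p \<le> ennreal ((12 ^ DIM('a)) powr p) * ?s x"
      by (simp only: c mult.assoc[symmetric])
  qed
  also have "\<dots> = ennreal ((12 ^ DIM('a)) powr p) * koethe_ext N ?s"
    by (intro koethe_ext_cmult borel_measurable_sum m)
  also have "koethe_ext N ?s \<le> (\<Sum>A\<in>Pow Basis. koethe_ext N (\<lambda>x. epowr (family_max (grid A) g x) p))"
    by (intro koethe_ext_sum_le m) simp
  also have "\<dots> \<le> (\<Sum>A\<in>Pow (Basis :: 'a set). ennreal (2 powr p * (p / (p - 1))) * (ennreal C * G g))"
    by (intro sum_mono ext_grid_max_le g)
  also have "\<dots> = 2 ^ DIM('a) * (ennreal (2 powr p * (p / (p - 1))) * (ennreal C * G g))"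
    by (simp add: card_Pow_Basis)
  finally show ?thesis by (simp add: mult_left_mono)
qed

text \<open>The bound is required for the extended-valued \<open>T g\<close>. Since
  \<open>enn2real\<close> sends infinity to 0, a bound on the real-valued version would not detect
  infinite values; here finiteness almost everywhere follows from the bound itself.\<close>

lemma bounded_on_YI:
  assumes m: "\<And>g. g \<in> fspace Y \<Longrightarrow> T g \<in> borel_measurable lebesgue"
    and le: "\<And>g. g \<in> fspace Y \<Longrightarrow> epowr (koethe_ext N (\<lambda>x. epowr (T g x) p)) \<theta> \<le> ennreal B * Y g"
  shows "bounded_on Y T B"
  unfolding bounded_on_def
proof (intro ballI conjI)
  fix g assume g: "g \<in> fspace Y"
  note [measurable] = m[OF g]
  show "(\<lambda>x. enn2real (T g x)) \<in> borel_measurable lebesgue" by measurable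
  have "ennreal B * Y g < top" using g by (auto simp: fspace_def ennreal_mult_less_top)
  with le[OF g] have "epowr (koethe_ext N (\<lambda>x. epowr (T g x) p)) \<theta> < top" by (rule le_less_trans)
  then have "koethe_ext N (\<lambda>x. epowr (T g x) p) < top" by (simp add: less_top[symmetric])
  then have "AE x in lebesgue. epowr (T g x) p < top"
    by (intro ext_finite_imp_AE_finite) measurable
  then show "AE x in lebesgue. T g x < \<infinity>" by eventually_elim (simp add: less_top[symmetric])
  have "Y (\<lambda>x. enn2real (T g x)) \<le> epowr (koethe_ext N (\<lambda>x. epowr (T g x) p)) \<theta>"
    unfolding Y_eq G_def
    by (intro epowr_mono \<theta> koethe_ext_mono) (auto simp: epowr_def)
  also have "\<dots> \<le> ennreal B * Y g" by (rule le[OF g])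
  finally show "Y (\<lambda>x. enn2real (T g x)) \<le> ennreal B * Y g" .
qed

text \<open>Raising \<open>ext_maximal_le\<close> to the power \<theta> removes the exponent p from
  12 and 2 and turns C into \<open>C powr \<theta>\<close>. The remaining factors, the number of
  grids and p / (p - 1) = 1 / (1 - \<theta>), are at least 1 and so do not increase.\<close>

lemma maximal_bounded_Y:
  "bounded_on Y maximal_op (2 * 24 ^ DIM('a) / (1 - \<theta>) * C powr \<theta>)"
proof (rule bounded_on_YI)
  fix g assume g: "g \<in> fspace Y"
  let ?d = "DIM('a)"
  have pp: "p / (p - 1) = 1 / (1 - \<theta>)" using \<theta> by (simp add: p_def field_simps)
  have "epowr (koethe_ext N (\<lambda>x. epowr (maximal_op g x) p)) \<theta>
    \<le> epowr (ennreal ((12 ^ ?d) powr p) * (2 ^ ?d * (ennreal (2 powr p * (p / (p - 1))) * (ennreal C * G g)))) \<theta>"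
    by (intro epowr_mono \<theta> ext_maximal_le g)
  also have "\<dots> = epowr (ennreal ((12 ^ ?d) powr p)) \<theta> * (epowr (ennreal (2 ^ ?d)) \<theta> *
      (epowr (ennreal (2 powr p * (p / (p - 1)))) \<theta> * (epowr (ennreal C) \<theta> * Y g)))"
    by (simp add: epowr_mult \<theta> Y_eq ennreal_power[symmetric])
  also have "epowr (ennreal ((12 ^ ?d) powr p)) \<theta> = ennreal (12 ^ ?d)"
    by (simp add: epowr_ennreal powr_powr \<theta>_p)
  also have "epowr (ennreal (2 ^ ?d)) \<theta> \<le> ennreal (2 ^ ?d)"
  proof -
    have "(2 ^ ?d :: real) powr \<theta> \<le> (2 ^ ?d) powr 1" using \<theta> by (intro powr_mono) auto
    then show ?thesis by (simp add: epowr_ennreal ennreal_leI)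
  qed
  also have "epowr (ennreal (2 powr p * (p / (p - 1)))) \<theta> \<le> ennreal (2 * (1 / (1 - \<theta>)))"
  proof -
    have "(1 / (1 - \<theta>)) powr \<theta> \<le> (1 / (1 - \<theta>)) powr 1" using \<theta> by (intro powr_mono) auto
    then have "(2 powr p * (1 / (1 - \<theta>))) powr \<theta> \<le> 2 * (1 / (1 - \<theta>))"
      using \<theta> by (simp add: powr_mult powr_divide powr_powr \<theta>_p)
    then show ?thesis unfolding pp using \<theta> by (subst epowr_ennreal) (auto intro!: ennreal_leI)
  qed
  also have "epowr (ennreal C) \<theta> = ennreal (C powr \<theta>)" by (rule epowr_ennreal[OF C_nonneg])
  also have "ennreal (12 ^ ?d) * (ennreal (2 ^ ?d) * (ennreal (2 * (1 / (1 - \<theta>))) * (ennreal (C powr \<theta>) * Y g)))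
    = ennreal (2 * 24 ^ ?d / (1 - \<theta>) * C powr \<theta>) * Y g"
  proof -
    have "ennreal (12 ^ ?d) * (ennreal (2 ^ ?d) * (ennreal (2 * (1 / (1 - \<theta>))) * ennreal (C powr \<theta>)))
      = ennreal (12 ^ ?d * (2 ^ ?d * (2 * (1 / (1 - \<theta>)) * C powr \<theta>)))"
      using \<theta> by (simp only: ennreal_mult zero_le_power zero_le_numeral powr_ge_zero mult_nonneg_nonneg zero_le_divide_1_iff diff_ge_0_iff_ge less_imp_le)
    also have "12 ^ ?d * (2 ^ ?d * (2 * (1 / (1 - \<theta>)) * C powr \<theta>)) = 2 * 24 ^ ?d / (1 - \<theta>) * C powr \<theta>"
      using power_mult_distrib[of "12::real" 2 ?d] by simp
    finally show ?thesis by (simp only: mult.assoc[symmetric])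
  qed
  finally show "epowr (koethe_ext N (\<lambda>x. epowr (maximal_op g x) p)) \<theta>
      \<le> ennreal (2 * 24 ^ ?d / (1 - \<theta>) * C powr \<theta>) * Y g"
    by (simp add: mult_left_mono mult_right_mono)
qed measurable

section \<open>Adjoints of linearised maximal operators and the dual of the power space\<close>

lemma absorb_ennreal:
  assumes "L < top" "K < top" "L \<le> ennreal \<alpha> * K + ennreal ((p - 1) / p) * L" "\<alpha> \<ge> 0"
  shows "L \<le> ennreal (p * \<alpha>) * K"
proof -
  obtain l where l: "L = ennreal l" "l \<ge> 0" using assms(1) by (cases L) auto
  obtain k where k: "K = ennreal k" "k \<ge> 0" using assms(2) by (cases K) auto
  have "ennreal l \<le> ennreal (\<alpha> * k + (p - 1) / p * l)"
  proof -
    have nn: "0 \<le> \<alpha> * k" "0 \<le> (p - 1) / p" "0 \<le> (p - 1) / p * l" using assms(4) l k p_gt_1 by auto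
    show ?thesis
      using assms(3) unfolding l(1) k(1)
      by (simp only: ennreal_plus[OF nn(1,3)] ennreal_mult[OF assms(4) k(2)] ennreal_mult[OF nn(2) l(2)])
  qed
  then have "l \<le> \<alpha> * k + (p - 1) / p * l"
    using assms(4) l k p_gt_1 by (subst (asm) ennreal_le_iff) auto
  \<comment> \<open>The coefficient left on l is 1 - (p - 1) / p = 1 / p, whence the factor
    p.\<close>
  then have "l \<le> p * \<alpha> * k" using p_gt_1 by (simp add: field_simps)
  then show ?thesis using l k assms(4) p_gt_1 by (simp add: ennreal_leI flip: ennreal_mult)
qed

lemma dual_operator_le:
  assumes k: "k \<in> fspace Y" and F: "F \<subseteq> grid A" "finite F"
    and E: "disjoint_family_on E F" "\<And>Q. Q \<in> F \<Longrightarrow> E Q \<subseteq> Q" "\<And>Q. Q \<in> F \<Longrightarrow> E Q \<in> sets lebesgue"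
    and a: "\<And>Q. a Q \<ge> 0" "\<And>Q. Q \<in> F \<Longrightarrow> ennreal (a Q) * emeasure lebesgue Q = (\<integral>\<^sup>+x\<in>E Q. ennreal \<bar>k x\<bar> \<partial>lebesgue)"
    and T: "T = (\<lambda>x. \<Sum>Q\<in>F. a Q * indicator Q x)"
  shows "T \<in> fspace Y" "Y T \<le> ennreal (p * C) * Y k"
proof -
  have nF: "nested F" by (rule nested_subset[OF nested_grid F(1)])
  \<comment> \<open>A step function over finitely many bounded cells; this gives the finiteness of
    \<open>G T\<close> that the absorption below requires.\<close>
  show TY: "T \<in> fspace Y"
    unfolding T using F grid_bounded by (intro step_function_in_fspace_Y a nestedD(1)[OF nF]) auto
  have [measurable]: "T \<in> borel_measurable lebesgue" "k \<in> borel_measurable lebesgue"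
    using TY k by (auto simp: fspace_def)
  have T0: "T x \<ge> 0" for x unfolding T using a(1) by (auto intro!: sum_nonneg)
  \<comment> \<open>With this weight the coefficient of \<open>G T\<close> is (p - 1) C / m = (p -
    1) / p < 1. Absorption then gives p m^(p - 1) C = m^p in front of \<open>G k\<close>, so the
    norm bound is m itself.\<close>
  let ?m = "p * C"
  have m: "?m > 0" using p_gt_1 C_pos by simp
  have fin: "G T < top" "G k < top" using TY k by (auto simp: fspace_Y_iff)
  have "G T \<le> ennreal (?m powr (p - 1) * C) * G k + ennreal ((p - 1) / p) * G T"
  proof (subst G_def, rule koethe_ext_least)
    fix f :: "'a \<Rightarrow> real"
    assume f [measurable]: "f \<in> borel_measurable lebesgue" and Nf: "N f = 1"
    have fs: "f \<in> fspace N" using f Nf by (simp add: fspace_def)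
    have "(\<integral>\<^sup>+x. ennreal \<bar>f x\<bar> * ennreal (T x powr p) \<partial>lebesgue)
      \<le> (\<integral>\<^sup>+x. ennreal p * (ennreal \<bar>k x\<bar> * ennreal (T x powr (p - 1))) * maximal_op f x \<partial>lebesgue)"
      using F by (intro nested_dual_powr_le[OF nF F(2) _ _ _ _ E a p_gt_1]) (auto simp: T intro!: avg_grid_le_maximal)
    also have "\<dots> \<le> (\<integral>\<^sup>+x. ennreal (?m powr (p - 1)) * (ennreal (\<bar>k x\<bar> powr p) * maximal_op f x)
        + ennreal ((p - 1) / ?m) * (ennreal (\<bar>T x\<bar> powr p) * maximal_op f x) \<partial>lebesgue)"
    proof (rule nn_integral_mono)
      fix x
      have "p * (\<bar>k x\<bar> * T x powr (p - 1)) \<le> ?m powr (p - 1) * \<bar>k x\<bar> powr p + (p - 1) / ?m * \<bar>T x\<bar> powr p"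
        using powr_young_scaled[OF p_gt_1 m, of "\<bar>k x\<bar>" "T x"] T0[of x] by simp
      then have "ennreal (p * (\<bar>k x\<bar> * T x powr (p - 1))) \<le> ennreal (?m powr (p - 1) * \<bar>k x\<bar> powr p + (p - 1) / ?m * \<bar>T x\<bar> powr p)"
        by (rule ennreal_leI)
      also have "\<dots> = ennreal (?m powr (p - 1)) * ennreal (\<bar>k x\<bar> powr p) + ennreal ((p - 1) / ?m) * ennreal (\<bar>T x\<bar> powr p)"
      proof -
        have nn: "0 \<le> ?m powr (p - 1)" "0 \<le> \<bar>k x\<bar> powr p" "0 \<le> (p - 1) / ?m" "0 \<le> \<bar>T x\<bar> powr p"
          using p_gt_1 m by auto
        show ?thesis
          by (simp only: ennreal_plus[OF mult_nonneg_nonneg[OF nn(1,2)] mult_nonneg_nonneg[OF nn(3,4)]]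
              ennreal_mult[OF nn(1,2)] ennreal_mult[OF nn(3,4)])
      qed
      finally have "ennreal (p * (\<bar>k x\<bar> * T x powr (p - 1))) * maximal_op f x
        \<le> (ennreal (?m powr (p - 1)) * ennreal (\<bar>k x\<bar> powr p) + ennreal ((p - 1) / ?m) * ennreal (\<bar>T x\<bar> powr p)) * maximal_op f x"
        by (rule mult_right_mono) simp
      then show "ennreal p * (ennreal \<bar>k x\<bar> * ennreal (T x powr (p - 1))) * maximal_op f x
        \<le> ennreal (?m powr (p - 1)) * (ennreal (\<bar>k x\<bar> powr p) * maximal_op f x)
        + ennreal ((p - 1) / ?m) * (ennreal (\<bar>T x\<bar> powr p) * maximal_op f x)"
        using p_gt_1 by (simp add: ennreal_mult distrib_right mult.assoc)
    qed
    also have "\<dots> = ennreal (?m powr (p - 1)) * (\<integral>\<^sup>+x. ennreal (\<bar>k x\<bar> powr p) * maximal_op f x \<partial>lebesgue)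
      + ennreal ((p - 1) / ?m) * (\<integral>\<^sup>+x. ennreal (\<bar>T x\<bar> powr p) * maximal_op f x \<partial>lebesgue)"
      by (subst nn_integral_add, measurable, subst (1 2) nn_integral_cmult, measurable)
    also have "\<dots> \<le> ennreal (?m powr (p - 1)) * (ennreal C * N f * G k) + ennreal ((p - 1) / ?m) * (ennreal C * N f * G T)"
      unfolding G_def by (intro add_mono mult_left_mono maximal_pairing fs) auto
    also have "\<dots> = ennreal (?m powr (p - 1) * C) * G k + ennreal ((p - 1) / p) * G T"
    proof -
      have "ennreal (?m powr (p - 1) * C) = ennreal (?m powr (p - 1)) * ennreal C"
        using C_nonneg by (intro ennreal_mult) auto
      moreover have "ennreal ((p - 1) / ?m) * ennreal C = ennreal ((p - 1) / p)"
        using C_pos p_gt_1 by (simp flip: ennreal_mult)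
      ultimately show ?thesis by (simp add: Nf mult.assoc[symmetric])
    qed
    finally show "(\<integral>\<^sup>+x. ennreal \<bar>f x\<bar> * ennreal (\<bar>T x\<bar> powr p) \<partial>lebesgue)
      \<le> ennreal (?m powr (p - 1) * C) * G k + ennreal ((p - 1) / p) * G T"
      using T0 by simp
  qed
  then have "G T \<le> ennreal (p * (?m powr (p - 1) * C)) * G k"
    using fin C_nonneg by (intro absorb_ennreal) auto
  also have "p * (?m powr (p - 1) * C) = ?m powr p"
    using m by (simp add: powr_diff)
  finally have "Y T \<le> epowr (ennreal (?m powr p) * G k) \<theta>"
    unfolding Y_eq by (intro epowr_mono \<theta>)
  also have "\<dots> = ennreal ?m * Y k"
    using m by (simp add: epowr_mult \<theta> Y_eq epowr_ennreal powr_powr \<theta>_p)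
  finally show "Y T \<le> ennreal ?m * Y k" .
qed

text \<open>The linearised maximal operator is moved onto k: the pairing equals that of |h| with the
  adjoint \<open>T\<close> of k, which lies in Y with a controlled norm.\<close>

lemma family_max_pairing:
  assumes h [measurable]: "h \<in> borel_measurable lebesgue" and k: "k \<in> fspace Y" and F: "F \<subseteq> grid A" "finite F"
  shows "(\<integral>\<^sup>+ x. ennreal \<bar>k x\<bar> * family_max F h x \<partial>lebesgue) \<le> ennreal (p * C) * (koethe_dual Y h * Y k)"
proof -
  have [measurable]: "k \<in> borel_measurable lebesgue" using k by (simp add: fspace_def)
  have nF: "nested F" by (rule nested_subset[OF nested_grid F(1)])
  obtain E where E: "disjoint_family_on E F" "\<And>Q. Q \<in> F \<Longrightarrow> E Q \<subseteq> Q" "\<And>Q. Q \<in> F \<Longrightarrow> E Q \<in> sets lebesgue"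
    "\<And>x. family_max F h x = (\<Sum>Q\<in>F. avg h Q * indicator (E Q) x)"
    using family_max_linearization[OF F(2) nestedD(1)[OF nF], of h] by auto
  \<comment> \<open>The coefficients of the adjoint. The masses over the bounded sets
    \<open>E Q\<close> are finite, so \<open>enn2real\<close> loses nothing.\<close>
  define a where "a = (\<lambda>Q. enn2real ((\<integral>\<^sup>+x\<in>E Q. ennreal \<bar>k x\<bar> \<partial>lebesgue) / emeasure lebesgue Q))"
  have a0: "a Q \<ge> 0" for Q by (simp add: a_def)
  have a: "ennreal (a Q) * emeasure lebesgue Q = (\<integral>\<^sup>+x\<in>E Q. ennreal \<bar>k x\<bar> \<partial>lebesgue)" if Q: "Q \<in> F" for Q
  proof -
    have "bounded (E Q)" using grid_bounded E(2)[OF Q] F(1) Q by (meson bounded_subset subsetD)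
    then have fin: "(\<integral>\<^sup>+x\<in>E Q. ennreal \<bar>k x\<bar> \<partial>lebesgue) < top" by (rule Y_local_integrable[OF k])
    note pos = nestedD(2,3)[OF nF Q]
    have "(\<integral>\<^sup>+x\<in>E Q. ennreal \<bar>k x\<bar> \<partial>lebesgue) / emeasure lebesgue Q < top"
      using fin pos by (auto simp: less_top[symmetric] ennreal_divide_eq_top_iff)
    then show ?thesis
      using pos by (simp add: a_def ennreal_divide_times)
  qed
  define T where "T = (\<lambda>x. \<Sum>Q\<in>F. a Q * indicator Q x)"
  have T: "T \<in> fspace Y" "Y T \<le> ennreal (p * C) * Y k"
    using dual_operator_le[OF k F E(1-3) a0 a T_def] by auto
  have "(\<integral>\<^sup>+ x. ennreal \<bar>k x\<bar> * family_max F h x \<partial>lebesgue)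
    = (\<integral>\<^sup>+ x. (\<Sum>Q\<in>F. avg h Q * (ennreal \<bar>k x\<bar> * indicator (E Q) x)) \<partial>lebesgue)"
    by (intro nn_integral_cong) (simp only: E(4) sum_distrib_left mult.left_commute)
  also have "\<dots> = (\<Sum>Q\<in>F. \<integral>\<^sup>+ x. avg h Q * (ennreal \<bar>k x\<bar> * indicator (E Q) x) \<partial>lebesgue)"
    using E(3) by (intro nn_integral_sum borel_measurable_times_ennreal borel_measurable_indicator) measurable
  also have "\<dots> = (\<Sum>Q\<in>F. avg h Q * (\<integral>\<^sup>+ x\<in>E Q. ennreal \<bar>k x\<bar> \<partial>lebesgue))"
    using E(3) by (intro sum.cong refl nn_integral_cmult borel_measurable_times_ennreal borel_measurable_indicator) measurable
  \<comment> \<open>The exchange of the operator with its adjoint: either term is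
    \<open>avg h Q\<close> times \<open>a Q\<close> times |Q|.\<close>
  also have "\<dots> = (\<Sum>Q\<in>F. ennreal (a Q) * (\<integral>\<^sup>+ x\<in>Q. ennreal \<bar>h x\<bar> \<partial>lebesgue))"
  proof (rule sum.cong[OF refl])
    fix Q assume Q: "Q \<in> F"
    show "avg h Q * (\<integral>\<^sup>+ x\<in>E Q. ennreal \<bar>k x\<bar> \<partial>lebesgue) = ennreal (a Q) * (\<integral>\<^sup>+ x\<in>Q. ennreal \<bar>h x\<bar> \<partial>lebesgue)"
      unfolding a[OF Q, symmetric] avg_mult_emeasure[OF nestedD(2,3)[OF nF Q], symmetric] by (simp add: mult_ac)
  qed
  also have "\<dots> = (\<Sum>Q\<in>F. \<integral>\<^sup>+ x. ennreal (a Q) * (ennreal \<bar>h x\<bar> * indicator Q x) \<partial>lebesgue)"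
    using nestedD(1)[OF nF] by (intro sum.cong refl nn_integral_cmult[symmetric] borel_measurable_times_ennreal borel_measurable_indicator) measurable
  also have "\<dots> = (\<integral>\<^sup>+ x. (\<Sum>Q\<in>F. ennreal (a Q) * (ennreal \<bar>h x\<bar> * indicator Q x)) \<partial>lebesgue)"
    using nestedD(1)[OF nF] by (intro nn_integral_sum[symmetric] borel_measurable_times_ennreal borel_measurable_indicator) measurable
  also have "\<dots> = (\<integral>\<^sup>+ x. ennreal \<bar>T x\<bar> * ennreal \<bar>h x\<bar> \<partial>lebesgue)"
  proof (rule nn_integral_cong)
    fix x
    have "T x \<ge> 0" unfolding T_def using a0 by (auto intro!: sum_nonneg)
    then have "ennreal \<bar>T x\<bar> = ennreal (\<Sum>Q\<in>F. a Q * indicator Q x)" by (simp add: T_def)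
    also have "\<dots> = (\<Sum>Q\<in>F. ennreal (a Q * indicator Q x))"
      using a0 by (intro sum_ennreal[symmetric]) auto
    also have "\<dots> = (\<Sum>Q\<in>F. ennreal (a Q) * indicator Q x)"
      by (intro sum.cong) (auto simp: indicator_def)
    finally have eq: "ennreal \<bar>T x\<bar> = (\<Sum>Q\<in>F. ennreal (a Q) * indicator Q x)" .
    show "(\<Sum>Q\<in>F. ennreal (a Q) * (ennreal \<bar>h x\<bar> * indicator Q x)) = ennreal \<bar>T x\<bar> * ennreal \<bar>h x\<bar>"
      unfolding eq sum_distrib_right by (intro sum.cong refl) (simp only: mult_ac)
  qed
  also have "\<dots> \<le> Y T * koethe_ext Y (\<lambda>x. ennreal \<bar>h x\<bar>)"
    by (rule Y_hoelder[OF T(1)]) measurable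
  also have "\<dots> \<le> ennreal (p * C) * Y k * koethe_dual Y h"
    unfolding koethe_dual_eq_ext[of Y] by (intro mult_right_mono T) auto
  finally show ?thesis by (simp add: mult_ac)
qed

text \<open>The bilinear form of (b). It is kept as a pairing because the sparse bound uses it
  directly, with the maximal function of g in the place of k. The constant is the 6^d of the grids
  times their number times p C.\<close>

lemma maximal_pairing_Y:
  assumes h [measurable]: "h \<in> borel_measurable lebesgue" and k: "k \<in> fspace Y"
  shows "(\<integral>\<^sup>+ x. ennreal \<bar>k x\<bar> * maximal_op h x \<partial>lebesgue) \<le> ennreal (12 ^ DIM('a) / \<theta> * C) * (koethe_dual Y h * Y k)"
proof -
  have [measurable]: "k \<in> borel_measurable lebesgue" using k by (simp add: fspace_def)
  let ?B = "ennreal (p * C) * (koethe_dual Y h * Y k)"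
  have m [measurable]: "family_max (grid A) h \<in> borel_measurable lebesgue" for A
    by (rule borel_measurable_family_max_grid[OF subset_refl])
  have le: "(\<integral>\<^sup>+ x. ennreal \<bar>k x\<bar> * family_max (grid A) h x \<partial>lebesgue) \<le> ?B" for A
  proof -
    obtain F where F: "incseq F" "\<And>n. finite (F n)" "(\<Union>n. F n) = grid A"
      by (rule countable_finite_exhaustion[OF countable_grid[of A]]) blast
    have sub: "F n \<subseteq> grid A" for n using F(3) by auto
    have "(\<integral>\<^sup>+ x. ennreal \<bar>k x\<bar> * family_max (grid A) h x \<partial>lebesgue) = (SUP n. \<integral>\<^sup>+ x. ennreal \<bar>k x\<bar> * family_max (F n) h x \<partial>lebesgue)"
      unfolding family_max_SUP[OF F(3)]
      by (intro nn_integral_mult_SUP incseq_family_max F borel_measurable_family_max_grid[OF sub]) measurable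
    also have "\<dots> \<le> ?B" by (intro SUP_least family_max_pairing[OF h k sub F(2)])
    finally show ?thesis .
  qed
  have "(\<integral>\<^sup>+ x. ennreal \<bar>k x\<bar> * maximal_op h x \<partial>lebesgue)
    \<le> (\<integral>\<^sup>+ x. ennreal (6 ^ DIM('a)) * (\<Sum>A\<in>Pow Basis. ennreal \<bar>k x\<bar> * family_max (grid A) h x) \<partial>lebesgue)"
  proof (rule nn_integral_mono)
    fix x
    show "ennreal \<bar>k x\<bar> * maximal_op h x \<le> ennreal (6 ^ DIM('a)) * (\<Sum>A\<in>Pow Basis. ennreal \<bar>k x\<bar> * family_max (grid A) h x)"
      using mult_left_mono[OF maximal_op_le_grids[of h x], of "ennreal \<bar>k x\<bar>"]
      by (simp only: sum_distrib_left mult.left_commute zero_le simp_thms)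
  qed
  also have "\<dots> = ennreal (6 ^ DIM('a)) * (\<Sum>A\<in>Pow Basis. \<integral>\<^sup>+ x. ennreal \<bar>k x\<bar> * family_max (grid A) h x \<partial>lebesgue)"
    by (subst nn_integral_cmult, measurable, subst nn_integral_sum, measurable)
  also have "\<dots> \<le> ennreal (6 ^ DIM('a)) * (\<Sum>A\<in>Pow (Basis :: 'a set). ?B)"
    by (intro mult_left_mono sum_mono le) simp
  also have "\<dots> = ennreal (6 ^ DIM('a)) * (ennreal (2 ^ DIM('a)) * ?B)"
    by (simp add: card_Pow_Basis ennreal_power[symmetric])
  also have "\<dots> = ennreal (12 ^ DIM('a) / \<theta> * C) * (koethe_dual Y h * Y k)"
  proof -
    have nn: "0 \<le> (6 ^ DIM('a) :: real)" "0 \<le> (2 ^ DIM('a) :: real)" "0 \<le> p * C" using p_gt_1 C_nonneg by auto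
    have "ennreal (6 ^ DIM('a)) * (ennreal (2 ^ DIM('a)) * ennreal (p * C)) = ennreal (6 ^ DIM('a) * (2 ^ DIM('a) * (p * C)))"
      by (simp only: ennreal_mult[OF nn(1) mult_nonneg_nonneg[OF nn(2,3)]] ennreal_mult[OF nn(2,3)])
    also have "6 ^ DIM('a) * (2 ^ DIM('a) * (p * C)) = 12 ^ DIM('a) / \<theta> * C"
      using power_mult_distrib[of "6::real" 2 "DIM('a)"] by (simp add: p_def)
    finally show ?thesis by (simp only: mult.assoc[symmetric])
  qed
  finally show ?thesis .
qed

lemma maximal_bounded_Y_dual: "bounded_on (koethe_dual Y) maximal_op (12 ^ DIM('a) / \<theta> * C)"
  unfolding bounded_on_def
proof (intro ballI conjI)
  fix h assume "h \<in> fspace (koethe_dual Y)"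
  then have h [measurable]: "h \<in> borel_measurable lebesgue" and fin: "koethe_dual Y h < top" by (auto simp: fspace_def)
  show "(\<lambda>x. enn2real (maximal_op h x)) \<in> borel_measurable lebesgue" by measurable
  \<comment> \<open>Pairing with the indicator of a cube, an element of Y, bounds the integral of
    the maximal function over that cube.\<close>
  show "AE x in lebesgue. maximal_op h x < \<infinity>"
  proof (rule AE_if_AE_on_cubes)
    fix Q :: "'a set" assume Q: "is_cube Q"
    note [measurable] = is_cube_sets[OF Q]
    have "bounded Q" using Q by (auto simp: is_cube_def)
    then have k: "indicator Q \<in> fspace Y"
      by (intro bounded_in_fspace_Y[where S = Q and B = 1]) (auto simp: indicator_def)
    have "(\<integral>\<^sup>+ x. ennreal \<bar>indicator Q x\<bar> * maximal_op h x \<partial>lebesgue)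
      \<le> ennreal (12 ^ DIM('a) / \<theta> * C) * (koethe_dual Y h * Y (indicator Q))"
      by (rule maximal_pairing_Y[OF h k])
    also have "\<dots> < top" using fin k by (auto simp: fspace_def ennreal_mult_less_top)
    finally have "AE x in lebesgue. ennreal \<bar>indicator Q x\<bar> * maximal_op h x \<noteq> \<infinity>"
      by (intro nn_integral_PInf_AE) auto
    then show "AE x in lebesgue. x \<in> Q \<longrightarrow> maximal_op h x < \<infinity>"
      by eventually_elim (auto simp: less_top[symmetric])
  qed
  show "koethe_dual Y (\<lambda>x. enn2real (maximal_op h x)) \<le> ennreal (12 ^ DIM('a) / \<theta> * C) * koethe_dual Y h"
    unfolding koethe_dual_eq_ext[of Y "\<lambda>x. enn2real (maximal_op h x)"]
  proof (rule koethe_ext_least)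
    fix k :: "'a \<Rightarrow> real" assume "k \<in> borel_measurable lebesgue" and Yk: "Y k = 1"
    then have k: "k \<in> fspace Y" by (simp add: fspace_def)
    have "(\<integral>\<^sup>+ x. ennreal \<bar>k x\<bar> * ennreal \<bar>enn2real (maximal_op h x)\<bar> \<partial>lebesgue)
      \<le> (\<integral>\<^sup>+ x. ennreal \<bar>k x\<bar> * maximal_op h x \<partial>lebesgue)"
      by (intro nn_integral_mono mult_left_mono) (auto simp: ennreal_enn2real_if)
    also have "\<dots> \<le> ennreal (12 ^ DIM('a) / \<theta> * C) * (koethe_dual Y h * Y k)"
      by (rule maximal_pairing_Y[OF h k])
    finally show "(\<integral>\<^sup>+ x. ennreal \<bar>k x\<bar> * ennreal \<bar>enn2real (maximal_op h x)\<bar> \<partial>lebesgue)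
      \<le> ennreal (12 ^ DIM('a) / \<theta> * C) * koethe_dual Y h" by (simp add: Yk)
  qed
qed

end

section \<open>Sparse operators\<close>

text \<open>Inside one cube the measures of the disjoint pieces have bounded sums, so only countably
  many are nonzero, and countably many cubes exhaust the space. This makes sparse collections
  countable, as needed for measurability and monotone limits of their operators.\<close>

lemma countable_disjoint_positive_measure:
  fixes E :: "'i \<Rightarrow> 'a::euclidean_space set"
  assumes disj: "disjoint_family_on E S" and sets: "\<And>i. i \<in> S \<Longrightarrow> E i \<in> sets lebesgue"
    and pos: "\<And>i. i \<in> S \<Longrightarrow> emeasure lebesgue (E i) > 0"
  shows "countable S"
proof -
  obtain B :: "nat \<Rightarrow> 'a set" where B: "\<And>n. is_cube (B n)" "\<And>x. \<exists>n. x \<in> B n"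
    by (rule exhausting_cubes) blast
  define m where "m = (\<lambda>n i. measure lebesgue (E i \<inter> B n))"
  note Bs = is_cube_sets[OF B(1)]
  have fin: "emeasure lebesgue (E i \<inter> B n) < top" if "i \<in> S" for i n
  proof -
    have "emeasure lebesgue (E i \<inter> B n) \<le> emeasure lebesgue (B n)" using Bs by (intro emeasure_mono) auto
    then show ?thesis using is_cube_emeasure(2)[OF B(1)] by (rule le_less_trans)
  qed
  have "countable {i\<in>S. m n i \<noteq> 0}" for n
  proof (rule summable_countable_real, rule nonneg_bdd_above_summable_on)
    show "bdd_above (sum (m n) ` {F. F \<subseteq> S \<and> finite F})"
    proof (rule bdd_aboveI2)
      fix F assume F: "F \<in> {F. F \<subseteq> S \<and> finite F}"
      have eq: "ennreal (m n i) = (\<integral>\<^sup>+x\<in>E i. indicator (B n) x \<partial>lebesgue)" if "i \<in> F" for i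
      proof -
        have i: "i \<in> S" using F that by auto
        have "(\<integral>\<^sup>+x\<in>E i. indicator (B n) x \<partial>lebesgue) = (\<integral>\<^sup>+x. indicator (E i \<inter> B n) x \<partial>lebesgue)"
          by (intro nn_integral_cong) (auto simp: indicator_def)
        also have "\<dots> = emeasure lebesgue (E i \<inter> B n)" using sets[OF i] Bs by (intro nn_integral_indicator) auto
        finally show ?thesis using fin[OF i] by (simp add: m_def emeasure_eq_ennreal_measure less_top)
      qed
      have "ennreal (sum (m n) F) = (\<Sum>i\<in>F. ennreal (m n i))"
        by (intro sum_ennreal[symmetric]) (simp add: m_def)
      also have "\<dots> = (\<Sum>i\<in>F. \<integral>\<^sup>+x\<in>E i. indicator (B n) x \<partial>lebesgue)"
        by (intro sum.cong refl eq)
      also have "\<dots> \<le> (\<integral>\<^sup>+x. indicator (B n) x \<partial>lebesgue)"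
        using F sets Bs by (intro sum_nn_integral_disjoint_le disjoint_family_on_mono[OF _ disj]) auto
      also have "\<dots> = ennreal (measure lebesgue (B n))"
        using Bs is_cube_emeasure(2)[OF B(1)] by (simp add: emeasure_eq_ennreal_measure less_top)
      finally show "sum (m n) F \<le> measure lebesgue (B n)" by (simp add: ennreal_le_iff)
    qed
  qed (simp add: m_def)
  then have "countable (\<Union>n. {i\<in>S. m n i \<noteq> 0})" by auto
  moreover have "S \<subseteq> (\<Union>n. {i\<in>S. m n i \<noteq> 0})"
  proof
    fix i assume i: "i \<in> S"
    show "i \<in> (\<Union>n. {i\<in>S. m n i \<noteq> 0})"
    proof (rule ccontr)
      assume "\<not> ?thesis"
      then have "m n i = 0" for n using i by auto
      then have "emeasure lebesgue (E i \<inter> B n) = 0" for n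
        using fin[OF i, of n] by (simp add: m_def emeasure_eq_ennreal_measure less_top)
      then have "emeasure lebesgue (\<Union>n. E i \<inter> B n) = 0"
        using sets[OF i] Bs by (intro emeasure_UN_eq_0) auto
      moreover have "(\<Union>n. E i \<inter> B n) = E i" using B(2) by auto
      ultimately show False using pos[OF i] by simp
    qed
  qed
  ultimately show ?thesis by (rule countable_subset[rotated])
qed

lemma sparseE:
  assumes "sparse S"
  obtains E where "disjoint_family_on E S" "\<And>Q. Q \<in> S \<Longrightarrow> E Q \<subseteq> Q"
    "\<And>Q. Q \<in> S \<Longrightarrow> E Q \<in> sets lebesgue"
    "\<And>Q. Q \<in> S \<Longrightarrow> emeasure lebesgue (E Q) \<ge> emeasure lebesgue Q / 2"
    "\<And>Q. Q \<in> S \<Longrightarrow> is_cube Q"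
proof -
  from assms obtain E where "disjoint_family_on E S" and "\<forall>Q\<in>S. E Q \<subseteq> Q \<and> E Q \<in> sets lebesgue \<and>
      emeasure lebesgue (E Q) \<ge> emeasure lebesgue Q / 2" and "\<forall>Q\<in>S. is_cube Q"
    unfolding sparse_def by (elim conjE exE)
  then show ?thesis by (intro that[of E]) auto
qed

lemma sparse_countable:
  assumes "sparse S" shows "countable S"
proof -
  obtain E where E: "disjoint_family_on E S" "\<And>Q. Q \<in> S \<Longrightarrow> E Q \<subseteq> Q" "\<And>Q. Q \<in> S \<Longrightarrow> E Q \<in> sets lebesgue"
    "\<And>Q. Q \<in> S \<Longrightarrow> emeasure lebesgue (E Q) \<ge> emeasure lebesgue Q / 2"
    and cube: "\<And>Q. Q \<in> S \<Longrightarrow> is_cube Q"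
    by (rule sparseE[OF assms]) blast
  show ?thesis
  proof (rule countable_disjoint_positive_measure[OF E(1,3)])
    fix Q assume Q: "Q \<in> S"
    have "0 < emeasure lebesgue Q / 2"
      using is_cube_emeasure[OF cube[OF Q]] by (simp add: ennreal_zero_less_divide)
    then show "emeasure lebesgue (E Q) > 0" using E(4)[OF Q] by (rule less_le_trans)
  qed
qed

text \<open>Every finite subfamily lies in some \<open>F n\<close>, so the supremum over a directed
  family becomes one along an increasing sequence, to which monotone convergence applies.\<close>

lemma sparse_op_SUP:
  assumes F: "incseq F" "\<And>n. finite (F n)" "(\<Union>n. F n) = S"
  shows "sparse_op S f x = (SUP n. \<Sum>Q\<in>F n. avg f Q * indicator Q x)"
  unfolding sparse_op_def
proof (rule antisym)
  show "(SUP G\<in>{G. finite G \<and> G \<subseteq> S}. \<Sum>Q\<in>G. avg f Q * indicator Q x) \<le> (SUP n. \<Sum>Q\<in>F n. avg f Q * indicator Q x)"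
  proof (rule SUP_least)
    fix G assume "G \<in> {G. finite G \<and> G \<subseteq> S}"
    then have G: "finite G" "G \<subseteq> (\<Union>n. F n)" using F(3) by auto
    then have "\<forall>Q\<in>G. \<exists>n. Q \<in> F n" by auto
    then obtain r where r: "\<forall>Q\<in>G. Q \<in> F (r Q)" by (rule bchoice[THEN exE])
    define n where "n = Max (insert 0 (r ` G))"
    have "G \<subseteq> F n"
    proof
      fix Q assume Q: "Q \<in> G"
      then have "r Q \<le> n" unfolding n_def using G(1) by (intro Max_ge) auto
      then show "Q \<in> F n" using r Q incseqD[OF F(1)] by blast
    qed
    then have "(\<Sum>Q\<in>G. avg f Q * indicator Q x) \<le> (\<Sum>Q\<in>F n. avg f Q * indicator Q x)"
      using F(2) by (intro sum_mono2) auto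
    then show "(\<Sum>Q\<in>G. avg f Q * indicator Q x) \<le> (SUP n. \<Sum>Q\<in>F n. avg f Q * indicator Q x)"
      by (rule SUP_upper2[OF UNIV_I])
  qed
  show "(SUP n. \<Sum>Q\<in>F n. avg f Q * indicator Q x) \<le> (SUP G\<in>{G. finite G \<and> G \<subseteq> S}. \<Sum>Q\<in>G. avg f Q * indicator Q x)"
    using F by (intro SUP_mono) auto
qed

section \<open>Sparse bounds on the power space\<close>

context maximal_bounded_power
begin

text \<open>As l is the p-th power of the norm of T in Y, the bound is this norm to the power p - 1.
  It is Hoelder's inequality with weight |f| and exponents p and p / (p - 1), obtained from Young's
  inequality.\<close>

lemma ext_product_le:
  assumes f [measurable]: "f \<in> borel_measurable lebesgue" and Nf: "N f = 1"
    and T: "T \<in> fspace Y" "\<And>x. T x \<ge> 0" and l: "G T = ennreal l" "l > 0"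
  shows "koethe_dual Y (\<lambda>x. \<bar>f x\<bar> * T x powr (p - 1)) \<le> ennreal (l powr (1 - \<theta>))"
  unfolding koethe_dual_eq_ext[of Y]
proof (rule koethe_ext_least)
  fix k :: "'a \<Rightarrow> real" assume k [measurable]: "k \<in> borel_measurable lebesgue" and Yk: "Y k = 1"
  have [measurable]: "T \<in> borel_measurable lebesgue" using T(1) by (simp add: fspace_def)
  have Gk: "G k = 1" using G_eq[of k] Yk epowr_ennreal[of 1 p] by simp
  \<comment> \<open>The weight is the norm of T itself. Both terms then contain
    \<open>l powr (1 - \<theta>)\<close>, with coefficients 1 / p and (p - 1) / p, which add up to
    1.\<close>
  let ?m = "l powr \<theta>"
  have m: "?m > 0" using l by simp
  have mp: "?m powr (p - 1) = l powr (1 - \<theta>)" by (simp add: powr_powr algebra_simps \<theta>_p)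
  have ml: "1 / ?m * l = l powr (1 - \<theta>)" using l by (simp add: powr_diff)
  have "(\<integral>\<^sup>+ x. ennreal \<bar>k x\<bar> * ennreal \<bar>\<bar>f x\<bar> * T x powr (p - 1)\<bar> \<partial>lebesgue)
    \<le> (\<integral>\<^sup>+ x. ennreal (?m powr (p - 1) / p) * (ennreal \<bar>f x\<bar> * ennreal (\<bar>k x\<bar> powr p))
        + ennreal ((p - 1) / ?m / p) * (ennreal \<bar>f x\<bar> * ennreal (\<bar>T x\<bar> powr p)) \<partial>lebesgue)"
  proof (rule nn_integral_mono)
    fix x
    have "p * (\<bar>k x\<bar> * T x powr (p - 1)) \<le> ?m powr (p - 1) * \<bar>k x\<bar> powr p + (p - 1) / ?m * \<bar>T x\<bar> powr p"
      using powr_young_scaled[OF p_gt_1 m, of "\<bar>k x\<bar>" "T x"] T(2)[of x] by simp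
    then have "\<bar>k x\<bar> * T x powr (p - 1) \<le> (?m powr (p - 1) * \<bar>k x\<bar> powr p + (p - 1) / ?m * \<bar>T x\<bar> powr p) / p"
      using p_gt_1 by (simp add: pos_le_divide_eq mult.commute)
    then have "\<bar>f x\<bar> * (\<bar>k x\<bar> * T x powr (p - 1)) \<le> \<bar>f x\<bar> * ((?m powr (p - 1) * \<bar>k x\<bar> powr p + (p - 1) / ?m * \<bar>T x\<bar> powr p) / p)"
      by (rule mult_left_mono) simp
    also have "\<dots> = ?m powr (p - 1) / p * (\<bar>f x\<bar> * \<bar>k x\<bar> powr p) + (p - 1) / ?m / p * (\<bar>f x\<bar> * \<bar>T x\<bar> powr p)"
      by (simp add: add_divide_distrib distrib_left mult_ac)
    finally have "ennreal (\<bar>f x\<bar> * (\<bar>k x\<bar> * T x powr (p - 1))) \<le> ennreal (?m powr (p - 1) / p * (\<bar>f x\<bar> * \<bar>k x\<bar> powr p) + (p - 1) / ?m / p * (\<bar>f x\<bar> * \<bar>T x\<bar> powr p))"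
      by (rule ennreal_leI)
    also have "\<dots> = ennreal (?m powr (p - 1) / p) * (ennreal \<bar>f x\<bar> * ennreal (\<bar>k x\<bar> powr p))
        + ennreal ((p - 1) / ?m / p) * (ennreal \<bar>f x\<bar> * ennreal (\<bar>T x\<bar> powr p))"
    proof -
      have nn: "0 \<le> ?m powr (p - 1) / p" "0 \<le> (p - 1) / ?m / p" "0 \<le> \<bar>f x\<bar>" "0 \<le> \<bar>k x\<bar> powr p" "0 \<le> \<bar>T x\<bar> powr p"
        using p_gt_1 m by auto
      note a = mult_nonneg_nonneg[OF nn(3,4)] and b = mult_nonneg_nonneg[OF nn(3,5)]
      show ?thesis
        by (simp only: ennreal_plus[OF mult_nonneg_nonneg[OF nn(1) a] mult_nonneg_nonneg[OF nn(2) b]]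
            ennreal_mult[OF nn(1) a] ennreal_mult[OF nn(2) b] ennreal_mult[OF nn(3,4)] ennreal_mult[OF nn(3,5)])
    qed
    also have "ennreal (\<bar>f x\<bar> * (\<bar>k x\<bar> * T x powr (p - 1))) = ennreal \<bar>k x\<bar> * ennreal \<bar>\<bar>f x\<bar> * T x powr (p - 1)\<bar>"
      by (simp add: abs_mult mult_ac flip: ennreal_mult)
    finally show "ennreal \<bar>k x\<bar> * ennreal \<bar>\<bar>f x\<bar> * T x powr (p - 1)\<bar>
      \<le> ennreal (?m powr (p - 1) / p) * (ennreal \<bar>f x\<bar> * ennreal (\<bar>k x\<bar> powr p))
        + ennreal ((p - 1) / ?m / p) * (ennreal \<bar>f x\<bar> * ennreal (\<bar>T x\<bar> powr p))" .
  qed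
  also have "\<dots> = ennreal (?m powr (p - 1) / p) * (\<integral>\<^sup>+ x. ennreal \<bar>f x\<bar> * ennreal (\<bar>k x\<bar> powr p) \<partial>lebesgue)
      + ennreal ((p - 1) / ?m / p) * (\<integral>\<^sup>+ x. ennreal \<bar>f x\<bar> * ennreal (\<bar>T x\<bar> powr p) \<partial>lebesgue)"
    by (subst nn_integral_add, measurable, subst (1 2) nn_integral_cmult, measurable)
  also have "\<dots> \<le> ennreal (?m powr (p - 1) / p) * G k + ennreal ((p - 1) / ?m / p) * G T"
    unfolding G_def by (intro add_mono mult_left_mono koethe_ext_upper f Nf) auto
  also have "\<dots> = ennreal (?m powr (p - 1) / p + (p - 1) / ?m / p * l)"
    unfolding Gk l(1) using p_gt_1 l(2) by (simp add: ennreal_plus ennreal_mult[symmetric])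
  also have "?m powr (p - 1) / p + (p - 1) / ?m / p * l = l powr (1 - \<theta>)"
  proof -
    have "(p - 1) / ?m / p * l = (p - 1) / p * (1 / ?m * l)" by simp
    also have "\<dots> = (p - 1) / p * l powr (1 - \<theta>)" by (simp only: ml)
    finally show ?thesis using p_gt_1 by (simp add: mp field_simps)
  qed
  finally show "(\<integral>\<^sup>+ x. ennreal \<bar>k x\<bar> * ennreal \<bar>\<bar>f x\<bar> * T x powr (p - 1)\<bar> \<partial>lebesgue) \<le> ennreal (l powr (1 - \<theta>))" .
qed

text \<open>Each term is \<open>avg g Q\<close> times \<open>avg h Q\<close> times |Q|, and
  sparseness bounds |Q| by twice the measure of \<open>E Q\<close>. On \<open>E Q\<close> both
  averages are below the maximal functions, and these sets are disjoint.\<close>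

lemma sparse_form_le:
  assumes F: "finite F" "\<And>Q. Q \<in> F \<Longrightarrow> is_cube Q"
    and E: "disjoint_family_on E F" "\<And>Q. Q \<in> F \<Longrightarrow> E Q \<subseteq> Q" "\<And>Q. Q \<in> F \<Longrightarrow> E Q \<in> sets lebesgue"
      "\<And>Q. Q \<in> F \<Longrightarrow> emeasure lebesgue (E Q) \<ge> emeasure lebesgue Q / 2"
    and [measurable]: "h \<in> borel_measurable lebesgue"
  shows "(\<integral>\<^sup>+ x. (\<Sum>Q\<in>F. avg g Q * indicator Q x) * ennreal \<bar>h x\<bar> \<partial>lebesgue)
    \<le> 2 * (\<integral>\<^sup>+ x. maximal_op g x * maximal_op h x \<partial>lebesgue)"
proof -
  have "(\<integral>\<^sup>+ x. (\<Sum>Q\<in>F. avg g Q * indicator Q x) * ennreal \<bar>h x\<bar> \<partial>lebesgue)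
    = (\<integral>\<^sup>+ x. (\<Sum>Q\<in>F. avg g Q * (ennreal \<bar>h x\<bar> * indicator Q x)) \<partial>lebesgue)"
    unfolding sum_distrib_right by (intro nn_integral_cong sum.cong refl) (simp only: mult_ac)
  also have "\<dots> = (\<Sum>Q\<in>F. \<integral>\<^sup>+ x. avg g Q * (ennreal \<bar>h x\<bar> * indicator Q x) \<partial>lebesgue)"
    using is_cube_sets[OF F(2)] by (intro nn_integral_sum borel_measurable_times_ennreal borel_measurable_indicator) measurable
  also have "\<dots> \<le> (\<Sum>Q\<in>F. \<integral>\<^sup>+ x\<in>E Q. (2 * (maximal_op g x * maximal_op h x)) \<partial>lebesgue)"
  proof (rule sum_mono)
    fix Q assume Q: "Q \<in> F"
    note [measurable] = is_cube_sets[OF F(2)[OF Q]] E(3)[OF Q]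
    note pos = is_cube_emeasure[OF F(2)[OF Q]]
    have "(\<integral>\<^sup>+ x. avg g Q * (ennreal \<bar>h x\<bar> * indicator Q x) \<partial>lebesgue) = avg g Q * (avg h Q * emeasure lebesgue Q)"
      unfolding avg_mult_emeasure[OF pos] by (rule nn_integral_cmult) measurable
    also have "\<dots> \<le> avg g Q * (avg h Q * (2 * emeasure lebesgue (E Q)))"
    proof (intro mult_left_mono)
      have "emeasure lebesgue Q = 2 * (emeasure lebesgue Q / 2)" by (simp add: ennreal_times_divide mult.commute[of 2] mult_divide_eq_ennreal)
      also have "\<dots> \<le> 2 * emeasure lebesgue (E Q)" by (intro mult_left_mono E Q) auto
      finally show "emeasure lebesgue Q \<le> 2 * emeasure lebesgue (E Q)" .
    qed auto
    also have "\<dots> = (\<integral>\<^sup>+ x. (2 * (avg g Q * avg h Q)) * indicator (E Q) x \<partial>lebesgue)"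
      by (subst nn_integral_cmult_indicator) (auto simp: mult_ac)
    also have "\<dots> \<le> (\<integral>\<^sup>+ x\<in>E Q. (2 * (maximal_op g x * maximal_op h x)) \<partial>lebesgue)"
    proof (rule nn_integral_mono)
      fix x
      show "2 * (avg g Q * avg h Q) * indicator (E Q) x \<le> 2 * (maximal_op g x * maximal_op h x) * indicator (E Q) x"
      proof (cases "x \<in> E Q")
        case True
        then have "x \<in> Q" using E(2)[OF Q] by auto
        then show ?thesis
          using F(2)[OF Q] by (intro mult_right_mono mult_left_mono mult_mono avg_cube_le_maximal) auto
      qed simp
    qed
    finally show "(\<integral>\<^sup>+ x. avg g Q * (ennreal \<bar>h x\<bar> * indicator Q x) \<partial>lebesgue)
      \<le> (\<integral>\<^sup>+ x\<in>E Q. (2 * (maximal_op g x * maximal_op h x)) \<partial>lebesgue)" .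
  qed
  also have "\<dots> \<le> (\<integral>\<^sup>+ x. 2 * (maximal_op g x * maximal_op h x) \<partial>lebesgue)"
    by (intro sum_nn_integral_disjoint_le F(1) E(1,3)) measurable
  also have "\<dots> = 2 * (\<integral>\<^sup>+ x. maximal_op g x * maximal_op h x \<partial>lebesgue)"
    by (rule nn_integral_cmult) measurable
  finally show ?thesis .
qed

lemma finite_sparse_le:
  assumes F: "finite F" "\<And>Q. Q \<in> F \<Longrightarrow> is_cube Q"
    and E: "disjoint_family_on E F" "\<And>Q. Q \<in> F \<Longrightarrow> E Q \<subseteq> Q" "\<And>Q. Q \<in> F \<Longrightarrow> E Q \<in> sets lebesgue"
      "\<And>Q. Q \<in> F \<Longrightarrow> emeasure lebesgue (E Q) \<ge> emeasure lebesgue Q / 2"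
    and g: "g \<in> fspace Y"
    and a: "bounded_on Y maximal_op Ba" "Ba \<ge> 0"
  shows "epowr (koethe_ext N (\<lambda>x. epowr (\<Sum>Q\<in>F. avg g Q * indicator Q x) p)) \<theta>
    \<le> ennreal (2 * (12 ^ DIM('a) / \<theta> * C) * Ba) * Y g"
proof -
  let ?Bb = "12 ^ DIM('a) / \<theta> * C"
  have Bb: "?Bb \<ge> 0" using \<theta> C_nonneg by simp
  \<comment> \<open>The sparse sum as a real function. It is a step function of bounded support, so
    its norm in Y is known to be finite before it is estimated.\<close>
  define T where "T = (\<lambda>x. \<Sum>Q\<in>F. enn2real (avg g Q) * indicator Q x)"
  have bd: "bounded Q" if "Q \<in> F" for Q using F(2)[OF that] by (auto simp: is_cube_def)
  have TY: "T \<in> fspace Y"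
    unfolding T_def using F bd by (intro step_function_in_fspace_Y is_cube_sets) auto
  have [measurable]: "T \<in> borel_measurable lebesgue" "g \<in> borel_measurable lebesgue"
    using TY g by (auto simp: fspace_def)
  have T0: "T x \<ge> 0" for x unfolding T_def by (auto intro!: sum_nonneg)
  have Te: "(\<Sum>Q\<in>F. avg g Q * indicator Q x) = ennreal (T x)" for x
  proof -
    have "ennreal (T x) = (\<Sum>Q\<in>F. ennreal (enn2real (avg g Q) * indicator Q x))"
      unfolding T_def by (intro sum_ennreal[symmetric]) auto
    also have "\<dots> = (\<Sum>Q\<in>F. avg g Q * indicator Q x)"
    proof (rule sum.cong[OF refl])
      fix Q assume Q: "Q \<in> F"
      have "avg g Q < top" by (rule avg_finite[OF g bd[OF Q] is_cube_emeasure(1)[OF F(2)[OF Q]]])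
      then show "ennreal (enn2real (avg g Q) * indicator Q x) = avg g Q * indicator Q x"
        by (auto simp: indicator_def)
    qed
    finally show ?thesis by simp
  qed
  have GT: "koethe_ext N (\<lambda>x. epowr (\<Sum>Q\<in>F. avg g Q * indicator Q x) p) = G T"
    unfolding G_def Te using T0 by (simp add: epowr_ennreal)
  have fin: "G T < top" "Y g < top" using TY g by (simp_all add: fspace_Y_iff Y_finite_iff)
  show ?thesis
  \<comment> \<open>The argument ends by cancelling \<open>l powr (1 - \<theta>)\<close>, which
    requires l to be positive.\<close>
  proof (cases "G T = 0")
    case True
    then show ?thesis unfolding GT by simp
  next
    case False
    with fin obtain l where l: "G T = ennreal l" "l > 0" by (cases "G T") (auto simp: less_le)
    obtain y where y: "Y g = ennreal y" "y \<ge> 0" using fin by (cases "Y g") auto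
    \<comment> \<open>A real-valued representative of the maximal function of g. The assumption on
      \<open>Ba\<close> places it in Y, so it may serve as k in
      \<open>maximal_pairing_Y\<close>.\<close>
    let ?u = "\<lambda>x. enn2real (maximal_op g x)"
    have Mg: "AE x in lebesgue. maximal_op g x < top" "Y ?u \<le> ennreal Ba * Y g"
      using a(1) g unfolding bounded_on_def by auto
    have "ennreal Ba * Y g < top" using fin by (simp add: ennreal_mult_less_top)
    with Mg(2) have "Y ?u < top" by (rule le_less_trans)
    then have uY: "?u \<in> fspace Y" by (simp add: fspace_def)
    have "ennreal l \<le> ennreal (2 * ?Bb * Ba * y * l powr (1 - \<theta>))"
      unfolding l(1)[symmetric] G_def
    proof (rule koethe_ext_least)
      fix f :: "'a \<Rightarrow> real"
      assume f [measurable]: "f \<in> borel_measurable lebesgue" and Nf: "N f = 1"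
      define h where "h = (\<lambda>x. \<bar>f x\<bar> * T x powr (p - 1))"
      have hm [measurable]: "h \<in> borel_measurable lebesgue" unfolding h_def by measurable
      have hY: "koethe_dual Y h \<le> ennreal (l powr (1 - \<theta>))"
        unfolding h_def by (rule ext_product_le[OF f Nf TY T0 l])
      have "(\<integral>\<^sup>+ x. ennreal \<bar>f x\<bar> * ennreal (\<bar>T x\<bar> powr p) \<partial>lebesgue)
        = (\<integral>\<^sup>+ x. (\<Sum>Q\<in>F. avg g Q * indicator Q x) * ennreal \<bar>h x\<bar> \<partial>lebesgue)"
      proof (rule nn_integral_cong)
        fix x
        have "T x powr p = T x * T x powr (p - 1)"
          using T0[of x] by (cases "T x = 0") (auto simp: powr_diff)
        then have "\<bar>f x\<bar> * \<bar>T x\<bar> powr p = T x * \<bar>h x\<bar>"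
          using T0[of x] by (simp add: h_def abs_mult)
        then show "ennreal \<bar>f x\<bar> * ennreal (\<bar>T x\<bar> powr p) = (\<Sum>Q\<in>F. avg g Q * indicator Q x) * ennreal \<bar>h x\<bar>"
          unfolding Te using T0[of x] by (simp flip: ennreal_mult)
      qed
      also have "\<dots> \<le> 2 * (\<integral>\<^sup>+ x. maximal_op g x * maximal_op h x \<partial>lebesgue)"
        by (rule sparse_form_le[OF F E hm])
      also have "(\<integral>\<^sup>+ x. maximal_op g x * maximal_op h x \<partial>lebesgue) = (\<integral>\<^sup>+ x. ennreal \<bar>?u x\<bar> * maximal_op h x \<partial>lebesgue)"
        using Mg(1) by (intro nn_integral_cong_AE, eventually_elim) simp
      also have "\<dots> \<le> ennreal ?Bb * (koethe_dual Y h * Y ?u)"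
        by (rule maximal_pairing_Y[OF hm uY])
      also have "\<dots> \<le> ennreal ?Bb * (ennreal (l powr (1 - \<theta>)) * (ennreal Ba * Y g))"
        by (intro mult_left_mono mult_mono hY Mg(2)) auto
      also have "2 * \<dots> = ennreal (2 * ?Bb * Ba * y * l powr (1 - \<theta>))"
      proof -
        have "ennreal (2 * (?Bb * (l powr (1 - \<theta>) * (Ba * y))))
          = ennreal 2 * (ennreal ?Bb * (ennreal (l powr (1 - \<theta>)) * (ennreal Ba * ennreal y)))"
          using Bb a(2) y(2) by (simp only: ennreal_mult mult_nonneg_nonneg powr_ge_zero zero_le_numeral)
        then show ?thesis unfolding y(1) by (simp add: mult_ac)
      qed
      finally show "(\<integral>\<^sup>+ x. ennreal \<bar>f x\<bar> * ennreal (\<bar>T x\<bar> powr p) \<partial>lebesgue)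
        \<le> ennreal (2 * ?Bb * Ba * y * l powr (1 - \<theta>))"
        by (simp add: mult_left_mono)
    qed
    moreover have nn: "0 \<le> 2 * ?Bb * Ba * y" using \<theta> C_nonneg a(2) y(2) by (intro mult_nonneg_nonneg) auto
    ultimately have "l \<le> (2 * ?Bb * Ba * y) * l powr (1 - \<theta>)"
      using ennreal_le_iff[OF mult_nonneg_nonneg[OF nn powr_ge_zero]] by blast
    moreover have "l = l powr \<theta> * l powr (1 - \<theta>)" using l(2) by (simp flip: powr_add)
    ultimately have "l powr \<theta> * l powr (1 - \<theta>) \<le> (2 * ?Bb * Ba * y) * l powr (1 - \<theta>)" by argo
    \<comment> \<open>Cancelling the factor contributed by the dual norm of h leaves
      \<open>l powr \<theta>\<close>, the norm of T in Y.\<close>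
    then have "l powr \<theta> \<le> 2 * ?Bb * Ba * y" by (rule mult_right_le_imp_le) (use l(2) in simp)
    then have "ennreal (l powr \<theta>) \<le> ennreal (2 * ?Bb * Ba * y)" by (rule ennreal_leI)
    also have "\<dots> = ennreal (2 * ?Bb * Ba) * Y g"
      unfolding y(1) using Bb a(2) y(2) by (intro ennreal_mult mult_nonneg_nonneg[OF _ a(2)]) auto
    finally show ?thesis unfolding GT l(1) using l(2) by (simp add: epowr_ennreal)
  qed
qed

text \<open>The bound for finite subfamilies is uniform. Restated without the outer root, it passes
  to the monotone limit over an exhaustion of the sparse collection.\<close>

lemma sparse_bounded_Y:
  assumes a: "bounded_on Y maximal_op Ba" "Ba \<ge> 0"
  shows "A_sparse Y (2 * (12 ^ DIM('a) / \<theta> * C) * Ba)"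
  unfolding A_sparse_def
proof (intro allI impI)
  fix S :: "'a set set" assume S: "sparse S"
  let ?B = "2 * (12 ^ DIM('a) / \<theta> * C) * Ba"
  have p0: "p > 0" using p_gt_1 by simp
  obtain F where F: "incseq F" "\<And>n. finite (F n)" "(\<Union>n. F n) = S"
    by (rule countable_finite_exhaustion[OF sparse_countable[OF S]]) blast
  obtain E where E: "disjoint_family_on E S" "\<And>Q. Q \<in> S \<Longrightarrow> E Q \<subseteq> Q" "\<And>Q. Q \<in> S \<Longrightarrow> E Q \<in> sets lebesgue"
    "\<And>Q. Q \<in> S \<Longrightarrow> emeasure lebesgue (E Q) \<ge> emeasure lebesgue Q / 2"
    and cube: "\<And>Q. Q \<in> S \<Longrightarrow> is_cube Q"
    by (rule sparseE[OF S]) blast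
  have FS: "Q \<in> S" if "Q \<in> F n" for Q n using F(3) that by auto
  have m: "(\<lambda>x. \<Sum>Q\<in>F n. avg g Q * indicator Q x) \<in> borel_measurable lebesgue" for n g
    using is_cube_sets[OF cube[OF FS]]
    by (intro borel_measurable_sum borel_measurable_times_ennreal borel_measurable_indicator) auto
  have eq: "sparse_op S g = (\<lambda>x. SUP n. \<Sum>Q\<in>F n. avg g Q * indicator Q x)" for g
    by (rule ext) (rule sparse_op_SUP[OF F])
  show "bounded_on Y (sparse_op S) ?B"
  proof (rule bounded_on_YI)
    fix g assume g: "g \<in> fspace Y"
    show "sparse_op S g \<in> borel_measurable lebesgue"
      unfolding eq by (intro borel_measurable_SUP m) auto
    have "koethe_ext N (\<lambda>x. epowr (sparse_op S g x) p) = koethe_ext N (\<lambda>x. SUP n. epowr (\<Sum>Q\<in>F n. avg g Q * indicator Q x) p)"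
      by (simp only: eq epowr_SUP[OF p0])
    also have "\<dots> \<le> epowr (ennreal ?B * Y g) p"
    proof (rule koethe_ext_SUP_le)
      show "incseq (\<lambda>n x. epowr (\<Sum>Q\<in>F n. avg g Q * indicator Q x) p)"
        using F(1,2) unfolding incseq_def le_fun_def
        by (intro allI impI epowr_mono p0 sum_mono2) auto
      show "(\<lambda>x. epowr (\<Sum>Q\<in>F n. avg g Q * indicator Q x) p) \<in> borel_measurable lebesgue" for n
        by (rule borel_measurable_epowr[OF m])
      fix n
      have "epowr (koethe_ext N (\<lambda>x. epowr (\<Sum>Q\<in>F n. avg g Q * indicator Q x) p)) \<theta> \<le> ennreal ?B * Y g"
        using FS by (intro finite_sparse_le[OF F(2) _ disjoint_family_on_mono[OF _ E(1)] _ _ _ g a] cube E) auto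
      then show "koethe_ext N (\<lambda>x. epowr (\<Sum>Q\<in>F n. avg g Q * indicator Q x) p) \<le> epowr (ennreal ?B * Y g) p"
        using epowr_le_iff[OF \<theta>(1)] by (simp add: p_def)
    qed
    finally show "epowr (koethe_ext N (\<lambda>x. epowr (sparse_op S g x) p)) \<theta> \<le> ennreal ?B * Y g"
      using epowr_le_iff[OF \<theta>(1)] by (simp add: p_def)
  qed
qed

end

section \<open>A common constant for the three estimates\<close>

lemma bounded_on_mono:
  assumes "bounded_on N T B" "B \<le> B'" shows "bounded_on N T B'"
  unfolding bounded_on_def
proof (intro ballI conjI)
  fix f assume f: "f \<in> fspace N"
  note * = assms(1)[unfolded bounded_on_def, rule_format, OF f]
  show "AE x in lebesgue. T f x < \<infinity>" "(\<lambda>x. enn2real (T f x)) \<in> borel_measurable lebesgue"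
    using * by auto
  have "N (\<lambda>x. enn2real (T f x)) \<le> ennreal B * N f" using * by auto
  also have "\<dots> \<le> ennreal B' * N f" by (intro mult_right_mono ennreal_leI assms(2)) simp
  finally show "N (\<lambda>x. enn2real (T f x)) \<le> ennreal B' * N f" .
qed

theorem theorem4p2:
  "\<exists>c::real. c > 0 \<and>
     (\<forall>(N :: 'a::euclidean_space fnorm) (\<theta>::real) (C::real).
        quasi_banach_function_space N \<longrightarrow> fatou_property N \<longrightarrow>
        C \<ge> 0 \<longrightarrow> bounded_on N maximal_op C \<longrightarrow> 0 < \<theta> \<longrightarrow> \<theta> < 1 \<longrightarrow>
        bounded_on (fpower (koethe_dual N) \<theta>) maximal_op
                   (c / (1 - \<theta>) * C powr \<theta>) \<and>
        bounded_on (koethe_dual (fpower (koethe_dual N) \<theta>)) maximal_op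
                   (c / \<theta> * C) \<and>
        A_sparse (fpower (koethe_dual N) \<theta>)
                 (c / \<theta> / (1 - \<theta>) * C powr (1 + \<theta>)))"
proof (intro exI[of _ "4 * 12 ^ DIM('a) * 24 ^ DIM('a)"] conjI allI impI)
  \<comment> \<open>The product of the numerical factors of the sparse bound: 2 for sparseness, 12^d
    from (b) and 2 times 24^d from (a). It dominates the factors of (a) and (b), so one constant
    serves all three estimates.\<close>
  let ?c = "4 * 12 ^ DIM('a) * 24 ^ DIM('a) :: real"
  show "?c > 0" by simp
  have c1: "2 * 24 ^ DIM('a) \<le> ?c" "12 ^ DIM('a) \<le> ?c"
  proof -
    have a: "1 \<le> (12::real) ^ DIM('a)" and b: "1 \<le> (24::real) ^ DIM('a)" by simp_all
    show "2 * 24 ^ DIM('a) \<le> ?c" using mult_right_mono[OF a, of "24 ^ DIM('a)"] b by linarith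
    show "12 ^ DIM('a) \<le> ?c" using mult_left_mono[OF b, of "12 ^ DIM('a)"] a by linarith
  qed
  fix N :: "'a fnorm" and \<theta> C :: real
  assume "quasi_banach_function_space N" "C \<ge> 0" "bounded_on N maximal_op C" "0 < \<theta>" "\<theta> < 1"
  then interpret maximal_bounded_power N C \<theta> by unfold_locales
  let ?Ba = "2 * 24 ^ DIM('a) / (1 - \<theta>) * C powr \<theta>"
  show "bounded_on Y maximal_op (?c / (1 - \<theta>) * C powr \<theta>)"
    using c1 \<theta> by (intro bounded_on_mono[OF maximal_bounded_Y] mult_right_mono divide_right_mono) auto
  show "bounded_on (koethe_dual Y) maximal_op (?c / \<theta> * C)"
    using c1 \<theta> C_nonneg by (intro bounded_on_mono[OF maximal_bounded_Y_dual] mult_right_mono divide_right_mono) auto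
  have "A_sparse Y (2 * (12 ^ DIM('a) / \<theta> * C) * ?Ba)"
    using \<theta> by (intro sparse_bounded_Y maximal_bounded_Y) auto
  also have "2 * (12 ^ DIM('a) / \<theta> * C) * ?Ba = ?c / \<theta> / (1 - \<theta>) * C powr (1 + \<theta>)"
    using C_pos by (simp add: powr_add)
  finally show "A_sparse Y (?c / \<theta> / (1 - \<theta>) * C powr (1 + \<theta>))" .
qed

end
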